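(* For every uncountable cardinal $\kappa\leq 2^{\aleph_0}$ there exist $2^\kappa$ incomparable, totally pathwise disconnected, first countable linearly ordered continua of weight $\kappa$.
   Context: A linearly ordered space is a topological space whose topology is the order topology of some linear ordering of its point set. A continuum is a compact connected Hausdorff space with more than one point. A linearly ordered continuum is a linearly ordered space that is a continuum. A space is totally pathwise disconnected if all its path components are singletons. Spaces $X_i$ $(i\in I)$ are called incomparable if $X_i$ is not homeomorphic to a subspace of $X_j$ whenever $i,j\in I$ and $i\neq j$. *)

theory Defs
  imports "HOL-Analysis.Analysis"
begin

unbundle cardinal_syntax

text \<open>Cardinals are represented as in the library by cardinal well-orders (\<^const>\<open>card_order_on\<close>)
  and compared up to \<^const>\<open>ordIso2\<close>.\<close>

text \<open>The set \<open>S\<close> is itself a generator so that the carrier is also right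
  when \<open>S\<close> has at most one point.\<close>

definition order_topology_on :: "'a set \<Rightarrow> 'a rel \<Rightarrow> 'a topology" where
  "order_topology_on S r =
     topology_generated_by
       (insert S
         ((\<lambda>a. {x \<in> S. (a, x) \<in> r \<and> x \<noteq> a}) ` S \<union>
          (\<lambda>a. {x \<in> S. (x, a) \<in> r \<and> x \<noteq> a}) ` S))"

definition linearly_ordered_space :: "'a topology \<Rightarrow> bool" where
  "linearly_ordered_space X \<longleftrightarrow>
     (\<exists>r. linear_order_on (topspace X) r \<and> X = order_topology_on (topspace X) r)"

definition continuum :: "'a topology \<Rightarrow> bool" where
  "continuum X \<longleftrightarrow>
     compact_space X \<and> connected_space X \<and> Hausdorff_space X \<and>
     (\<exists>x\<in>topspace X. \<exists>y\<in>topspace X. x \<noteq> y)"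

definition linearly_ordered_continuum :: "'a topology \<Rightarrow> bool" where
  "linearly_ordered_continuum X \<longleftrightarrow> linearly_ordered_space X \<and> continuum X"

definition totally_pathwise_disconnected :: "'a topology \<Rightarrow> bool" where
  "totally_pathwise_disconnected X \<longleftrightarrow> (\<forall>C\<in>path_components_of X. \<exists>x. C = {x})"

definition base_of :: "'a topology \<Rightarrow> 'a set set \<Rightarrow> bool" where
  "base_of X B \<longleftrightarrow> openin X = arbitrary union_of (\<lambda>U. U \<in> B)"

text \<open>The least cardinality of a base. No convention about rounding finite weights up to
  \<open>\<aleph>\<^sub>0\<close> is built in. The minimum is attained because cardinals are well-ordered, so the
  choice operator picks a base of least cardinality.\<close>

definition weight :: "'a topology \<Rightarrow> 'a set rel" where
  "weight X = |SOME B. base_of X B \<and> (\<forall>B'. base_of X B' \<longrightarrow> |B| \<le>o |B'| )|"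

definition embeds_in :: "'a topology \<Rightarrow> 'b topology \<Rightarrow> bool" where
  "embeds_in X Y \<longleftrightarrow> (\<exists>S\<subseteq>topspace Y. X homeomorphic_space subtopology Y S)"

text \<open>A space embeds in itself, so an incomparable indexed family is injective and can be given
  as a set of spaces. When the spaces are first countable and compact Hausdorff, each has at most
  \<open>2\<^sup>\<aleph>\<^sup>0\<close> points (Arhangel'skii), so topologies on subsets of the bare point set of \<open>real\<close>
  cover all of them up to homeomorphism.\<close>

definition incomparable_spaces :: "'a topology set \<Rightarrow> bool" where
  "incomparable_spaces F \<longleftrightarrow> pairwise (\<lambda>X Y. \<not> embeds_in X Y) F"

end

theory Submission
  imports Defs "HOL-Library.Countable_Set_Type"
begin

text \<open>
  The continua are lexicographically ordered sets of transfinite digit sequences. Every node of a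
  tree of countable sequences stands for a copy of the unit interval; the points of that copy which
  are digits allowed at the node are blown up to copies belonging to the child nodes, and so on, and
  the points of the continuum are the maximal branches. Suprema can be computed digit by digit, so
  the order is complete, and it is dense. The tree has no branch of length \<open>\<omega>\<^sub>1\<close>; so a point has
  only countably many digits that matter, which gives first countability. Every node has
  extensions of every countable length; so a countable set of points misses an open interval inside
  any given interval (\<open>nowhere_separable\<close>), whereas the image of a path is separable. Finally
  \<open>\<kappa>\<close> nodes give a base of size \<open>\<kappa>\<close>, and a node with \<open>\<kappa>\<close> children gives \<open>\<kappa>\<close> disjoint open
  intervals.

  The main point is to make \<open>2\<^sup>\<kappa>\<close> such continua incomparable. The order types of sets of
  reals are useless for this purpose: it is consistent that all \<open>\<aleph>\<^sub>1\<close>-dense sets of reals are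
  isomorphic (Baumgartner). Instead a rank for intervals is used. An interval has rank at most \<open>n + 1\<close>
  if every continuous monotone real function on it has at most countably many fibres that are not
  of rank at most \<open>n\<close>; only one-point intervals have rank \<open>0\<close>. If all nodes have countably many
  children, taken from one countable set of digits \<open>Q\<close>, and all levels of the tree are
  countable, then every interval has rank at most \<open>1\<close> (\<open>thin_flat\<close>). Such a tree is an Aronszajn
  tree; it consists of the finite modifications of a coherent sequence of finite-to-one functions.
  If the first \<open>r\<close> levels use instead an everywhere uncountable set of digits, then the rank is
  exactly \<open>r + 1\<close> (\<open>thin_ranked\<close>, \<open>not_thin_ranked\<close>).

  A point is special of type \<open>n\<close> if near it the rank is \<open>1\<close> on one side and \<open>n + 1\<close> on the other.
  Inside an interval built with \<open>r\<close> uncountable levels there are no special points with \<open>n \<ge> 2\<close>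
  (\<open>not_special_ranked\<close>), so the types in an interval of rank \<open>1\<close> with isolated blocks of higher
  rank inserted are exactly the chosen numbers. This codes a real \<open>a\<close> by an interval whose
  set of types is \<open>code a\<close> (\<open>types_code_block\<close>), and the sets \<open>code a\<close> are pairwise
  incomparable. For a set \<open>S\<close> of reals the continuum is the unit interval with each \<open>a\<close> in
  \<open>Q \<union> S\<close> blown up to an interval coding \<open>a\<close>.

  An embedding of connected linearly ordered spaces preserves betweenness, hence rank and types.
  It maps the interval coding \<open>a\<close> onto an interval which either is part of a single interval coding some
  \<open>b\<close>, and then \<open>code a \<subseteq> code b\<close> and \<open>a = b\<close>, or contains two whole coding intervals, and
  then \<open>code a\<close> contains two different codes, which is impossible. So the set \<open>S\<close> of one
  continuum is contained in \<open>Q \<union> T\<close> for the set \<open>T\<close> of the other (\<open>coded_set_mono\<close>), and it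
  remains to take \<open>2\<^sup>\<kappa>\<close> sets disjoint from \<open>Q\<close> none of which contains another.
\<close>

section \<open>The first uncountable ordinal\<close>

typedef omega1 = "Field (cardSuc natLeq)"
proof -
  have "infinite (Field (cardSuc natLeq))"
    using Cinfinite_cardSuc natLeq_Cinfinite by (auto simp: cinfinite_def)
  then show ?thesis by (metis ex_in_conv finite.emptyI)
qed

instantiation omega1 :: wellorder
begin

definition less_eq_omega1 :: "omega1 \<Rightarrow> omega1 \<Rightarrow> bool" where
  "x \<le> y \<longleftrightarrow> (Rep_omega1 x, Rep_omega1 y) \<in> cardSuc natLeq"

definition less_omega1 :: "omega1 \<Rightarrow> omega1 \<Rightarrow> bool" where
  "x < y \<longleftrightarrow> x \<le> y \<and> x \<noteq> (y :: omega1)"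

instance
proof -
  let ?r = "cardSuc natLeq"
  have wo: "Well_order ?r"
    by (simp add: cardSuc_Well_order natLeq_Card_order)
  have lin: "Linear_order ?r" and wf: "wf (?r - Id)"
    using wo by (auto simp: well_order_on_def)
  have refl: "Refl ?r" and trans: "trans ?r" and anti: "antisym ?r" and total: "Total ?r"
    using lin by (auto simp: linear_order_on_def partial_order_on_def preorder_on_def)
  show "OFCLASS(omega1, wellorder_class)"
  proof
    fix x y z :: omega1
    show "x \<le> x"
      using refl Rep_omega1[of x] by (auto simp: less_eq_omega1_def refl_on_def)
    show "x \<le> z" if "x \<le> y" "y \<le> z"
      using that trans by (auto simp: less_eq_omega1_def trans_def)
    show le_anti: "x = y" if "x \<le> y" "y \<le> x"
      using antisymD[OF anti, of "Rep_omega1 x" "Rep_omega1 y"] that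
      by (auto simp: less_eq_omega1_def Rep_omega1_inject)
    show "x < y \<longleftrightarrow> x \<le> y \<and> \<not> y \<le> x"
      using antisymD[OF anti, of "Rep_omega1 x" "Rep_omega1 y"] \<open>x \<le> x\<close>
      by (auto simp: less_omega1_def less_eq_omega1_def Rep_omega1_inject)
    show "x \<le> y \<or> y \<le> x"
      using total refl Rep_omega1[of x] Rep_omega1[of y]
      unfolding less_eq_omega1_def total_on_def refl_on_def
      by (cases "Rep_omega1 x = Rep_omega1 y") metis+
  next
    fix P :: "omega1 \<Rightarrow> bool" and a :: omega1
    assume step: "\<And>x. (\<And>y. y < x \<Longrightarrow> P y) \<Longrightarrow> P x"
    have "wf {(x, y). x < (y :: omega1)}"
    proof (rule wf_subset)
      show "wf (inv_image (?r - Id) Rep_omega1)"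
        using wf by (rule wf_inv_image)
      show "{(x, y). x < (y :: omega1)} \<subseteq> inv_image (?r - Id) Rep_omega1"
        by (auto simp: less_omega1_def less_eq_omega1_def Rep_omega1_inject)
    qed
    then show "P a"
      by (induction a rule: wf_induct_rule) (auto intro: step)
  qed
qed

end

lemma countable_below: "countable {..<\<beta> :: omega1}"
proof -
  let ?r = "cardSuc natLeq"
  have co: "Card_order ?r" by (simp add: cardSuc_Card_order natLeq_Card_order)
  have "|underS ?r (Rep_omega1 \<beta>)| <o ?r"
    using card_of_underS[OF co Rep_omega1] .
  then have "|underS ?r (Rep_omega1 \<beta>)| \<le>o natLeq"
    by (simp add: cardSuc_ordLeq_ordLess natLeq_Card_order card_of_Card_order)
  then have "countable (underS ?r (Rep_omega1 \<beta>))"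
    using countable_card_le_natLeq by blast
  moreover have "Rep_omega1 ` {..<\<beta>} \<subseteq> underS ?r (Rep_omega1 \<beta>)"
    by (auto simp: underS_def less_omega1_def less_eq_omega1_def Rep_omega1_inject)
  ultimately have "countable (Rep_omega1 ` {..<\<beta>})"
    using countable_subset by blast
  then show ?thesis
    by (rule countable_image_inj_on) (meson Rep_omega1_inject inj_onI)
qed

lemma card_omega1: "|UNIV :: omega1 set| =o cardSuc natLeq"
proof -
  have "|UNIV :: omega1 set| =o |Field (cardSuc natLeq)|"
    by (rule card_of_ordIsoI[where f = Rep_omega1])
       (simp add: bij_betw_def inj_on_def Rep_omega1_inject
          type_definition.Rep_range[OF type_definition_omega1])
  also have "|Field (cardSuc natLeq)| =o cardSuc natLeq"
    by (simp add: cardSuc_Card_order card_of_Field_ordIso natLeq_Card_order)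
  finally show ?thesis .
qed

lemma uncountable_omega1: "uncountable (UNIV :: omega1 set)"
proof
  assume "countable (UNIV :: omega1 set)"
  then have "|UNIV :: omega1 set| \<le>o natLeq"
    using countable_card_le_natLeq by blast
  then have "cardSuc natLeq \<le>o natLeq"
    using card_omega1 ordIso_ordLeq_trans ordIso_symmetric by blast
  then show False
    using cardSuc_greater[OF natLeq_Card_order] not_ordLess_ordLeq by blast
qed

lemma countable_bounded:
  assumes "countable (M :: omega1 set)"
  obtains \<gamma> where "\<And>\<xi>. \<xi> \<in> M \<Longrightarrow> \<xi> < \<gamma>"
proof -
  have "countable (\<Union>\<xi>\<in>M. {..\<xi>})"
  proof (intro countable_UN assms)
    fix \<xi> :: omega1
    have "{..\<xi>} = insert \<xi> {..<\<xi>}" by auto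
    then show "countable {..\<xi>}" by (simp add: countable_below)
  qed
  then have "(\<Union>\<xi>\<in>M. {..\<xi>}) \<noteq> UNIV"
    using uncountable_omega1 by auto
  then obtain \<gamma> where "\<gamma> \<notin> (\<Union>\<xi>\<in>M. {..\<xi>})" by auto
  then show ?thesis by (intro that[of \<gamma>]) auto
qed

text \<open>Otherwise a countably infinite part of the set would lie below a single bound.\<close>

lemma countable_if_finite_below:
  assumes "\<And>\<beta>. finite {\<xi> \<in> M. \<xi> < (\<beta> :: omega1)}"
  shows "countable M"
proof (rule ccontr)
  assume "uncountable M"
  then obtain C where C: "C \<subseteq> M" "infinite C" "countable C"
    using infinite_countable_subset' uncountable_infinite by metis
  obtain \<gamma> where "\<And>\<xi>. \<xi> \<in> C \<Longrightarrow> \<xi> < \<gamma>"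
    using countable_bounded[OF C(3)] by blast
  then have "C \<subseteq> {\<xi> \<in> M. \<xi> < \<gamma>}" using C(1) by auto
  then show False using assms C(2) finite_subset by blast
qed

definition suc :: "omega1 \<Rightarrow> omega1" where
  "suc \<xi> = (LEAST \<eta>. \<xi> < \<eta>)"

lemma less_suc_iff: "\<eta> < suc \<xi> \<longleftrightarrow> \<eta> \<le> \<xi>" and less_suc: "\<xi> < suc \<xi>"
proof -
  obtain \<gamma> where "\<xi> < \<gamma>" using countable_bounded[of "{\<xi>}"] by auto
  then show 1: "\<xi> < suc \<xi>" unfolding suc_def by (rule LeastI)
  show "\<eta> < suc \<xi> \<longleftrightarrow> \<eta> \<le> \<xi>"
    using 1 not_less_Least[of \<eta> "\<lambda>\<eta>. \<xi> < \<eta>"] by (auto simp: suc_def[symmetric])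
qed

lemma suc_le_iff: "suc \<xi> \<le> \<eta> \<longleftrightarrow> \<xi> < \<eta>"
  using less_suc_iff[of \<eta> \<xi>] by (simp add: not_less[symmetric])

text \<open>The digits at the first positions decide which tree is built below them; these positions
  are the finite ordinals.\<close>

definition fin :: "nat \<Rightarrow> omega1" where
  "fin n = (suc ^^ n) (LEAST \<xi>. True)"

lemma fin_0_le: "fin 0 \<le> \<xi>"
  by (simp add: fin_def Least_le)

lemma fin_Suc: "fin (Suc n) = suc (fin n)"
  by (simp add: fin_def)

lemma strict_mono_fin: "strict_mono fin"
  by (simp add: strict_mono_Suc_iff fin_Suc less_suc)

section \<open>A coherent sequence of finite-to-one functions\<close>

definition enum_below :: "omega1 \<Rightarrow> nat \<Rightarrow> omega1" where
  "enum_below \<beta> = from_nat_into {..<\<beta>}"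

lemma enum_below:
  assumes "\<xi> < \<beta>"
  shows "enum_below \<beta> n < \<beta>" "range (enum_below \<beta>) = {..<\<beta>}"
proof -
  have "{..<\<beta>} \<noteq> {}" using assms by auto
  then show "enum_below \<beta> n < \<beta>" "range (enum_below \<beta>) = {..<\<beta>}"
    using from_nat_into[of "{..<\<beta>}" n] range_from_nat_into[OF _ countable_below]
    unfolding enum_below_def by auto
qed

text \<open>Let \<open>n\<close> be the first index for which the enumeration of the ordinals below \<open>\<beta>\<close> reaches
  an ordinal that is at least \<open>\<xi>\<close>. The value at \<open>\<xi>\<close> is taken over from the function belonging to that
  ordinal; it is \<open>n\<close> if that ordinal is \<open>\<xi>\<close> itself. Raising the value to at least \<open>n\<close> makes the new function finite-to-one. Coherence
  survives: below a fixed \<open>\<alpha>\<close> in the enumeration only finitely many indices \<open>n\<close> occur, so only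
  small values are changed, and these are taken finitely often.\<close>

function coh :: "omega1 \<Rightarrow> omega1 \<Rightarrow> nat" where
  "coh \<beta> \<xi> = (if \<xi> < \<beta> then
     let n = (LEAST n. \<xi> \<le> enum_below \<beta> n)
     in if \<xi> = enum_below \<beta> n then n else max (coh (enum_below \<beta> n) \<xi>) n
   else 0)"
  by auto
termination
  by (relation "inv_image {(x, y). x < y} fst") (auto simp: wf enum_below)

declare coh.simps[simp del]

lemma coh_cases:
  assumes "\<xi> < \<beta>"
  obtains n where "\<And>m. \<xi> \<le> enum_below \<beta> m \<Longrightarrow> n \<le> m" "\<xi> = enum_below \<beta> n" "coh \<beta> \<xi> = n"
    | n where "\<And>m. \<xi> \<le> enum_below \<beta> m \<Longrightarrow> n \<le> m" "\<xi> < enum_below \<beta> n"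
        "coh \<beta> \<xi> = max (coh (enum_below \<beta> n) \<xi>) n"
proof -
  define n where "n = (LEAST n. \<xi> \<le> enum_below \<beta> n)"
  obtain k where "\<xi> = enum_below \<beta> k"
    using enum_below(2)[OF assms] assms by auto
  then have le: "\<xi> \<le> enum_below \<beta> n"
    unfolding n_def by (metis LeastI order_refl)
  have least: "n \<le> m" if "\<xi> \<le> enum_below \<beta> m" for m
    unfolding n_def using that by (rule Least_le)
  have "coh \<beta> \<xi> = (if \<xi> = enum_below \<beta> n then n else max (coh (enum_below \<beta> n) \<xi>) n)"
    using assms by (subst coh.simps) (simp add: n_def Let_def)
  with le least that show thesis
    by (metis order_le_less)
qed

lemma coh_finite_to_one: "finite {\<xi>. \<xi> < \<beta> \<and> coh \<beta> \<xi> \<le> k}"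
proof (induction \<beta> rule: less_induct)
  case (less \<beta>)
  have "{\<xi>. \<xi> < \<beta> \<and> coh \<beta> \<xi> \<le> k} \<subseteq>
      (\<Union>n\<in>{n. n \<le> k \<and> enum_below \<beta> n < \<beta>}.
         insert (enum_below \<beta> n) {\<xi>. \<xi> < enum_below \<beta> n \<and> coh (enum_below \<beta> n) \<xi> \<le> k})"
  proof safe
    fix \<xi> assume "\<xi> < \<beta>" "coh \<beta> \<xi> \<le> k"
    then show "\<xi> \<in> (\<Union>n\<in>{n. n \<le> k \<and> enum_below \<beta> n < \<beta>}.
         insert (enum_below \<beta> n) {\<xi>. \<xi> < enum_below \<beta> n \<and> coh (enum_below \<beta> n) \<xi> \<le> k})"
      by (cases rule: coh_cases[OF \<open>\<xi> < \<beta>\<close>]) (use enum_below(1) in fastforce)+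
  qed
  moreover have "finite \<dots>"
    using less.IH by auto
  ultimately show ?case by (rule finite_subset)
qed

lemma coh_coherent:
  assumes "\<alpha> < \<beta>"
  shows "finite {\<xi>. \<xi> < \<alpha> \<and> coh \<alpha> \<xi> \<noteq> coh \<beta> \<xi>}"
  using assms
proof (induction \<beta> arbitrary: \<alpha> rule: less_induct)
  case (less \<beta>)
  obtain N where N: "\<alpha> = enum_below \<beta> N"
    using enum_below(2)[OF less.prems] less.prems by auto
  have IH: "finite {\<xi>. \<xi> < \<alpha> \<and> \<xi> < \<gamma> \<and> coh \<alpha> \<xi> \<noteq> coh \<gamma> \<xi>}" if "\<gamma> < \<beta>" for \<gamma>
  proof (cases \<alpha> \<gamma> rule: linorder_cases)
    case less': less
    show ?thesis
      by (rule finite_subset[OF _ less.IH[OF that less']]) auto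
  next
    case greater
    show ?thesis
      by (rule finite_subset[OF _ less.IH[OF less.prems greater]]) auto
  qed auto
  have "{\<xi>. \<xi> < \<alpha> \<and> coh \<alpha> \<xi> \<noteq> coh \<beta> \<xi>} \<subseteq>
     (\<Union>n\<le>N. insert (enum_below \<beta> n) ({\<xi>. \<xi> < \<alpha> \<and> \<xi> < enum_below \<beta> n \<and> coh \<alpha> \<xi> \<noteq> coh (enum_below \<beta> n) \<xi>}
        \<union> {\<xi>. \<xi> < \<alpha> \<and> coh \<alpha> \<xi> \<le> n}))"
  proof safe
    fix \<xi> assume \<xi>: "\<xi> < \<alpha>" "coh \<alpha> \<xi> \<noteq> coh \<beta> \<xi>"
    then have "\<xi> < \<beta>" using less.prems by auto
    then show "\<xi> \<in> (\<Union>n\<le>N. insert (enum_below \<beta> n) ({\<xi>. \<xi> < \<alpha> \<and> \<xi> < enum_below \<beta> n \<and> coh \<alpha> \<xi> \<noteq> coh (enum_below \<beta> n) \<xi>}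
        \<union> {\<xi>. \<xi> < \<alpha> \<and> coh \<alpha> \<xi> \<le> n}))"
    proof (cases rule: coh_cases)
      case (1 n)
      then have "n \<le> N" using \<xi>(1) N by auto
      then show ?thesis using 1 by auto
    next
      case (2 n)
      then have n: "n \<le> N" using \<xi>(1) N by auto
      show ?thesis
      proof (cases "coh \<alpha> \<xi> = coh (enum_below \<beta> n) \<xi>")
        case True
        then have "coh \<alpha> \<xi> \<le> n" using 2(3) \<xi>(2) by (auto simp: max_def split: if_splits)
        then show ?thesis using n \<xi>(1) by auto
      qed (use n \<xi> 2 in auto)
    qed
  qed
  moreover have "finite \<dots>"
    using IH enum_below(1)[OF less.prems] coh_finite_to_one by auto
  ultimately show ?case by (rule finite_subset)
qed

section \<open>Lexicographically ordered transfinite digit sequences\<close>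

text \<open>A new type, because functions are already ordered pointwise.\<close>

datatype pt = Pt (dig: "omega1 \<Rightarrow> real")

definition agree :: "omega1 \<Rightarrow> pt \<Rightarrow> pt \<Rightarrow> bool" where
  "agree \<xi> x y \<longleftrightarrow> (\<forall>\<eta><\<xi>. dig x \<eta> = dig y \<eta>)"

lemma agree_refl [simp]: "agree \<xi> x x"
  by (simp add: agree_def)

lemma agree_sym: "agree \<xi> x y \<Longrightarrow> agree \<xi> y x"
  by (simp add: agree_def)

lemma agree_trans: "agree \<xi> x y \<Longrightarrow> agree \<xi> y z \<Longrightarrow> agree \<xi> x z"
  by (simp add: agree_def)

lemma agree_common: "agree \<xi> x a \<Longrightarrow> agree \<xi> x b \<Longrightarrow> agree \<xi> a b"
  by (simp add: agree_def)

lemma agree_le: "agree \<xi> x y \<Longrightarrow> \<eta> \<le> \<xi> \<Longrightarrow> agree \<eta> x y"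
  by (auto simp: agree_def)

lemma agree_suc_iff: "agree (suc \<xi>) x y \<longleftrightarrow> agree \<xi> x y \<and> dig x \<xi> = dig y \<xi>"
  by (auto simp: agree_def less_suc_iff order_le_less)

lemma agree_fin_0 [simp]: "agree (fin 0) x y"
  using fin_0_le by (auto simp: agree_def not_less[symmetric])

lemma first_difference:
  assumes "x \<noteq> y"
  obtains \<xi> where "agree \<xi> x y" "dig x \<xi> \<noteq> dig y \<xi>"
proof -
  define \<xi> where "\<xi> = (LEAST \<xi>. dig x \<xi> \<noteq> dig y \<xi>)"
  have "dig x \<noteq> dig y" using assms by (cases x; cases y) auto
  then obtain \<eta> where "dig x \<eta> \<noteq> dig y \<eta>" by blast
  then have "dig x \<xi> \<noteq> dig y \<xi>" unfolding \<xi>_def by (rule LeastI)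
  moreover have "agree \<xi> x y"
    unfolding agree_def \<xi>_def using not_less_Least by blast
  ultimately show thesis using that by blast
qed

instantiation pt :: linorder
begin

definition less_pt :: "pt \<Rightarrow> pt \<Rightarrow> bool" where
  "x < y \<longleftrightarrow> (\<exists>\<xi>. agree \<xi> x y \<and> dig x \<xi> < dig y \<xi>)"

definition less_eq_pt :: "pt \<Rightarrow> pt \<Rightarrow> bool" where
  "x \<le> y \<longleftrightarrow> x = y \<or> x < (y :: pt)"

instance
proof -
  have asym: False if xy: "x < y" and yx: "y < x" for x y :: pt
  proof -
    from xy obtain \<xi> where \<xi>: "agree \<xi> x y" "dig x \<xi> < dig y \<xi>" by (auto simp: less_pt_def)
    from yx obtain \<zeta> where \<zeta>: "agree \<zeta> y x" "dig y \<zeta> < dig x \<zeta>" by (auto simp: less_pt_def)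
    show False
      using \<xi> \<zeta> by (cases \<xi> \<zeta> rule: linorder_cases) (auto simp: agree_def)
  qed
  have less_trans: "x < z" if xy: "x < y" and yz: "y < z" for x y z :: pt
  proof -
    from xy obtain \<xi> where \<xi>: "agree \<xi> x y" "dig x \<xi> < dig y \<xi>" by (auto simp: less_pt_def)
    from yz obtain \<zeta> where \<zeta>: "agree \<zeta> y z" "dig y \<zeta> < dig z \<zeta>" by (auto simp: less_pt_def)
    have "agree (min \<xi> \<zeta>) x z" using \<xi> \<zeta> by (auto simp: agree_def)
    moreover have "dig x (min \<xi> \<zeta>) < dig z (min \<xi> \<zeta>)"
      using \<xi> \<zeta> by (cases \<xi> \<zeta> rule: linorder_cases) (auto simp: agree_def min_def)
    ultimately show ?thesis unfolding less_pt_def by blast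
  qed
  have total: "x < y \<or> y < x" if neq: "x \<noteq> y" for x y :: pt
    using first_difference[OF neq] agree_sym unfolding less_pt_def by (metis linorder_neqE)
  show "OFCLASS(pt, linorder_class)"
  proof
    fix x y z :: pt
    show "x < y \<longleftrightarrow> x \<le> y \<and> \<not> y \<le> x"
      using asym by (auto simp: less_eq_pt_def)
    show "x \<le> x" by (simp add: less_eq_pt_def)
    show "x \<le> z" if "x \<le> y" "y \<le> z" using that less_trans by (auto simp: less_eq_pt_def)
    show "x = y" if "x \<le> y" "y \<le> x" using that asym by (auto simp: less_eq_pt_def)
    show "x \<le> y \<or> y \<le> x" using total by (auto simp: less_eq_pt_def)
  qed
qed

end

lemma lessI_digit: "agree \<xi> x y \<Longrightarrow> dig x \<xi> < dig y \<xi> \<Longrightarrow> x < y"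
  by (auto simp: less_pt_def)

lemma dig_mono:
  assumes "agree \<xi> x y" "x \<le> y"
  shows "dig x \<xi> \<le> dig y \<xi>"
  using assms lessI_digit[OF agree_sym[OF assms(1)]] by (meson not_le)

lemma agree_between:
  assumes "agree \<xi> x y" "x \<le> z" "z \<le> y"
  shows "agree \<xi> x z"
proof (rule ccontr)
  assume "\<not> agree \<xi> x z"
  then have "x \<noteq> z" by auto
  then obtain \<zeta> where \<zeta>: "agree \<zeta> x z" "dig x \<zeta> \<noteq> dig z \<zeta>"
    using first_difference by blast
  with \<open>\<not> agree \<xi> x z\<close> have "\<zeta> < \<xi>" by (meson agree_le not_le)
  then have "agree \<zeta> z y" "dig x \<zeta> = dig y \<zeta>"
    using assms(1) \<zeta>(1) by (auto simp: agree_def)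
  then show False
    using dig_mono[OF \<zeta>(1) assms(2)] dig_mono[OF _ assms(3)] \<zeta>(2) by fastforce
qed

text \<open>The padding with \<open>0\<close> makes this the least sequence with the given initial part; in the
  trees below, where \<open>0\<close> is never a digit of a node, it is the left end of the block of all
  continuations.\<close>

definition trunc :: "pt \<Rightarrow> omega1 \<Rightarrow> real \<Rightarrow> pt" where
  "trunc x \<xi> d = Pt (\<lambda>\<eta>. if \<eta> < \<xi> then dig x \<eta> else if \<eta> = \<xi> then d else 0)"

lemma dig_trunc: "dig (trunc x \<xi> d) \<eta> = (if \<eta> < \<xi> then dig x \<eta> else if \<eta> = \<xi> then d else 0)"
  by (simp add: trunc_def)

lemma dig_trunc_at [simp]: "dig (trunc x \<xi> d) \<xi> = d"
  by (simp add: dig_trunc)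

lemma agree_trunc [simp]: "agree \<xi> x (trunc x \<xi> d)" "agree \<xi> (trunc x \<xi> d) x"
    "agree \<xi> (trunc x \<xi> d) (trunc x \<xi> d')"
  by (auto simp: agree_def dig_trunc)

lemma trunc_cong: "agree \<xi> x y \<Longrightarrow> trunc x \<xi> d = trunc y \<xi> d"
  by (auto simp: trunc_def agree_def)

lemma agree_truncI: "agree \<xi> x y \<Longrightarrow> agree \<xi> x (trunc y \<xi> d)" "agree \<xi> x y \<Longrightarrow> agree \<xi> (trunc x \<xi> d) y"
  by (auto simp: agree_def dig_trunc)

lemma trunc_less_iff [simp]: "trunc x \<xi> d < trunc x \<xi> d' \<longleftrightarrow> d < d'"
proof
  assume "trunc x \<xi> d < trunc x \<xi> d'"
  then have "d \<le> d'" "d \<noteq> d'" using dig_mono[of \<xi> "trunc x \<xi> d" "trunc x \<xi> d'"] by auto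
  then show "d < d'" by simp
qed (auto intro: lessI_digit[of \<xi>])

lemma trunc_le_iff [simp]: "trunc x \<xi> d \<le> trunc x \<xi> d' \<longleftrightarrow> d \<le> d'"
  by (simp add: linorder_not_less[symmetric])

section \<open>The continuum of maximal branches of a tree\<close>

text \<open>\<open>Nd \<beta> x\<close> means that the digits of \<open>x\<close> before \<open>\<beta>\<close> form a node. That \<open>0\<close> and \<open>1\<close> never
  lead to a node provides each block with a first and a last point. \<open>Nd_bounded\<close> says that there
  is no branch of length \<open>\<omega>\<^sub>1\<close>, and is the source of first countability; \<open>Nd_extend\<close>
  makes every block nonseparable.\<close>

locale node_tree =
  fixes Nd :: "omega1 \<Rightarrow> pt \<Rightarrow> bool"
  assumes Nd_cong: "\<And>\<beta> x y. agree \<beta> x y \<Longrightarrow> Nd \<beta> x \<Longrightarrow> Nd \<beta> y"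
    and Nd_le: "\<And>\<alpha> \<beta> x. \<alpha> \<le> \<beta> \<Longrightarrow> Nd \<beta> x \<Longrightarrow> Nd \<alpha> x"
    and Nd_bounded: "\<And>x. \<exists>\<beta>. \<not> Nd \<beta> x"
    and Nd_0: "\<And>x. Nd (fin 0) x"
    and Nd_suc: "\<And>\<xi> x. Nd (suc \<xi>) x \<Longrightarrow> 0 < dig x \<xi> \<and> dig x \<xi> < 1"
    and Nd_extend: "\<And>\<xi> \<gamma> x. Nd \<xi> x \<Longrightarrow> \<xi> \<le> \<gamma> \<Longrightarrow> \<exists>y. agree \<xi> x y \<and> Nd \<gamma> y"
    and Nd_dense: "\<And>\<xi> x u v. Nd \<xi> x \<Longrightarrow> 0 \<le> u \<Longrightarrow> u < v \<Longrightarrow> v \<le> 1 \<Longrightarrow>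
       \<exists>d. u < d \<and> d < v \<and> Nd (suc \<xi>) (trunc x \<xi> d)"
begin

text \<open>A point follows the tree as long as possible. The digit by which it leaves the tree is an
  arbitrary element of the unit interval, and all later digits are padding. A branch of limit
  length that is not a node is a single point.\<close>

definition X :: "pt set" where
  "X = {x. (\<forall>\<xi>. 0 \<le> dig x \<xi> \<and> dig x \<xi> \<le> 1) \<and> (\<forall>\<beta> \<xi>. \<not> Nd \<beta> x \<longrightarrow> \<beta> \<le> \<xi> \<longrightarrow> dig x \<xi> = 0)}"

lemma dig_bounds: "x \<in> X \<Longrightarrow> 0 \<le> dig x \<xi>" "x \<in> X \<Longrightarrow> dig x \<xi> \<le> 1"
  by (auto simp: X_def)

lemma dig_eq_0: "x \<in> X \<Longrightarrow> \<not> Nd \<beta> x \<Longrightarrow> \<beta> \<le> \<xi> \<Longrightarrow> dig x \<xi> = 0"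
  by (auto simp: X_def)

lemma Nd_dig: "Nd \<beta> x \<Longrightarrow> \<xi> < \<beta> \<Longrightarrow> 0 < dig x \<xi> \<and> dig x \<xi> < 1"
  by (meson Nd_le Nd_suc suc_le_iff)

lemma Nd_trunc: "Nd \<xi> x \<Longrightarrow> \<beta> \<le> \<xi> \<Longrightarrow> Nd \<beta> (trunc x \<xi> d)"
  using Nd_cong[OF agree_le[OF agree_trunc(1)]] Nd_le by blast

lemma trunc_in_X:
  assumes "Nd \<xi> x" "0 \<le> d" "d \<le> 1"
  shows "trunc x \<xi> d \<in> X"
  unfolding X_def
proof (intro CollectI conjI allI impI)
  fix \<eta>
  show "0 \<le> dig (trunc x \<xi> d) \<eta>" "dig (trunc x \<xi> d) \<eta> \<le> 1"
    using assms Nd_dig[OF assms(1), of \<eta>] by (auto simp: dig_trunc)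
next
  fix \<beta> \<eta> assume "\<not> Nd \<beta> (trunc x \<xi> d)" "\<beta> \<le> \<eta>"
  then have "\<xi> < \<eta>" using Nd_trunc[OF assms(1)] by (meson le_less_trans not_le)
  then show "dig (trunc x \<xi> d) \<eta> = 0" by (auto simp: dig_trunc)
qed

lemma Nd_if_differ:
  assumes "x \<in> X" "y \<in> X" "agree \<xi> x y" "dig x \<xi> \<noteq> dig y \<xi>"
  shows "Nd \<xi> x"
  using assms dig_eq_0[of x \<xi> \<xi>] dig_eq_0[of y \<xi> \<xi>] Nd_cong[OF agree_sym[OF assms(3)]]
  by fastforce

lemma less_in_X_E:
  assumes "x \<in> X" "y \<in> X" "x < y"
  obtains \<xi> where "agree \<xi> x y" "dig x \<xi> < dig y \<xi>" "Nd \<xi> x" "Nd \<xi> y"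
proof -
  obtain \<xi> where \<xi>: "agree \<xi> x y" "dig x \<xi> < dig y \<xi>" using assms(3) by (auto simp: less_pt_def)
  then have "Nd \<xi> x" using Nd_if_differ assms by (metis less_irrefl)
  then show thesis using that \<xi> Nd_cong by blast
qed

lemma trunc_between:
  assumes "x \<in> X" "y \<in> X" "agree \<xi> x y" "dig x \<xi> < d" "d < dig y \<xi>"
  shows "trunc x \<xi> d \<in> X" "x < trunc x \<xi> d" "trunc x \<xi> d < y"
proof -
  have "Nd \<xi> x" using Nd_if_differ assms by fastforce
  then show "trunc x \<xi> d \<in> X"
    using dig_bounds(1)[OF assms(1), of \<xi>] dig_bounds(2)[OF assms(2), of \<xi>] assms(4,5)
    by (intro trunc_in_X) auto
  show "x < trunc x \<xi> d" using assms by (intro lessI_digit[of \<xi>]) auto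
  show "trunc x \<xi> d < y"
    using assms by (intro lessI_digit[of \<xi>]) (auto intro: agree_truncI)
qed

lemma rat_trunc_between:
  assumes "x \<in> X" "y \<in> X" "x < y"
  obtains \<xi> r where "Nd \<xi> x" "Nd \<xi> y" "trunc x \<xi> (of_rat r) = trunc y \<xi> (of_rat r)"
    "trunc x \<xi> (of_rat r) \<in> X" "x < trunc x \<xi> (of_rat r)" "trunc x \<xi> (of_rat r) < y"
    "0 \<le> (of_rat r :: real)" "of_rat r \<le> (1 :: real)"
proof -
  obtain \<xi> where \<xi>: "agree \<xi> x y" "dig x \<xi> < dig y \<xi>" "Nd \<xi> x" "Nd \<xi> y"
    using less_in_X_E[OF assms] .
  obtain r where r: "dig x \<xi> < of_rat r" "of_rat r < dig y \<xi>"
    using of_rat_dense[OF \<xi>(2)] by blast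
  show thesis
  proof (rule that)
    show "Nd \<xi> x" "Nd \<xi> y" by fact+
    show "trunc x \<xi> (of_rat r) = trunc y \<xi> (of_rat r)" using \<xi>(1) by (rule trunc_cong)
    show "trunc x \<xi> (of_rat r) \<in> X" "x < trunc x \<xi> (of_rat r)" "trunc x \<xi> (of_rat r) < y"
      using trunc_between[OF assms(1,2) \<xi>(1) r] by auto
    show "0 \<le> (of_rat r :: real)" "of_rat r \<le> (1 :: real)"
      using r dig_bounds(1)[OF assms(1), of \<xi>] dig_bounds(2)[OF assms(2), of \<xi>] by linarith+
  qed
qed

definition Bot :: pt where "Bot = Pt (\<lambda>_. 0)"
definition Top :: pt where "Top = trunc Bot (fin 0) 1"

lemma Bot_in_X: "Bot \<in> X"
  by (simp add: X_def Bot_def)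

lemma Bot_le: "x \<in> X \<Longrightarrow> Bot \<le> x"
  using dig_bounds(1)[of x] by (auto simp: less_pt_def Bot_def not_less[symmetric] leD)

lemma Top_in_X: "Top \<in> X"
  unfolding Top_def using Nd_0 by (intro trunc_in_X) auto

lemma Bot_less_Top: "Bot < Top"
  by (rule lessI_digit[of "fin 0"]) (auto simp: Top_def Bot_def)

text \<open>The supremum is computed digit by digit: the next digit is the supremum of the next digits of
  those elements of \<open>B\<close> that agree with the digits found so far. When there are no such elements
  left, the least continuation, by zeros, is the supremum.\<close>

lemma X_complete:
  assumes "B \<subseteq> X"
  obtains s where "s \<in> X" "\<And>b. b \<in> B \<Longrightarrow> b \<le> s" "\<And>u. u \<in> X \<Longrightarrow> (\<And>b. b \<in> B \<Longrightarrow> b \<le> u) \<Longrightarrow> s \<le> u"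
proof -
  define F where "F = (\<lambda>(f :: omega1 \<Rightarrow> real) \<xi>. let C = {b \<in> B. \<forall>\<eta><\<xi>. dig b \<eta> = f \<eta>}
      in if C = {} then 0 else Sup ((\<lambda>b. dig b \<xi>) ` C))"
  define y where "y = wfrec {(x, y). x < y} F"
  define s where "s = Pt y"
  define C where "C = (\<lambda>\<xi>. {b \<in> B. agree \<xi> b s})"
  have y: "y \<xi> = (if C \<xi> = {} then 0 else Sup ((\<lambda>b. dig b \<xi>) ` C \<xi>))" for \<xi>
  proof -
    have "y \<xi> = F (Wfrec.cut y {(x, y). x < y} \<xi>) \<xi>"
      unfolding y_def by (rule wfrec[OF wf])
    moreover have "{b \<in> B. \<forall>\<eta><\<xi>. dig b \<eta> = Wfrec.cut y {(x, y). x < y} \<xi> \<eta>} = C \<xi>"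
      by (auto simp: C_def agree_def s_def cut_def)
    ultimately show ?thesis unfolding F_def Let_def by simp
  qed
  have bdd: "bdd_above ((\<lambda>b. dig b \<xi>) ` C \<xi>)" for \<xi>
    by (rule bdd_aboveI[of _ 1]) (use assms dig_bounds in \<open>auto simp: C_def\<close>)
  have le_y: "dig b \<xi> \<le> y \<xi>" if "b \<in> C \<xi>" for b \<xi>
    using that bdd by (auto simp: y intro: cSUP_upper)
  show thesis
  proof (rule that)
    show "s \<in> X"
      unfolding X_def
    proof (intro CollectI conjI allI impI)
      fix \<xi>
      show "0 \<le> dig s \<xi>"
      proof (cases "C \<xi> = {}")
        case False
        then obtain b where "b \<in> C \<xi>" by auto
        then show ?thesis
          using le_y[of b \<xi>] dig_bounds(1)[of b \<xi>] assms by (auto simp: s_def C_def)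
      qed (simp add: s_def y)
      show "dig s \<xi> \<le> 1"
        using assms dig_bounds by (auto simp: s_def y C_def intro!: cSUP_least)
    next
      fix \<beta> \<xi> assume \<beta>: "\<not> Nd \<beta> s" "\<beta> \<le> \<xi>"
      have "dig b \<xi> = 0" if "b \<in> C \<xi>" for b
      proof (rule dig_eq_0)
        show "b \<in> X" using that assms by (auto simp: C_def)
        have "agree \<beta> b s" using that \<beta>(2) by (auto simp: C_def intro: agree_le)
        then show "\<not> Nd \<beta> b" using \<beta>(1) Nd_cong by blast
      qed (rule \<beta>(2))
      then have "C \<xi> \<noteq> {} \<Longrightarrow> (\<lambda>b. dig b \<xi>) ` C \<xi> = {0}" by force
      then show "dig s \<xi> = 0" by (auto simp: s_def y)
    qed
  next
    fix b assume b: "b \<in> B"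
    show "b \<le> s"
    proof (rule ccontr)
      assume "\<not> b \<le> s"
      then obtain \<xi> where "agree \<xi> s b" "dig s \<xi> < dig b \<xi>" by (auto simp: not_le less_pt_def)
      then show False using le_y[of b \<xi>] b by (auto simp: C_def s_def agree_sym)
    qed
  next
    fix u assume u: "u \<in> X" "\<And>b. b \<in> B \<Longrightarrow> b \<le> u"
    show "s \<le> u"
    proof (rule ccontr)
      assume "\<not> s \<le> u"
      then obtain \<xi> where \<xi>: "agree \<xi> u s" "dig u \<xi> < dig s \<xi>" by (auto simp: not_le less_pt_def)
      then have "C \<xi> \<noteq> {}" using dig_bounds(1)[OF u(1), of \<xi>] by (auto simp: s_def y)
      then obtain b where "b \<in> C \<xi>" "dig u \<xi> < dig b \<xi>"
        using \<xi>(2) less_cSUP_iff[OF _ bdd] by (auto simp: s_def y)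
      then have "b \<in> B" "u < b"
        using \<xi>(1) by (auto simp: C_def intro!: lessI_digit[of \<xi>] intro: agree_trans agree_sym)
      then show False using u(2) leD by blast
    qed
  qed
qed

lemma X_dense: "x \<in> X \<Longrightarrow> y \<in> X \<Longrightarrow> x < y \<Longrightarrow> \<exists>z\<in>X. x < z \<and> z < y"
  by (metis rat_trunc_between)

lemma countable_Nd: "countable {\<xi>. Nd \<xi> x}"
proof -
  obtain \<beta> where "\<not> Nd \<beta> x" using Nd_bounded by blast
  then have "{\<xi>. Nd \<xi> x} \<subseteq> {..<\<beta>}" using Nd_le by (auto simp: not_le[symmetric])
  then show ?thesis using countable_below countable_subset by blast
qed

text \<open>A countable set that approximates the point from both sides.\<close>

definition rat_truncs :: "pt \<Rightarrow> pt set" where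
  "rat_truncs x = {trunc x \<xi> (of_rat r) | \<xi> r. Nd \<xi> x \<and> 0 \<le> (of_rat r :: real) \<and> of_rat r \<le> (1 :: real)}"

lemma countable_rat_truncs: "countable (rat_truncs x)"
proof -
  have "rat_truncs x \<subseteq> (\<lambda>(\<xi>, r). trunc x \<xi> (of_rat r)) ` ({\<xi>. Nd \<xi> x} \<times> UNIV)"
    by (auto simp: rat_truncs_def)
  moreover have "countable ({\<xi>. Nd \<xi> x} \<times> (UNIV :: rat set))"
    using countable_Nd by (intro countable_SIGMA) auto
  ultimately show ?thesis by (meson countable_image countable_subset)
qed

lemma rat_truncs_subset: "rat_truncs x \<subseteq> X"
  by (auto simp: rat_truncs_def trunc_in_X)

lemma rat_truncs_dense:
  assumes "x \<in> X" "y \<in> X"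
  shows "x < y \<Longrightarrow> \<exists>e\<in>rat_truncs x. x < e \<and> e < y"
    and "y < x \<Longrightarrow> \<exists>e\<in>rat_truncs x. y < e \<and> e < x"
proof -
  show "\<exists>e\<in>rat_truncs x. x < e \<and> e < y" if "x < y"
  proof (rule rat_trunc_between[OF assms that])
    fix \<xi> r
    assume *: "Nd \<xi> x" "x < trunc x \<xi> (real_of_rat r)" "trunc x \<xi> (real_of_rat r) < y"
      "0 \<le> (of_rat r :: real)" "of_rat r \<le> (1 :: real)"
    then have "trunc x \<xi> (real_of_rat r) \<in> rat_truncs x" unfolding rat_truncs_def by blast
    then show ?thesis using * by blast
  qed
  show "\<exists>e\<in>rat_truncs x. y < e \<and> e < x" if "y < x"
  proof (rule rat_trunc_between[OF assms(2,1) that])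
    fix \<xi> r
    assume *: "Nd \<xi> x" "trunc y \<xi> (real_of_rat r) = trunc x \<xi> (real_of_rat r)"
      "y < trunc y \<xi> (real_of_rat r)" "trunc y \<xi> (real_of_rat r) < x"
      "0 \<le> (of_rat r :: real)" "of_rat r \<le> (1 :: real)"
    then have "trunc x \<xi> (real_of_rat r) \<in> rat_truncs x" unfolding rat_truncs_def by blast
    then show ?thesis using * by metis
  qed
qed

text \<open>All points of a countable set leave the tree below some countable level. A node
  beyond that level determines a block without points of the set, and the given interval contains
  the block of a node, which has an extension beyond that level.\<close>

lemma nowhere_separable:
  assumes "x \<in> X" "y \<in> X" "x < y" "countable G" "G \<subseteq> X"
  obtains u v where "u \<in> X" "v \<in> X" "x < u" "u < v" "v < y" "\<And>g. g \<in> G \<Longrightarrow> \<not> (u \<le> g \<and> g \<le> v)"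
proof -
  obtain \<xi> where \<xi>: "agree \<xi> x y" "dig x \<xi> < dig y \<xi>" "Nd \<xi> x"
    using less_in_X_E[OF assms(1-3)] .
  obtain d where d: "dig x \<xi> < d" "d < dig y \<xi>" "Nd (suc \<xi>) (trunc x \<xi> d)"
    using Nd_dense[OF \<xi>(3) _ \<xi>(2)] dig_bounds assms by blast
  obtain b where b: "\<And>g. \<not> Nd (b g) g" using Nd_bounded by metis
  have "countable (insert (suc \<xi>) (b ` G))" using assms(4) by auto
  then obtain \<gamma> where \<gamma>: "\<And>\<zeta>. \<zeta> \<in> insert (suc \<xi>) (b ` G) \<Longrightarrow> \<zeta> < \<gamma>"
    using countable_bounded by blast
  then have "suc \<xi> < \<gamma>" by blast
  then obtain z where z: "agree (suc \<xi>) (trunc x \<xi> d) z" "Nd \<gamma> z"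
    using Nd_extend[OF d(3)] by (metis less_imp_le)
  have \<xi>\<gamma>: "\<xi> < \<gamma>" using \<open>suc \<xi> < \<gamma>\<close> less_suc less_trans by blast
  have z\<xi>: "agree \<xi> x z" "dig z \<xi> = d"
    using z(1) by (auto simp: agree_suc_iff intro: agree_trans[OF agree_trunc(1)])
  have zt: "agree \<xi> x (trunc z \<gamma> e)" "dig (trunc z \<gamma> e) \<xi> = d" for e
    using z\<xi> \<xi>\<gamma> by (auto simp: agree_def dig_trunc)
  show thesis
  proof (rule that)
    show "trunc z \<gamma> (1/3) \<in> X" "trunc z \<gamma> (2/3) \<in> X"
      using z(2) by (auto intro: trunc_in_X)
    show "trunc z \<gamma> (1/3) < trunc z \<gamma> (2/3)" by simp
    show "x < trunc z \<gamma> (1/3)" using zt d by (intro lessI_digit[of \<xi>]) auto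
    show "trunc z \<gamma> (2/3) < y"
      using zt d \<xi>(1) by (intro lessI_digit[of \<xi>]) (auto intro: agree_trans[OF agree_sym])
    fix g assume g: "g \<in> G"
    show "\<not> (trunc z \<gamma> (1/3) \<le> g \<and> g \<le> trunc z \<gamma> (2/3))"
    proof
      assume "trunc z \<gamma> (1/3) \<le> g \<and> g \<le> trunc z \<gamma> (2/3)"
      then have "agree \<gamma> (trunc z \<gamma> (1/3)) g"
        using agree_between[of \<gamma> "trunc z \<gamma> (1/3)" "trunc z \<gamma> (2/3)" g] by auto
      then have "Nd \<gamma> g" using z(2) Nd_cong agree_trunc(1) by blast
      moreover have "b g \<le> \<gamma>" using \<gamma>[of "b g"] g by auto
      ultimately show False using b Nd_le by blast
    qed
  qed
qed

end

section \<open>A rank for intervals and the set of types it yields\<close>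

text \<open>Rank and types are defined from betweenness alone, so that they are also invariant under
  order-reversing maps.\<close>

definition segm :: "'a::linorder set \<Rightarrow> 'a \<Rightarrow> 'a \<Rightarrow> 'a set" where
  "segm X x y = {w \<in> X. min x y \<le> w \<and> w \<le> max x y}"

lemma segm_commute: "segm X x y = segm X y x"
  by (simp add: segm_def min.commute max.commute)

lemma segm_eq: "x \<le> y \<Longrightarrow> segm X x y = {w \<in> X. x \<le> w \<and> w \<le> y}"
  by (simp add: segm_def)

lemma segmI: "w \<in> X \<Longrightarrow> x \<le> w \<Longrightarrow> w \<le> y \<Longrightarrow> w \<in> segm X x y"
  by (simp add: segm_def min.coboundedI1 max.coboundedI2)

lemma segmI': "w \<in> X \<Longrightarrow> y \<le> w \<Longrightarrow> w \<le> x \<Longrightarrow> w \<in> segm X x y"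
  by (simp add: segm_def min.coboundedI2 max.coboundedI1)

lemma segm_trichotomy:
  fixes a b d :: "'a::linorder"
  assumes "a \<in> X" "b \<in> X" "d \<in> X"
  shows "d \<in> segm X a b \<or> a \<in> segm X d b \<or> b \<in> segm X a d"
  using assms by (auto simp: segm_def min_def max_def)

lemma in_segmD: "w \<in> segm X x y \<Longrightarrow> w \<in> X"
  by (simp add: segm_def)

lemma ends_in_segm [simp]: "x \<in> segm X x y \<longleftrightarrow> x \<in> X" "y \<in> segm X x y \<longleftrightarrow> y \<in> X"
  by (auto simp: segm_def)

lemma segm_refl: "x \<in> X \<Longrightarrow> segm X x x = {x}"
  by (auto simp: segm_def)

lemma segm_subset: "u \<in> segm X x y \<Longrightarrow> v \<in> segm X x y \<Longrightarrow> segm X u v \<subseteq> segm X x y"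
  by (auto simp: segm_def min_def max_def split: if_splits)

lemma segm_total: "p \<in> segm X w z \<Longrightarrow> x \<in> segm X w z \<Longrightarrow> x \<in> segm X p z \<or> p \<in> segm X x z"
  by (auto simp: segm_def min_def max_def split: if_splits)

lemma segm_split: "z \<in> segm X a b \<Longrightarrow> a \<in> segm X w w' \<Longrightarrow> b \<in> segm X w w' \<Longrightarrow>
    a \<in> segm X w z \<and> b \<in> segm X w' z \<or> a \<in> segm X w' z \<and> b \<in> segm X w z"
  by (auto simp: segm_def min_def max_def split: if_splits)

lemma agree_segm:
  assumes "agree \<xi> x u" "agree \<xi> x v" "w \<in> segm X u v"
  shows "agree \<xi> x w"
proof -
  have *: "agree \<xi> x w" if "agree \<xi> x u" "agree \<xi> x v" "u \<le> w" "w \<le> v" for u v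
    using agree_between[OF agree_trans[OF agree_sym[OF that(1)] that(2)] that(3,4)]
      agree_trans that(1) by blast
  show ?thesis
    using assms *[of u v] *[of v u] by (auto simp: segm_def min_def max_def split: if_splits)
qed

text \<open>On a segment of a complete dense order these are the continuous functions that are
  monotone or antitone.\<close>

definition tame :: "'a::linorder set \<Rightarrow> ('a \<Rightarrow> real) \<Rightarrow> 'a \<Rightarrow> 'a \<Rightarrow> bool" where
  "tame X f x y \<longleftrightarrow> (\<forall>u\<in>segm X x y. \<forall>v\<in>segm X x y.
     f ` segm X u v = {min (f u) (f v)..max (f u) (f v)})"

text \<open>Here \<open>R\<close> is a notion of smallness for the segment spanned by two points.\<close>

abbreviation wide_fibres :: "'a::linorder set \<Rightarrow> ('a \<Rightarrow> 'a \<Rightarrow> bool) \<Rightarrow> ('a \<Rightarrow> real) \<Rightarrow> 'a \<Rightarrow> 'a \<Rightarrow> real set" where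
  "wide_fibres X R f x y \<equiv>
     {t. \<exists>u\<in>segm X x y. \<exists>v\<in>segm X x y. f u = t \<and> f v = t \<and> \<not> R u v}"

text \<open>The segment from \<open>x\<close> to \<open>y\<close> has rank at most \<open>n\<close>.\<close>

primrec thin :: "'a::linorder set \<Rightarrow> nat \<Rightarrow> 'a \<Rightarrow> 'a \<Rightarrow> bool" where
  "thin X 0 x y \<longleftrightarrow> x = y"
| "thin X (Suc n) x y \<longleftrightarrow> (\<forall>f. tame X f x y \<longrightarrow>
     countable (wide_fibres X (thin X n) f x y))"

lemma tameD: "tame X f x y \<Longrightarrow> u \<in> segm X x y \<Longrightarrow> v \<in> segm X x y \<Longrightarrow>
    f ` segm X u v = {min (f u) (f v)..max (f u) (f v)}"
  by (simp add: tame_def)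

lemma thin_SucD: "thin X (Suc n) x y \<Longrightarrow> tame X f x y \<Longrightarrow>
    countable (wide_fibres X (thin X n) f x y)"
  by simp

lemma tame_const:
  assumes "tame X f x y" "u \<in> segm X x y" "v \<in> segm X x y" "f u = f v" "w \<in> segm X u v"
  shows "f w = f u"
  using tameD[OF assms(1-3)] assms(4,5) by auto

text \<open>A tame function on the smaller segment extends to the larger one by composing it
  with the retraction that moves outside points to the nearer end.\<close>

lemma thin_hereditary:
  assumes "thin X n x y" "x' \<in> segm X x y" "y' \<in> segm X x y"
  shows "thin X n x' y'"
proof (cases n)
  case 0
  then show ?thesis using assms by (auto simp: segm_def)
next
  case (Suc m)
  define lo hi where "lo = min x' y'" and "hi = max x' y'"
  have lohi: "lo \<in> X" "hi \<in> X" "lo \<le> hi"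
    using assms in_segmD by (auto simp: lo_def hi_def min_def max_def)
  define c where "c = (\<lambda>z. max lo (min hi z))"
  have c_id: "c z = z" if "z \<in> segm X x' y'" for z
    using that by (auto simp: c_def lo_def hi_def segm_def)
  have c_in: "c z \<in> segm X x' y'" if "z \<in> X" for z
  proof -
    have "segm X x' y' = {w \<in> X. lo \<le> w \<and> w \<le> hi}" by (simp add: segm_def lo_def hi_def)
    moreover have "c z = lo \<or> c z = hi \<or> c z = z" unfolding c_def min_def max_def by argo
    then have "c z \<in> X" using that lohi(1,2) by metis
    moreover have "lo \<le> c z" "c z \<le> hi" unfolding c_def using lohi(3) by simp_all
    ultimately show ?thesis by simp
  qed
  have c_segm: "c ` segm X u v = segm X (c u) (c v)" if uv: "u \<in> X" "v \<in> X" "u \<le> v" for u v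
  proof -
    have mono: "c a \<le> c b" if "a \<le> b" for a b
      using that unfolding c_def by (intro max.mono min.mono) auto
    show ?thesis
    proof (intro equalityI subsetI)
      fix w assume "w \<in> c ` segm X u v"
      then show "w \<in> segm X (c u) (c v)"
        using uv mono c_in in_segmD by (fastforce simp: segm_eq)
    next
      fix w assume "w \<in> segm X (c u) (c v)"
      then have w: "w \<in> X" "c u \<le> w" "w \<le> c v" using mono[OF uv(3)] by (auto simp: segm_eq)
      consider "w < u" | "u \<le> w" "w \<le> v" | "v < w" by fastforce
      then show "w \<in> c ` segm X u v"
      proof cases
        case 1
        then have "w = c u" using w mono[OF uv(3)] lohi(3)
          by (auto simp: c_def min_def max_def split: if_splits)
        then show ?thesis using uv by auto
      next
        case 2
        have "w = c w" using w 2 lohi(3) by (auto simp: c_def min_def max_def split: if_splits)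
        then show ?thesis using w(1) 2 uv by (auto simp: segm_eq)
      next
        case 3
        then have "w = c v" using w mono[OF uv(3)] lohi(3)
          by (auto simp: c_def min_def max_def split: if_splits)
        then show ?thesis using uv by auto
      qed
    qed
  qed
  show ?thesis
    unfolding Suc thin.simps
  proof (intro allI impI)
    fix f assume f: "tame X f x' y'"
    have "tame X (f \<circ> c) x y"
      unfolding tame_def
    proof (intro ballI)
      fix u v assume "u \<in> segm X x y" "v \<in> segm X x y"
      then have uv: "u \<in> X" "v \<in> X" by (auto dest: in_segmD)
      have "c ` segm X u v = segm X (c u) (c v)"
        using c_segm[OF uv] c_segm[OF uv(2,1)] by (metis segm_commute linear)
      then have "(f \<circ> c) ` segm X u v = f ` segm X (c u) (c v)"
        by (metis image_comp)
      then show "(f \<circ> c) ` segm X u v = {min ((f \<circ> c) u) ((f \<circ> c) v)..max ((f \<circ> c) u) ((f \<circ> c) v)}"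
        using tameD[OF f c_in c_in] uv by simp
    qed
    then have "countable (wide_fibres X (thin X m) (f \<circ> c) x y)"
      by (rule thin_SucD[OF assms(1)[unfolded Suc]])
    moreover have "wide_fibres X (thin X m) f x' y'
       \<subseteq> wide_fibres X (thin X m) (f \<circ> c) x y"
    proof (intro Collect_mono impI, elim bexE)
      fix t u v assume "u \<in> segm X x' y'" "v \<in> segm X x' y'" "f u = t \<and> f v = t \<and> \<not> thin X m u v"
      then show "\<exists>u\<in>segm X x y. \<exists>v\<in>segm X x y. (f \<circ> c) u = t \<and> (f \<circ> c) v = t \<and> \<not> thin X m u v"
        using segm_subset[OF assms(2,3)] c_id by (intro bexI[of _ u] bexI[of _ v]) auto
    qed
    ultimately show "countable (wide_fibres X (thin X m) f x' y')"
      by (rule countable_subset[rotated])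
  qed
qed

lemma thin_Suc: "x \<in> X \<Longrightarrow> thin X n x y \<Longrightarrow> thin X (Suc n) x y"
proof (induction n arbitrary: x y)
  case 0
  then show ?case by (auto simp: segm_refl)
next
  case (Suc n)
  show ?case
    unfolding thin.simps(2)[of X "Suc n"]
  proof (intro allI impI)
    fix f assume "tame X f x y"
    then have "countable (wide_fibres X (thin X n) f x y)"
      using Suc.prems by simp
    moreover have "wide_fibres X (thin X (Suc n)) f x y
       \<subseteq> wide_fibres X (thin X n) f x y"
      using Suc.IH in_segmD by blast
    ultimately show "countable (wide_fibres X (thin X (Suc n)) f x y)"
      by (rule countable_subset[rotated])
  qed
qed

lemma thin_le:
  assumes "x \<in> X" "m \<le> n" "thin X m x y"
  shows "thin X n x y"
  using assms(2)
proof (induction n rule: dec_induct)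
  case base
  show ?case by (fact assms(3))
next
  case (step k)
  then show ?case by (intro thin_Suc assms(1))
qed

lemma thin_commute: "thin X n x y \<longleftrightarrow> thin X n y x"
  by (cases n) (auto simp: segm_commute[of X x] tame_def)

lemma thin_iso:
  assumes inj: "inj_on \<phi> X"
    and \<phi>: "\<And>u v. u \<in> X \<Longrightarrow> v \<in> X \<Longrightarrow> \<phi> ` segm X u v = segm Y (\<phi> u) (\<phi> v)"
    and xy: "x \<in> X" "y \<in> X"
  shows "thin X n x y \<longleftrightarrow> thin Y n (\<phi> x) (\<phi> y)"
  using xy
proof (induction n arbitrary: x y)
  case 0
  then show ?case using inj by (auto simp: inj_on_eq_iff)
next
  case (Suc n)
  note xy = Suc.prems
  have img: "segm Y (\<phi> x) (\<phi> y) = \<phi> ` segm X x y" using \<phi> xy by simp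
  have tame_iff: "tame Y f (\<phi> x) (\<phi> y) \<longleftrightarrow> tame X g x y"
    if "\<And>u. u \<in> X \<Longrightarrow> f (\<phi> u) = g u" for f :: "'b \<Rightarrow> real" and g
  proof -
    have "f ` segm Y (\<phi> u) (\<phi> v) = g ` segm X u v" if "u \<in> segm X x y" "v \<in> segm X x y" for u v
      using \<phi>[of u v] that \<open>\<And>u. u \<in> X \<Longrightarrow> f (\<phi> u) = g u\<close> in_segmD
      by (metis (no_types, lifting) image_cong image_image)
    moreover have "f (\<phi> u) = g u" if "u \<in> segm X x y" for u
      using that \<open>\<And>u. u \<in> X \<Longrightarrow> f (\<phi> u) = g u\<close> in_segmD by blast
    ultimately show ?thesis
      unfolding tame_def img by simp
  qed
  have set_eq: "wide_fibres Y (thin Y n) f (\<phi> x) (\<phi> y)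
      = wide_fibres X (thin X n) g x y"
    if "\<And>u. u \<in> X \<Longrightarrow> f (\<phi> u) = g u" for f :: "'b \<Rightarrow> real" and g
  proof -
    have "(f (\<phi> u) = t \<and> f (\<phi> v) = t \<and> \<not> thin Y n (\<phi> u) (\<phi> v)) \<longleftrightarrow> (g u = t \<and> g v = t \<and> \<not> thin X n u v)"
      if "u \<in> segm X x y" "v \<in> segm X x y" for u v t
      using that[THEN in_segmD] \<open>\<And>u. u \<in> X \<Longrightarrow> f (\<phi> u) = g u\<close> Suc.IH by simp
    then have "(\<exists>u\<in>\<phi> ` segm X x y. \<exists>v\<in>\<phi> ` segm X x y. f u = t \<and> f v = t \<and> \<not> thin Y n u v) \<longleftrightarrow>
       (\<exists>u\<in>segm X x y. \<exists>v\<in>segm X x y. g u = t \<and> g v = t \<and> \<not> thin X n u v)" for t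
      by blast
    then show ?thesis unfolding img by (rule Collect_cong)
  qed
  show ?case
  proof
    assume L: "thin X (Suc n) x y"
    show "thin Y (Suc n) (\<phi> x) (\<phi> y)"
      unfolding thin.simps
    proof (intro allI impI)
      fix f assume "tame Y f (\<phi> x) (\<phi> y)"
      then show "countable (wide_fibres Y (thin Y n) f (\<phi> x) (\<phi> y))"
        using thin_SucD[OF L, of "f \<circ> \<phi>"] tame_iff[of f "f \<circ> \<phi>"] set_eq[of f "f \<circ> \<phi>"] by simp
    qed
  next
    assume R: "thin Y (Suc n) (\<phi> x) (\<phi> y)"
    show "thin X (Suc n) x y"
      unfolding thin.simps
    proof (intro allI impI)
      fix g assume g: "tame X g x y"
      have *: "\<And>u. u \<in> X \<Longrightarrow> (g \<circ> inv_into X \<phi>) (\<phi> u) = g u"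
        using inj by simp
      show "countable (wide_fibres X (thin X n) g x y)"
        using thin_SucD[OF R, of "g \<circ> inv_into X \<phi>"] g
        by (simp only: tame_iff[where f = "g \<circ> inv_into X \<phi>" and g = g, OF *]
            set_eq[where f = "g \<circ> inv_into X \<phi>" and g = g, OF *])
    qed
  qed
qed

text \<open>On the side of \<open>p\<close>, the local rank of \<open>z\<close> is at most \<open>n\<close>. By heredity it does not matter
  how far away \<open>p\<close> is (\<open>near_iff\<close>).\<close>

definition near :: "'a::linorder set \<Rightarrow> 'a \<Rightarrow> nat \<Rightarrow> 'a \<Rightarrow> bool" where
  "near X p n z \<longleftrightarrow> (\<exists>x\<in>segm X p z. x \<noteq> z \<and> thin X n x z)"

lemma near_ends: "near X p n z \<Longrightarrow> p \<noteq> z"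
  by (auto simp: near_def segm_def)

lemma near_le: "near X p m z \<Longrightarrow> m \<le> n \<Longrightarrow> near X p n z"
  unfolding near_def using thin_le in_segmD by blast

lemma near_iff:
  assumes "p \<in> segm X w z" "p \<noteq> z" "z \<in> X"
  shows "near X w n z \<longleftrightarrow> near X p n z"
proof
  assume "near X p n z"
  moreover have "segm X p z \<subseteq> segm X w z"
    using assms by (intro segm_subset) auto
  ultimately show "near X w n z" by (auto simp: near_def)
next
  assume "near X w n z"
  then obtain x where x: "x \<in> segm X w z" "x \<noteq> z" "thin X n x z" by (auto simp: near_def)
  consider "x \<in> segm X p z" | "p \<in> segm X x z" using segm_total assms(1) x(1) by blast
  then show "near X p n z"
  proof cases
    case 1
    then show ?thesis using x by (auto simp: near_def)
  next
    case 2
    then have "thin X n p z" using x(3) assms(3) by (auto intro: thin_hereditary)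
    moreover have "p \<in> segm X p z" using assms(1) in_segmD by auto
    ultimately show ?thesis using assms(2) unfolding near_def by blast
  qed
qed

text \<open>The local rank is \<open>1\<close> on the side of \<open>p\<close> and exactly \<open>n + 1\<close> on the side of \<open>q\<close>.\<close>

definition special :: "'a::linorder set \<Rightarrow> 'a \<Rightarrow> 'a \<Rightarrow> nat \<Rightarrow> 'a \<Rightarrow> bool" where
  "special X p q n z \<longleftrightarrow> z \<in> segm X p q \<and> near X p 1 z \<and> near X q (Suc n) z \<and> \<not> near X q n z"

text \<open>The case \<open>n = 1\<close> is excluded because rank \<open>1\<close> meets rank \<open>2\<close> at the ends of all innermost
  blocks, whatever is coded.\<close>

definition types :: "'a::linorder set \<Rightarrow> 'a \<Rightarrow> 'a \<Rightarrow> nat set" where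
  "types X p q = {n. 2 \<le> n \<and> (\<exists>z. special X p q n z \<or> special X q p n z)}"

lemma types_commute: "types X p q = types X q p"
  by (auto simp: types_def)

lemma types_mono:
  assumes "p \<in> segm X w w'" "q \<in> segm X w w'"
  shows "types X p q \<subseteq> types X w w'"
proof -
  have 1: "special X w w' n z \<or> special X w' w n z" if sp: "special X a b n z"
    and ab: "a \<in> segm X w w'" "b \<in> segm X w w'" for a b n z
  proof -
    have z: "z \<in> segm X a b" "z \<in> X" "a \<noteq> z" "b \<noteq> z"
      using sp near_ends in_segmD unfolding special_def by blast+
    have zw: "z \<in> segm X w w'" using z(1) ab segm_subset by blast
    consider "a \<in> segm X w z" "b \<in> segm X w' z" | "a \<in> segm X w' z" "b \<in> segm X w z"
      using segm_split[OF z(1) ab] by blast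
    then show ?thesis
    proof cases
      case 1
      then have "special X w w' n z"
        using sp zw z near_iff[of a X w z] near_iff[of b X w' z] by (simp add: special_def)
      then show ?thesis ..
    next
      case 2
      then have "special X w' w n z"
        using sp zw z near_iff[of a X w' z] near_iff[of b X w z]
        by (simp add: special_def segm_commute)
      then show ?thesis ..
    qed
  qed
  show ?thesis
    unfolding types_def using 1[OF _ assms] 1[OF _ assms(2,1)] by blast
qed

lemma types_iso:
  assumes inj: "inj_on \<phi> X"
    and \<phi>: "\<And>u v. u \<in> X \<Longrightarrow> v \<in> X \<Longrightarrow> \<phi> ` segm X u v = segm Y (\<phi> u) (\<phi> v)"
    and pq: "p \<in> X" "q \<in> X"
  shows "types X p q = types Y (\<phi> p) (\<phi> q)"
proof -
  have near: "near Y (\<phi> a) n (\<phi> z) \<longleftrightarrow> near X a n z" if "a \<in> X" "z \<in> X" for a n z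
    unfolding near_def \<phi>[OF that, symmetric]
    using thin_iso[OF inj \<phi>] that in_segmD[of _ X a z] inj
    by (auto simp: inj_on_eq_iff)
  have special: "(\<exists>z. special Y (\<phi> a) (\<phi> b) n z) \<longleftrightarrow> (\<exists>z. special X a b n z)" if "a \<in> X" "b \<in> X" for a b n
    unfolding special_def \<phi>[OF that, symmetric]
    using near that in_segmD[of _ X a b] by blast
  show ?thesis
    unfolding types_def using special[OF pq] special[OF pq(2,1)] by blast
qed

section \<open>The order topology of a complete dense linear order\<close>

definition order_on :: "'a::linorder set \<Rightarrow> 'a rel" where
  "order_on X = {(x, y). x \<in> X \<and> y \<in> X \<and> x \<le> y}"

definition otop :: "'a::linorder set \<Rightarrow> 'a topology" where
  "otop X = order_topology_on X (order_on X)"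

definition ups :: "'a::linorder set \<Rightarrow> 'a set \<Rightarrow> 'a set set" where
  "ups X D = insert X ((\<lambda>a. {x \<in> X. a < x}) ` D)"

definition downs :: "'a::linorder set \<Rightarrow> 'a set \<Rightarrow> 'a set set" where
  "downs X D = insert X ((\<lambda>a. {x \<in> X. x < a}) ` D)"

lemma otop_eq: "otop X = topology_generated_by (ups X X \<union> downs X X)"
proof -
  have *: "(\<lambda>a. {x \<in> X. (a, x) \<in> order_on X \<and> x \<noteq> a}) ` X = (\<lambda>a. {x \<in> X. a < x}) ` X"
       "(\<lambda>a. {x \<in> X. (x, a) \<in> order_on X \<and> x \<noteq> a}) ` X = (\<lambda>a. {x \<in> X. x < a}) ` X"
    by (auto simp: order_on_def intro!: image_cong)
  then show ?thesis
    unfolding otop_def order_topology_on_def ups_def downs_def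
    by (simp only: * Un_insert_left Un_insert_right insert_absorb2)
qed

lemma topspace_otop [simp]: "topspace (otop X) = X"
  by (auto simp: otop_eq topology_generated_by_topspace ups_def downs_def)

lemma ups_Int: "A \<in> ups X D \<Longrightarrow> A' \<in> ups X D \<Longrightarrow> A \<inter> A' \<in> ups X D"
proof -
  have *: "A \<inter> A' = A \<or> A \<inter> A' = A'" if "A \<in> ups X D" "A' \<in> ups X D"
    using that unfolding ups_def by (auto simp: order.strict_trans)
  show "A \<in> ups X D \<Longrightarrow> A' \<in> ups X D \<Longrightarrow> A \<inter> A' \<in> ups X D"
    using * by metis
qed

lemma downs_Int: "A \<in> downs X D \<Longrightarrow> A' \<in> downs X D \<Longrightarrow> A \<inter> A' \<in> downs X D"
proof -
  have *: "A \<inter> A' = A \<or> A \<inter> A' = A'" if "A \<in> downs X D" "A' \<in> downs X D"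
    using that unfolding downs_def by (auto simp: order.strict_trans)
  show "A \<in> downs X D \<Longrightarrow> A' \<in> downs X D \<Longrightarrow> A \<inter> A' \<in> downs X D"
    using * by metis
qed

lemma openin_ups: "A \<in> ups X X \<Longrightarrow> openin (otop X) A"
  unfolding otop_eq by (rule topology_generated_by_Basis) blast

lemma openin_downs: "A \<in> downs X X \<Longrightarrow> openin (otop X) A"
  unfolding otop_eq by (rule topology_generated_by_Basis) blast

lemma openin_greater: "a \<in> X \<Longrightarrow> openin (otop X) {x \<in> X. a < x}"
  by (rule openin_ups) (simp add: ups_def)

lemma openin_lesser: "a \<in> X \<Longrightarrow> openin (otop X) {x \<in> X. x < a}"
  by (rule openin_downs) (simp add: downs_def)

lemma otop_nbhd:
  assumes "openin (otop X) U" "z \<in> U"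
  obtains A B where "A \<in> ups X X" "B \<in> downs X X" "z \<in> A" "z \<in> B" "A \<inter> B \<subseteq> U"
proof -
  have "generate_topology_on (ups X X \<union> downs X X) U"
    using assms(1) by (simp add: otop_eq openin_topology_generated_by_iff)
  then have "\<exists>A\<in>ups X X. \<exists>B\<in>downs X X. z \<in> A \<and> z \<in> B \<and> A \<inter> B \<subseteq> U"
    using assms(2)
  proof (induction arbitrary: z)
    case (Int a b)
    then obtain A B A' B' where "A \<in> ups X X" "B \<in> downs X X" "z \<in> A" "z \<in> B" "A \<inter> B \<subseteq> a"
      "A' \<in> ups X X" "B' \<in> downs X X" "z \<in> A'" "z \<in> B'" "A' \<inter> B' \<subseteq> b"
      by (metis IntD1 IntD2)
    then show ?case
      by (intro bexI[of _ "A \<inter> A'"] bexI[of _ "B \<inter> B'"]) (auto intro: ups_Int downs_Int)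
  next
    case (UN K)
    then show ?case by (meson UnionE Union_upper order_trans)
  next
    case (Basis s)
    have "s \<subseteq> X" using Basis(1) by (auto simp: ups_def downs_def)
    moreover have "X \<in> ups X X" "X \<in> downs X X" by (auto simp: ups_def downs_def)
    ultimately show ?case using Basis by (metis UnE inf_le1 inf_le2 subsetD)
  qed auto
  then show thesis using that by blast
qed

lemma ups_refine:
  assumes "A \<in> ups X X" "z \<in> A" "\<And>y. y \<in> X \<Longrightarrow> y < z \<Longrightarrow> \<exists>e\<in>E. y < e \<and> e < z"
  obtains A' where "A' \<in> ups X E" "z \<in> A'" "A' \<subseteq> A"
proof (cases "A = X")
  case True
  then show ?thesis using that[of X] assms(2) by (auto simp: ups_def)
next
  case False
  then obtain a where a: "a \<in> X" "A = {x \<in> X. a < x}" using assms(1) by (auto simp: ups_def)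
  then obtain e where "e \<in> E" "a < e" "e < z" using assms(2,3) by blast
  then show ?thesis using that[of "{x \<in> X. e < x}"] a assms(2) by (auto simp: ups_def intro: less_trans)
qed

lemma downs_refine:
  assumes "A \<in> downs X X" "z \<in> A" "\<And>y. y \<in> X \<Longrightarrow> z < y \<Longrightarrow> \<exists>e\<in>E. z < e \<and> e < y"
  obtains A' where "A' \<in> downs X E" "z \<in> A'" "A' \<subseteq> A"
proof (cases "A = X")
  case True
  then show ?thesis using that[of X] assms(2) by (auto simp: downs_def)
next
  case False
  then obtain a where a: "a \<in> X" "A = {x \<in> X. x < a}" using assms(1) by (auto simp: downs_def)
  then obtain e where "e \<in> E" "z < e" "e < a" using assms(2,3) by blast
  then show ?thesis using that[of "{x \<in> X. x < e}"] a assms(2) by (auto simp: downs_def intro: less_trans)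
qed

definition interval_base :: "'a::linorder set \<Rightarrow> 'a set \<Rightarrow> 'a set set" where
  "interval_base X E = (\<lambda>(A, B). A \<inter> B) ` (ups X E \<times> downs X E)"

lemma openin_interval_base: "E \<subseteq> X \<Longrightarrow> U \<in> interval_base X E \<Longrightarrow> openin (otop X) U"
  by (auto simp: interval_base_def ups_def downs_def
       intro!: openin_Int openin_greater openin_lesser)
     (metis openin_topspace topspace_otop)+

lemma interval_base_nbhd:
  assumes "openin (otop X) U" "z \<in> U"
    and "\<And>y. y \<in> X \<Longrightarrow> y < z \<Longrightarrow> \<exists>e\<in>E. y < e \<and> e < z"
    and "\<And>y. y \<in> X \<Longrightarrow> z < y \<Longrightarrow> \<exists>e\<in>E. z < e \<and> e < y"
  shows "\<exists>V\<in>interval_base X E. z \<in> V \<and> V \<subseteq> U"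
proof -
  obtain A B where AB: "A \<in> ups X X" "B \<in> downs X X" "z \<in> A" "z \<in> B" "A \<inter> B \<subseteq> U"
    using otop_nbhd assms(1,2) .
  obtain A' where A': "A' \<in> ups X E" "z \<in> A'" "A' \<subseteq> A"
    using ups_refine[OF AB(1,3) assms(3)] .
  obtain B' where B': "B' \<in> downs X E" "z \<in> B'" "B' \<subseteq> B"
    using downs_refine[OF AB(2,4) assms(4)] .
  show ?thesis
    using A' B' AB(5) by (intro bexI[of _ "A' \<inter> B'"]) (auto simp: interval_base_def)
qed

lemma first_countable_otop:
  assumes "\<And>z. z \<in> X \<Longrightarrow> \<exists>E\<subseteq>X. countable E \<and> (\<forall>y\<in>X. y < z \<longrightarrow> (\<exists>e\<in>E. y < e \<and> e < z))
       \<and> (\<forall>y\<in>X. z < y \<longrightarrow> (\<exists>e\<in>E. z < e \<and> e < y))"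
  shows "first_countable (otop X)"
  unfolding first_countable_def
proof
  fix z assume "z \<in> topspace (otop X)"
  then obtain E where E: "E \<subseteq> X" "countable E" "\<And>y. y \<in> X \<Longrightarrow> y < z \<Longrightarrow> \<exists>e\<in>E. y < e \<and> e < z"
    "\<And>y. y \<in> X \<Longrightarrow> z < y \<Longrightarrow> \<exists>e\<in>E. z < e \<and> e < y" using assms[of z] by auto
  have "countable (interval_base X E)"
    unfolding interval_base_def ups_def downs_def using E(2)
    by (intro countable_image countable_SIGMA) auto
  then show "\<exists>\<B>. countable \<B> \<and> (\<forall>V\<in>\<B>. openin (otop X) V) \<and>
      (\<forall>U. openin (otop X) U \<and> z \<in> U \<longrightarrow> (\<exists>V\<in>\<B>. z \<in> V \<and> V \<subseteq> U))"
    using openin_interval_base[OF E(1)] interval_base_nbhd[OF _ _ E(3,4)] by blast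
qed

lemma base_of_interval_base:
  assumes "D \<subseteq> X" "\<And>x y. x \<in> X \<Longrightarrow> y \<in> X \<Longrightarrow> x < y \<Longrightarrow> \<exists>d\<in>D. x < d \<and> d < y"
  shows "base_of (otop X) (interval_base X D)"
proof -
  have "\<exists>V\<in>interval_base X D. z \<in> V \<and> V \<subseteq> U" if "openin (otop X) U" "z \<in> U" for U z
    using that assms(2) openin_subset[OF that(1)] by (intro interval_base_nbhd) auto
  then show ?thesis
    unfolding base_of_def openin_topology_base_unique
    using openin_interval_base[OF assms(1)] by blast
qed

locale complete_dense_order =
  fixes X :: "'a::linorder set"
  assumes complete: "\<And>B. B \<subseteq> X \<Longrightarrow> \<exists>s\<in>X. (\<forall>b\<in>B. b \<le> s) \<and> (\<forall>u\<in>X. (\<forall>b\<in>B. b \<le> u) \<longrightarrow> s \<le> u)"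
    and dense: "\<And>x y. x \<in> X \<Longrightarrow> y \<in> X \<Longrightarrow> x < y \<Longrightarrow> \<exists>z\<in>X. x < z \<and> z < y"
begin

text \<open>Induction along a complete order. The supremum of the initial parts of the order, starting at
  \<open>a\<close>, on which \<open>P\<close> holds satisfies \<open>P\<close> itself, and by the step cannot have points above it.
  Compactness and connectedness both follow by this principle.\<close>

lemma real_induct:
  assumes "a \<in> X" "w \<in> X" "a \<le> w"
    and step: "\<And>z. z \<in> X \<Longrightarrow> a \<le> z \<Longrightarrow> (\<And>t. t \<in> X \<Longrightarrow> a \<le> t \<Longrightarrow> t < z \<Longrightarrow> P t) \<Longrightarrow>
       P z \<and> (\<forall>y\<in>X. z < y \<longrightarrow> (\<exists>c\<in>X. z < c \<and> (\<forall>t\<in>X. z < t \<longrightarrow> t < c \<longrightarrow> P t)))"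
  shows "P w"
proof -
  define B where "B = {w \<in> X. a \<le> w \<and> (\<forall>t\<in>X. a \<le> t \<longrightarrow> t < w \<longrightarrow> P t)}"
  obtain s where s: "s \<in> X" "\<And>b. b \<in> B \<Longrightarrow> b \<le> s" "\<And>u. u \<in> X \<Longrightarrow> (\<And>b. b \<in> B \<Longrightarrow> b \<le> u) \<Longrightarrow> s \<le> u"
    using complete[of B] by (auto simp: B_def)
  have "a \<in> B" using assms(1) by (auto simp: B_def)
  then have "a \<le> s" using s(2) by blast
  have below: "P t" if t: "t \<in> X" "a \<le> t" "t < s" for t
  proof -
    obtain b where "b \<in> B" "t < b" using s(3)[OF t(1)] t(3) by (meson not_le)
    then show ?thesis using t by (auto simp: B_def)
  qed
  have st: "P s \<and> (\<forall>y\<in>X. s < y \<longrightarrow> (\<exists>c\<in>X. s < c \<and> (\<forall>t\<in>X. s < t \<longrightarrow> t < c \<longrightarrow> P t)))"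
    using step[OF s(1) \<open>a \<le> s\<close>] below by blast
  have "\<not> (\<exists>y\<in>X. s < y)"
  proof
    assume "\<exists>y\<in>X. s < y"
    then obtain c where c: "c \<in> X" "s < c" "\<And>t. t \<in> X \<Longrightarrow> s < t \<Longrightarrow> t < c \<Longrightarrow> P t"
      using st by blast
    have "P t" if "t \<in> X" "a \<le> t" "t < c" for t
      using below c(3) st that by (metis linorder_cases)
    then have "c \<in> B" using c \<open>a \<le> s\<close> by (auto simp: B_def)
    then show False using s(2) c(2) by force
  qed
  then show ?thesis
    using below st assms(2,3) by (metis linorder_cases)
qed

lemma compact_otop: "compact_space (otop X)"
  unfolding compact_space_def compactin_def
proof (intro conjI allI impI)
  fix \<U> assume \<U>: "Ball \<U> (openin (otop X)) \<and> topspace (otop X) \<subseteq> \<Union>\<U>"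
  obtain a where a: "a \<in> X" "\<And>u. u \<in> X \<Longrightarrow> a \<le> u" using complete[of "{}"] by auto
  obtain w where w: "w \<in> X" "\<And>u. u \<in> X \<Longrightarrow> u \<le> w" using complete[of X] by auto
  let ?P = "\<lambda>z. \<exists>\<F>. finite \<F> \<and> \<F> \<subseteq> \<U> \<and> {t \<in> X. t \<le> z} \<subseteq> \<Union>\<F>"
  have "?P w"
  proof (rule real_induct[where P = ?P, OF a(1) w(1) a(2)[OF w(1)]])
    fix z assume z: "z \<in> X" and below: "\<And>t. t \<in> X \<Longrightarrow> a \<le> t \<Longrightarrow> t < z \<Longrightarrow> ?P t"
    obtain U where U: "U \<in> \<U>" "z \<in> U" using \<U> z by auto
    then obtain A B where AB: "A \<in> ups X X" "B \<in> downs X X" "z \<in> A" "z \<in> B" "A \<inter> B \<subseteq> U"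
      using otop_nbhd \<U> by metis
    obtain \<F> where \<F>: "finite \<F>" "\<F> \<subseteq> \<U>" "{t \<in> X. t \<le> z} \<subseteq> \<Union>\<F>" "A \<inter> B \<subseteq> \<Union>\<F>"
    proof (cases "A = X")
      case True
      have "{t \<in> X. t \<le> z} \<subseteq> A \<inter> B" using True AB(2,4) by (auto simp: downs_def)
      then show ?thesis using that[of "{U}"] U(1) AB(5) by auto
    next
      case False
      then obtain b where b: "b \<in> X" "A = {x \<in> X. b < x}" using AB(1) by (auto simp: ups_def)
      then obtain \<F> where F: "finite \<F>" "\<F> \<subseteq> \<U>" "{t \<in> X. t \<le> b} \<subseteq> \<Union>\<F>"
        using below[OF b(1)] a AB(3) by auto
      have "{t \<in> X. t \<le> z} \<subseteq> {t \<in> X. t \<le> b} \<union> A \<inter> B"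
        using b AB(2,4) by (auto simp: downs_def)
      then have "{t \<in> X. t \<le> z} \<subseteq> \<Union>(insert U \<F>)" using F(3) AB(5) by auto
      then show ?thesis using that[of "insert U \<F>"] F(1,2) U(1) AB(5) by auto
    qed
    have up: "?P t" if t: "t \<in> X" "t \<in> B" "z < t" for t
    proof -
      have "{s \<in> X. s \<le> t} \<subseteq> {s \<in> X. s \<le> z} \<union> A \<inter> B"
        using t AB by (auto simp: ups_def downs_def)
      then have "{s \<in> X. s \<le> t} \<subseteq> \<Union>\<F>" using \<F>(3,4) by blast
      then show ?thesis using \<F>(1,2) by blast
    qed
    show "?P z \<and> (\<forall>y\<in>X. z < y \<longrightarrow> (\<exists>c\<in>X. z < c \<and> (\<forall>t\<in>X. z < t \<longrightarrow> t < c \<longrightarrow> ?P t)))"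
    proof (intro conjI ballI impI)
      show "?P z" using \<F> by blast
      fix y assume y: "y \<in> X" "z < y"
      show "\<exists>c\<in>X. z < c \<and> (\<forall>t\<in>X. z < t \<longrightarrow> t < c \<longrightarrow> ?P t)"
      proof (cases "B = X")
        case True
        then show ?thesis using up y by blast
      next
        case False
        then obtain b where "b \<in> X" "B = {x \<in> X. x < b}" using AB(2) by (auto simp: downs_def)
        then show ?thesis using up AB(4) by (intro bexI[of _ b]) auto
      qed
    qed
  qed
  then obtain \<F> where \<F>: "finite \<F>" "\<F> \<subseteq> \<U>" "{t \<in> X. t \<le> w} \<subseteq> \<Union>\<F>" by blast
  moreover have "{t \<in> X. t \<le> w} = X" using w(2) by blast
  ultimately show "\<exists>\<F>. finite \<F> \<and> \<F> \<subseteq> \<U> \<and> topspace (otop X) \<subseteq> \<Union>\<F>"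
    by (intro exI[of _ \<F>]) simp
qed simp

lemma connectedin_convex:
  assumes "C \<subseteq> X" "\<And>u v. u \<in> C \<Longrightarrow> v \<in> C \<Longrightarrow> segm X u v \<subseteq> C"
  shows "connectedin (otop X) C"
proof -
  have False
    if op: "openin (otop X) E" "openin (otop X) F" and cov: "C \<subseteq> E \<union> F" "E \<inter> F \<inter> C = {}"
      and uv: "u \<in> E \<inter> C" "v \<in> F \<inter> C" "u < v" for E F u v
  proof -
    have uvX: "u \<in> X" "v \<in> X" using uv assms(1) by auto
    have sub: "z \<in> C" if "z \<in> X" "u \<le> z" "z \<le> v" for z
      using assms(2)[of u v] uv that by (auto simp: segm_eq)
    have "v \<le> v \<longrightarrow> v \<in> E"
    proof (rule real_induct[where P = "\<lambda>t. t \<le> v \<longrightarrow> t \<in> E", OF uvX less_imp_le[OF uv(3)]])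
      fix z assume z: "z \<in> X" "u \<le> z"
        and below: "\<And>t. t \<in> X \<Longrightarrow> u \<le> t \<Longrightarrow> t < z \<Longrightarrow> t \<le> v \<longrightarrow> t \<in> E"
      have "z \<in> E" if "z \<le> v"
      proof (rule ccontr)
        assume "z \<notin> E"
        then have "z \<in> F" "u < z" using sub[OF z that] cov uv z by auto
        obtain A B where AB: "A \<in> ups X X" "B \<in> downs X X" "z \<in> A" "z \<in> B" "A \<inter> B \<subseteq> F"
          using otop_nbhd[OF op(2) \<open>z \<in> F\<close>] .
        obtain t where t: "t \<in> X" "u \<le> t" "t < z" "t \<in> A"
        proof (cases "A = X")
          case True
          then show ?thesis using that[of u] uvX \<open>u < z\<close> by auto
        next
          case False
          then obtain b where b: "b \<in> X" "A = {x \<in> X. b < x}" using AB(1) by (auto simp: ups_def)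
          then have "max u b < z" "max u b \<in> X" using AB(3) \<open>u < z\<close> uvX by (auto simp: max_def)
          then obtain t where "t \<in> X" "max u b < t" "t < z" using dense[OF _ z(1)] by blast
          then show ?thesis using that[of t] b by auto
        qed
        moreover have "t \<in> B" using t(1,3) AB(2,4) by (auto simp: downs_def)
        ultimately have "t \<in> F" "t \<in> E" "t \<in> C"
          using AB(5) below[of t] sub[of t] \<open>z \<le> v\<close> by auto
        then show False using cov(2) by blast
      qed
      moreover have "\<exists>c\<in>X. z < c \<and> (\<forall>t\<in>X. z < t \<longrightarrow> t < c \<longrightarrow> t \<le> v \<longrightarrow> t \<in> E)" if y: "y \<in> X" "z < y" for y
      proof (cases "z \<le> v")
        case False
        then show ?thesis using y by (intro bexI[of _ y]) auto
      next
        case True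
        then have "z \<in> E" using \<open>z \<le> v \<Longrightarrow> z \<in> E\<close> by blast
        then obtain A B where AB: "A \<in> ups X X" "B \<in> downs X X" "z \<in> A" "z \<in> B" "A \<inter> B \<subseteq> E"
          using otop_nbhd[OF op(1)] by blast
        have up: "t \<in> E" if "t \<in> X" "z < t" "t \<in> B" for t
          using that AB(1,3,5) by (auto simp: ups_def)
        show ?thesis
        proof (cases "B = X")
          case True
          then show ?thesis using y up by auto
        next
          case False
          then obtain b where "b \<in> X" "B = {x \<in> X. x < b}" using AB(2) by (auto simp: downs_def)
          then show ?thesis using up AB(4) by (intro bexI[of _ b]) auto
        qed
      qed
      ultimately show "(z \<le> v \<longrightarrow> z \<in> E) \<and>
          (\<forall>y\<in>X. z < y \<longrightarrow> (\<exists>c\<in>X. z < c \<and> (\<forall>t\<in>X. z < t \<longrightarrow> t < c \<longrightarrow> t \<le> v \<longrightarrow> t \<in> E)))"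
        by blast
    qed
    then show False using uv cov by auto
  qed note sep = this
  show ?thesis
    unfolding connectedin
  proof (intro conjI notI)
    show "C \<subseteq> topspace (otop X)" using assms(1) by simp
    assume "\<exists>E1 E2. openin (otop X) E1 \<and> openin (otop X) E2 \<and> C \<subseteq> E1 \<union> E2 \<and>
        E1 \<inter> E2 \<inter> C = {} \<and> E1 \<inter> C \<noteq> {} \<and> E2 \<inter> C \<noteq> {}"
    then obtain E F u v where EF: "openin (otop X) E" "openin (otop X) F" "C \<subseteq> E \<union> F" "E \<inter> F \<inter> C = {}"
      and uv: "u \<in> E \<inter> C" "v \<in> F \<inter> C" by blast
    then have "u \<noteq> v" by auto
    then consider "u < v" | "v < u" by fastforce
    then show False
    proof cases
      case 1
      then show ?thesis using sep[OF EF uv] by blast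
    next
      case 2
      have "C \<subseteq> F \<union> E" "F \<inter> E \<inter> C = {}" using EF by auto
      then show ?thesis using sep[OF EF(2,1) _ _ uv(2,1) 2] by blast
    qed
  qed
qed

lemma connectedin_segm: "u \<in> X \<Longrightarrow> v \<in> X \<Longrightarrow> connectedin (otop X) (segm X u v)"
  by (rule connectedin_convex) (auto dest: in_segmD segm_subset)

lemma convex_if_connectedin:
  assumes "connectedin (otop X) C" "u \<in> C" "v \<in> C"
  shows "segm X u v \<subseteq> C"
proof
  have *: "w \<in> C" if "u \<in> C" "v \<in> C" "w \<in> X" "u < w" "w < v" for u v w
  proof (rule ccontr)
    assume "w \<notin> C"
    have CX: "C \<subseteq> X" using connectedin_subset_topspace[OF assms(1)] by simp
    show False
    proof (rule connectedinD[OF assms(1) openin_lesser[OF that(3)] openin_greater[OF that(3)]])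
      show "C \<subseteq> {x \<in> X. x < w} \<union> {x \<in> X. w < x}"
        using CX \<open>w \<notin> C\<close> by (auto simp: not_less order_le_less)
      show "{x \<in> X. x < w} \<inter> C \<noteq> {}" "{x \<in> X. w < x} \<inter> C \<noteq> {}"
        using that CX by blast+
    qed auto
  qed
  fix w assume "w \<in> segm X u v"
  then have "w \<in> X" "u \<le> w \<and> w \<le> v \<or> v \<le> w \<and> w \<le> u"
    by (auto simp: segm_def min_def max_def split: if_splits)
  then show "w \<in> C" using *[OF assms(2,3)] *[OF assms(3,2)] assms(2,3) by (metis order_le_less)
qed

lemma connected_otop: "connected_space (otop X)"
  using connectedin_convex[of X] in_segmD by (auto simp flip: connectedin_topspace)

lemma Hausdorff_otop: "Hausdorff_space (otop X)"
proof -
  have *: "\<exists>U V. openin (otop X) U \<and> openin (otop X) V \<and> x \<in> U \<and> y \<in> V \<and> disjnt U V"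
    if xy: "x \<in> X" "y \<in> X" "x < y" for x y
  proof -
    obtain z where z: "z \<in> X" "x < z" "z < y" using dense[OF xy] by blast
    then show ?thesis
      using openin_lesser[OF z(1)] openin_greater[OF z(1)] xy
      by (intro exI[of _ "{t \<in> X. t < z}"] exI[of _ "{t \<in> X. z < t}"]) (auto simp: disjnt_def)
  qed
  show ?thesis
    unfolding Hausdorff_space_def
  proof (intro allI impI)
    fix x y assume "x \<in> topspace (otop X) \<and> y \<in> topspace (otop X) \<and> x \<noteq> y"
    then have xy: "x \<in> X" "y \<in> X" "x \<noteq> y" by auto
    show "\<exists>U V. openin (otop X) U \<and> openin (otop X) V \<and> x \<in> U \<and> y \<in> V \<and> disjnt U V"
    proof (cases "x < y")
      case True
      then show ?thesis using * xy by blast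
    next
      case False
      then obtain U V where "openin (otop X) U" "openin (otop X) V" "y \<in> U" "x \<in> V" "disjnt U V"
        using *[of y x] xy by (auto simp: not_less order_le_less)
      then show ?thesis using disjnt_sym by blast
    qed
  qed
qed

text \<open>A path between two different points covers the segment between them, and its values at
  rational times are dense in its image. They cannot miss an open interval of that segment.\<close>

lemma totally_pathwise_disconnected_otop:
  assumes nowhere_separable: "\<And>x y G. x \<in> X \<Longrightarrow> y \<in> X \<Longrightarrow> x < y \<Longrightarrow> countable G \<Longrightarrow> G \<subseteq> X \<Longrightarrow>
     \<exists>u\<in>X. \<exists>v\<in>X. x < u \<and> u < v \<and> v < y \<and> (\<forall>g\<in>G. \<not> (u \<le> g \<and> g \<le> v))"
  shows "totally_pathwise_disconnected (otop X)"
proof -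
  have *: False if xy: "x \<in> X" "y \<in> X" "x < y" and C: "g ` {0..1::real} \<supseteq> segm X x y"
      and g: "continuous_map (top_of_set {0..1}) (otop X) g" for x y g
  proof -
    let ?G = "g ` ({0..1} \<inter> \<rat>)"
    have "?G \<subseteq> X" using g by (auto simp: continuous_map_def)
    moreover have "countable ?G" using countable_rat by (intro countable_image) auto
    ultimately obtain u v where uv: "u \<in> X" "v \<in> X" "x < u" "u < v" "v < y"
        "\<And>h. h \<in> ?G \<Longrightarrow> \<not> (u \<le> h \<and> h \<le> v)"
      using nowhere_separable[OF xy] by meson
    define W where "W = {t \<in> X. u < t} \<inter> {t \<in> X. t < v}"
    have "openin (otop X) W"
      unfolding W_def using uv by (intro openin_Int openin_greater openin_lesser)
    then have "openin (top_of_set {0..1}) {t \<in> {0..1}. g t \<in> W}"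
      using openin_continuous_map_preimage[OF g] by simp
    then obtain S where S: "open S" "{t \<in> {0..1}. g t \<in> W} = {0..1} \<inter> S"
      unfolding openin_open by blast
    obtain w where "w \<in> W" using dense[OF uv(1,2,4)] by (auto simp: W_def)
    then have "w \<in> segm X x y" using uv by (auto simp: W_def segm_def min_def max_def)
    then obtain t where t: "t \<in> {0..1} \<inter> S" using C \<open>w \<in> W\<close> S(2) by blast
    have "\<exists>q. q \<in> \<rat> \<and> q \<in> {0..1} \<inter> S"
    proof -
      obtain e where e: "e > 0" "ball t e \<subseteq> S" using S(1) t openE by blast
      have "max 0 (t - e) < min 1 (t + e)" using t e by auto
      then obtain q where "q \<in> \<rat>" "max 0 (t - e) < q" "q < min 1 (t + e)" using Rats_dense_in_real by blast
      then have "q \<in> \<rat> \<and> q \<in> {0..1} \<inter> S" using e(2) by (auto simp: ball_def dist_real_def subset_iff)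
      then show ?thesis ..
    qed
    then obtain q where "q \<in> \<rat>" "q \<in> {0..1}" "g q \<in> W" using S(2) by blast
    then have "g q \<in> ?G" "u \<le> g q" "g q \<le> v" by (auto simp: W_def)
    then show False using uv(6) by blast
  qed
  have eq: "x = y" if pc: "path_component_of (otop X) x y" for x y
  proof (rule ccontr)
    assume "x \<noteq> y"
    obtain g where g: "continuous_map (top_of_set {0..1::real}) (otop X) g" "g 0 = x" "g 1 = y"
      using pc unfolding path_component_of_def pathin_def by blast
    have "connectedin (otop X) (g ` {0..1})"
      by (rule connectedin_continuous_map_image[OF g(1)])
         (simp add: connectedin_subtopology connectedin_iff_connected)
    then have sub: "segm X x y \<subseteq> g ` {0..1}" "segm X y x \<subseteq> g ` {0..1}"
      using convex_if_connectedin[of "g ` {0..1}"] g(2,3) by force+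
    have "x \<in> X" "y \<in> X" using pc path_component_in_topspace by force+
    then show False using *[OF _ _ _ sub(1) g(1)] *[OF _ _ _ sub(2) g(1)] \<open>x \<noteq> y\<close>
      by (metis linorder_neqE)
  qed
  show ?thesis
    unfolding totally_pathwise_disconnected_def path_components_of_def
  proof safe
    fix x assume "x \<in> topspace (otop X)"
    then have "path_component_of_set (otop X) x = {x}"
      using eq path_component_of_refl by fastforce
    then show "\<exists>y. path_component_of_set (otop X) x = {y}" by blast
  qed
qed

end

text \<open>The segment between two points is the least connected set that contains them.\<close>

lemma embedding_preserves_segm:
  assumes "complete_dense_order X" "complete_dense_order Y"
    and hom: "homeomorphic_maps (otop X) (subtopology (otop Y) S) \<phi> \<psi>"
    and uv: "u \<in> X" "v \<in> X"
  shows "\<phi> ` segm X u v = segm Y (\<phi> u) (\<phi> v)"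
proof -
  interpret X: complete_dense_order X by fact
  interpret Y: complete_dense_order Y by fact
  have \<phi>: "continuous_map (otop X) (otop Y) \<phi>" and \<psi>: "continuous_map (subtopology (otop Y) S) (otop X) \<psi>"
    and inv: "\<And>x. x \<in> X \<Longrightarrow> \<psi> (\<phi> x) = x" "\<And>y. y \<in> Y \<inter> S \<Longrightarrow> \<phi> (\<psi> y) = y"
    and img: "\<phi> ` X \<subseteq> Y \<inter> S"
    using hom unfolding homeomorphic_maps_def continuous_map_in_subtopology
    by (simp_all add: Pi_iff image_subset_iff continuous_map_def)
  have \<psi>X: "\<psi> y \<in> X" if "y \<in> Y \<inter> S" for y using \<psi> that by (auto simp: continuous_map_def)
  have sub: "segm Y (\<phi> a) (\<phi> b) \<subseteq> \<phi> ` C" if "connectedin (otop X) C" "a \<in> C" "b \<in> C" for a b C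
    using connectedin_continuous_map_image[OF \<phi> that(1)] that by (intro Y.convex_if_connectedin) auto
  show ?thesis
  proof
    show "segm Y (\<phi> u) (\<phi> v) \<subseteq> \<phi> ` segm X u v"
      using X.connectedin_segm[OF uv] uv by (intro sub) auto
    have "segm Y (\<phi> u) (\<phi> v) \<subseteq> \<phi> ` X"
      using X.connected_otop uv by (intro sub) (auto simp flip: connectedin_topspace)
    then have S: "segm Y (\<phi> u) (\<phi> v) \<subseteq> Y \<inter> S" using img by blast
    have in_Y: "\<phi> u \<in> Y" "\<phi> v \<in> Y" using img uv by auto
    have "connectedin (subtopology (otop Y) S) (segm Y (\<phi> u) (\<phi> v))"
      using Y.connectedin_segm[OF in_Y] S by (simp add: connectedin_subtopology)
    then have "connectedin (otop X) (\<psi> ` segm Y (\<phi> u) (\<phi> v))"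
      using connectedin_continuous_map_image[OF \<psi>] by blast
    moreover have "u \<in> \<psi> ` segm Y (\<phi> u) (\<phi> v)" "v \<in> \<psi> ` segm Y (\<phi> u) (\<phi> v)"
      using inv(1)[OF uv(1)] inv(1)[OF uv(2)] in_Y by (metis ends_in_segm imageI)+
    ultimately have "segm X u v \<subseteq> \<psi> ` segm Y (\<phi> u) (\<phi> v)"
      by (rule X.convex_if_connectedin)
    then show "\<phi> ` segm X u v \<subseteq> segm Y (\<phi> u) (\<phi> v)"
      using S inv(2) by (auto simp: subset_iff image_iff)
  qed
qed

section \<open>The trees that code sets of reals\<close>

definition Q :: "real set" where
  "Q = {0<..<1} \<inter> \<rat>"

definition q :: "nat \<Rightarrow> real" where
  "q = from_nat_into Q"

lemma Q_between:
  assumes "0 \<le> u" "u < v" "v \<le> (1 :: real)"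
  obtains d where "d \<in> Q" "u < d" "d < v"
  using Rats_dense_in_real[OF assms(2)] assms by (auto simp: Q_def)

lemma countable_Q: "countable Q"
  unfolding Q_def using countable_rat by (rule countable_subset[rotated]) auto

lemma range_q: "range q = Q"
proof -
  have "Q \<noteq> {}" using Q_between[of 0 1] by auto
  then show ?thesis unfolding q_def using countable_Q by (rule range_from_nat_into)
qed

lemma inj_q: "inj q"
proof -
  have "infinite Q"
  proof
    assume "finite Q"
    moreover have "Q \<noteq> {}" using Q_between[of 0 1] by auto
    ultimately have "Min Q \<in> Q" "\<And>d. d \<in> Q \<Longrightarrow> Min Q \<le> d" by auto
    moreover obtain d where "d \<in> Q" "d < Min Q"
      using Q_between[of 0 "Min Q"] \<open>Min Q \<in> Q\<close> by (auto simp: Q_def)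
    ultimately show False by fastforce
  qed
  then show ?thesis
    unfolding q_def using countable_Q by (auto simp: inj_def)
qed

text \<open>The numbers \<open>2 n + 2\<close> and \<open>2 n + 3\<close> record the two possible positions of \<open>a\<close> relative to the
  \<open>n\<close>-th rational. Recording both outcomes turns inclusion of codes into equality.\<close>

definition code :: "real \<Rightarrow> nat set" where
  "code a = {2 * n + 2 |n. from_nat_into \<rat> n < a} \<union> {2 * n + 3 |n. \<not> from_nat_into \<rat> n < a}"

lemma code_antichain:
  assumes "code a \<subseteq> code b"
  shows "a = b"
proof (rule ccontr)
  have iff: "from_nat_into \<rat> n < a \<longleftrightarrow> from_nat_into \<rat> n < b" for n
  proof
    assume "from_nat_into \<rat> n < a"
    then have "2 * n + 2 \<in> code b" using assms by (auto simp: code_def)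
    then show "from_nat_into \<rat> n < b" by (auto simp: code_def) presburger
  next
    assume "from_nat_into \<rat> n < b"
    show "from_nat_into \<rat> n < a"
    proof (rule ccontr)
      assume "\<not> from_nat_into \<rat> n < a"
      then have "2 * n + 3 \<in> code b" using assms by (auto simp: code_def)
      then show False using \<open>from_nat_into \<rat> n < b\<close> by (auto simp: code_def) presburger
    qed
  qed
  assume "a \<noteq> b"
  then have "min a b < max a b" by (auto simp: min_def max_def)
  then obtain r where r: "r \<in> \<rat>" "min a b < r" "r < max a b"
    using Rats_dense_in_real by blast
  then obtain n where "from_nat_into \<rat> n = r"
    using from_nat_into_surj[OF countable_rat r(1)] by blast
  then show False using iff[of n] r by (auto simp: min_def max_def split: if_splits)
qed

lemma code_ge_2: "n \<in> code a \<Longrightarrow> 2 \<le> n"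
  by (auto simp: code_def)

lemma code_nonempty: "code a \<noteq> {}"
  by (auto simp: code_def)

text \<open>The number of uncountable levels below the digit \<open>d\<close> in the block that codes \<open>a\<close>. The digits
  \<open>1 / (n + 2)\<close> are isolated from each other and accumulate only at \<open>0\<close>; the one with \<open>n \<in> code a\<close>
  receives \<open>n\<close> uncountable levels, and then \<open>\<lfloor>1 / d\<rfloor> - 2 = n\<close>. All other digits receive none.\<close>

definition depth :: "real \<Rightarrow> real \<Rightarrow> nat" where
  "depth a d = (if \<exists>n\<in>code a. d = 1 / (real n + 2) then nat \<lfloor>1 / d\<rfloor> - 2 else 0)"

lemma depth_code: "n \<in> code a \<Longrightarrow> depth a (1 / (real n + 2)) = n"
  unfolding depth_def by (auto simp: nat_eq_iff floor_eq_iff)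

lemma depth_pos: "depth a d \<noteq> 0 \<Longrightarrow> depth a d \<in> code a \<and> d = 1 / (real (depth a d) + 2)"
  using depth_code by (metis depth_def)

lemma code_digit_in_Q: "1 / (real n + 2) \<in> Q"
  by (auto simp: Q_def field_simps)

lemma depth_locally_0:
  assumes "0 < d" "d < 1"
  obtains u v where "0 < u" "u < d" "d < v" "v < 1" "\<And>e. u \<le> e \<Longrightarrow> e \<le> v \<Longrightarrow> e \<noteq> d \<Longrightarrow> depth a e = 0"
proof -
  define M where "M = {e. d / 2 \<le> e \<and> depth a e \<noteq> 0}"
  have "M \<subseteq> (\<lambda>n. 1 / (real n + 2)) ` {..nat \<lceil>2 / d\<rceil>}"
  proof
    fix e assume e: "e \<in> M"
    then have *: "e = 1 / (real (depth a e) + 2)" "d / 2 \<le> e" using depth_pos by (auto simp: M_def)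
    then have "d / 2 \<le> 1 / (real (depth a e) + 2)" by simp
    then have "real (depth a e) \<le> 2 / d" using assms by (simp add: field_simps)
    then have "depth a e \<le> nat \<lceil>2 / d\<rceil>" by linarith
    then show "e \<in> (\<lambda>n. 1 / (real n + 2)) ` {..nat \<lceil>2 / d\<rceil>}" using * by blast
  qed
  then have "finite M" by (rule finite_subset) simp
  then obtain \<epsilon> where \<epsilon>: "\<epsilon> > 0" "\<And>e. e \<in> M \<Longrightarrow> e \<noteq> d \<Longrightarrow> \<epsilon> \<le> dist d e"
    using finite_set_avoid[of M d] by blast
  \<comment> \<open>\<open>M\<close> has no point other than \<open>d\<close> within \<open>\<epsilon>\<close>; the other two bounds keep the interval inside \<open>{d / 2..<1}\<close>\<close>
  define \<delta> where "\<delta> = Min {\<epsilon> / 2, d / 2, (1 - d) / 2}"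
  have "\<delta> \<le> \<epsilon> / 2" "\<delta> \<le> d / 2" "\<delta> \<le> (1 - d) / 2"
    unfolding \<delta>_def by (rule Min_le; simp)+
  moreover have "0 < \<delta>" using \<epsilon>(1) assms by (auto simp: \<delta>_def)
  ultimately have \<delta>: "0 < \<delta>" "\<delta> < \<epsilon>" "\<delta> \<le> d / 2" "\<delta> < 1 - d" using \<epsilon>(1) assms by auto
  show thesis
  proof (rule that[of "d - \<delta>" "d + \<delta>"])
    fix e assume e: "d - \<delta> \<le> e" "e \<le> d + \<delta>" "e \<noteq> d"
    show "depth a e = 0"
    proof (rule ccontr)
      assume "depth a e \<noteq> 0"
      then have "e \<in> M" using e \<delta> by (auto simp: M_def)
      then show False using \<epsilon>(2)[of e] e \<delta> by (auto simp: dist_real_def)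
    qed
  qed (use \<delta> assms in auto)
qed

definition depth_of :: "pt \<Rightarrow> nat" where
  "depth_of x = depth (dig x (fin 0)) (dig x (fin 1))"

text \<open>At the root every element of \<open>Q \<union> S\<close> may be chosen; this is the real that is coded below
  it. The second digit chooses a number of uncountable levels, which follow
  immediately; from then on all levels are countable.\<close>

definition digits :: "real set \<Rightarrow> real set \<Rightarrow> pt \<Rightarrow> omega1 \<Rightarrow> real set" where
  "digits A S x \<xi> = (if \<xi> = fin 0 then Q \<union> S
     else if \<exists>j<depth_of x. \<xi> = fin (j + 2) then A else Q)"

text \<open>Closeness to the coherent sequence makes the part of the tree with countable levels an
  Aronszajn tree.\<close>

definition node :: "real set \<Rightarrow> real set \<Rightarrow> omega1 \<Rightarrow> pt \<Rightarrow> bool" where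
  "node A S \<beta> x \<longleftrightarrow> (\<forall>\<xi><\<beta>. dig x \<xi> \<in> digits A S x \<xi>) \<and> finite {\<xi>. \<xi> < \<beta> \<and> dig x \<xi> \<noteq> q (coh \<beta> \<xi>)}"

lemma fin_less_iff [simp]: "fin m < fin n \<longleftrightarrow> m < n"
  using strict_mono_fin by (rule strict_mono_less)

lemma fin_eq_iff [simp]: "fin m = fin n \<longleftrightarrow> m = n"
  using strict_mono_fin by (rule strict_mono_eq)

lemma depth_of_cong: "agree (fin 2) x y \<Longrightarrow> depth_of x = depth_of y"
  by (simp add: depth_of_def agree_def)

lemma digits_cong:
  assumes "agree \<xi> x y"
  shows "digits A S x \<xi> = digits A S y \<xi>"
proof (cases "\<exists>j. \<xi> = fin (j + 2)")
  case True
  then obtain j where j: "\<xi> = fin (j + 2)" by blast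
  have "fin 2 \<le> \<xi>" unfolding j using fin_less_iff[of "j + 2" 2] by (auto simp: not_less[symmetric])
  then have "depth_of x = depth_of y" using assms agree_le depth_of_cong by blast
  then show ?thesis by (simp add: digits_def)
next
  case False
  then show ?thesis by (auto simp: digits_def)
qed

locale coded_tree =
  fixes A S :: "real set"
  assumes A_sub: "A \<subseteq> {0<..<1}" and Q_sub: "Q \<subseteq> A" and S_sub: "S \<subseteq> A"
    and A_uncountable: "\<And>u v. 0 \<le> u \<Longrightarrow> u < v \<Longrightarrow> v \<le> 1 \<Longrightarrow> uncountable (A \<inter> {u<..<v})"
begin

abbreviation "Nd \<equiv> node A S"

lemma digits_subset: "Q \<subseteq> digits A S x \<xi>" "digits A S x \<xi> \<subseteq> A"
  using Q_sub S_sub by (auto simp: digits_def)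

lemma node_le:
  assumes "\<alpha> \<le> \<beta>" "Nd \<beta> x"
  shows "Nd \<alpha> x"
proof (cases "\<alpha> = \<beta>")
  case False
  then have "\<alpha> < \<beta>" using assms by simp
  have "{\<xi>. \<xi> < \<alpha> \<and> dig x \<xi> \<noteq> q (coh \<alpha> \<xi>)} \<subseteq>
      {\<xi>. \<xi> < \<alpha> \<and> coh \<alpha> \<xi> \<noteq> coh \<beta> \<xi>} \<union> {\<xi>. \<xi> < \<beta> \<and> dig x \<xi> \<noteq> q (coh \<beta> \<xi>)}"
    using \<open>\<alpha> < \<beta>\<close> by auto
  then have "finite {\<xi>. \<xi> < \<alpha> \<and> dig x \<xi> \<noteq> q (coh \<alpha> \<xi>)}"
    using assms(2) coh_coherent[OF \<open>\<alpha> < \<beta>\<close>] finite_subset unfolding node_def by blast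
  then show ?thesis using assms by (auto simp: node_def)
qed (use assms in simp)

lemma node_cong: "agree \<beta> x y \<Longrightarrow> Nd \<beta> x \<Longrightarrow> Nd \<beta> y"
proof -
  assume a: "agree \<beta> x y" and n: "Nd \<beta> x"
  have "digits A S x \<xi> = digits A S y \<xi>" "dig x \<xi> = dig y \<xi>" if "\<xi> < \<beta>" for \<xi>
    using digits_cong[OF agree_le[OF a]] a that by (auto simp: agree_def)
  moreover from this have "{\<xi>. \<xi> < \<beta> \<and> dig y \<xi> \<noteq> q (coh \<beta> \<xi>)} = {\<xi>. \<xi> < \<beta> \<and> dig x \<xi> \<noteq> q (coh \<beta> \<xi>)}"
    by auto
  ultimately show "Nd \<beta> y" using n unfolding node_def by simp
qed

lemma node_suc_iff: "Nd (suc \<xi>) x \<longleftrightarrow> Nd \<xi> x \<and> dig x \<xi> \<in> digits A S x \<xi>"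
proof
  assume "Nd (suc \<xi>) x"
  then show "Nd \<xi> x \<and> dig x \<xi> \<in> digits A S x \<xi>"
    using node_le[of \<xi> "suc \<xi>"] less_suc by (auto simp: node_def less_imp_le)
next
  assume n: "Nd \<xi> x \<and> dig x \<xi> \<in> digits A S x \<xi>"
  have "{\<eta>. \<eta> < suc \<xi> \<and> dig x \<eta> \<noteq> q (coh (suc \<xi>) \<eta>)} \<subseteq>
      insert \<xi> ({\<eta>. \<eta> < \<xi> \<and> coh \<xi> \<eta> \<noteq> coh (suc \<xi>) \<eta>} \<union> {\<eta>. \<eta> < \<xi> \<and> dig x \<eta> \<noteq> q (coh \<xi> \<eta>)})"
    by (auto simp: less_suc_iff order_le_less)
  then have "finite {\<eta>. \<eta> < suc \<xi> \<and> dig x \<eta> \<noteq> q (coh (suc \<xi>) \<eta>)}"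
    using n coh_coherent[OF less_suc] finite_subset unfolding node_def by (metis (no_types, lifting) finite_Un finite_insert)
  then show "Nd (suc \<xi>) x" using n by (auto simp: node_def less_suc_iff order_le_less)
qed

text \<open>Along a branch of length \<open>\<omega>\<^sub>1\<close> a fixed value \<open>q k\<close> occurs only finitely often below
  every \<open>\<beta>\<close>, because \<open>coh \<beta>\<close> is finite-to-one, and only finitely many digits below \<open>\<beta>\<close> are outside
  of \<open>Q\<close>. Hence there would be only countably many positions.\<close>

lemma node_bounded: "\<exists>\<beta>. \<not> Nd \<beta> x"
proof (rule ccontr)
  assume "\<nexists>\<beta>. \<not> Nd \<beta> x"
  then have n: "finite {\<xi>. \<xi> < \<beta> \<and> dig x \<xi> \<noteq> q (coh \<beta> \<xi>)}" for \<beta> by (simp add: node_def)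
  have "countable {\<xi>. dig x \<xi> = q k}" for k
  proof (rule countable_if_finite_below)
    fix \<beta>
    have "{\<xi> \<in> {\<xi>. dig x \<xi> = q k}. \<xi> < \<beta>} \<subseteq>
        {\<xi>. \<xi> < \<beta> \<and> dig x \<xi> \<noteq> q (coh \<beta> \<xi>)} \<union> {\<xi>. \<xi> < \<beta> \<and> coh \<beta> \<xi> \<le> k}"
      using inj_q by (auto simp: inj_eq)
    then show "finite {\<xi> \<in> {\<xi>. dig x \<xi> = q k}. \<xi> < \<beta>}"
      using n[of \<beta>] coh_finite_to_one finite_subset by blast
  qed
  moreover have "countable {\<xi>. dig x \<xi> \<notin> range q}"
  proof (rule countable_if_finite_below)
    fix \<beta>
    have "{\<xi> \<in> {\<xi>. dig x \<xi> \<notin> range q}. \<xi> < \<beta>} \<subseteq> {\<xi>. \<xi> < \<beta> \<and> dig x \<xi> \<noteq> q (coh \<beta> \<xi>)}"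
      by auto
    then show "finite {\<xi> \<in> {\<xi>. dig x \<xi> \<notin> range q}. \<xi> < \<beta>}"
      using n[of \<beta>] finite_subset by blast
  qed
  ultimately have "countable ((\<Union>k. {\<xi>. dig x \<xi> = q k}) \<union> {\<xi>. dig x \<xi> \<notin> range q})" by blast
  moreover have "(\<Union>k. {\<xi>. dig x \<xi> = q k}) \<union> {\<xi>. dig x \<xi> \<notin> range q} = UNIV" by auto
  ultimately show False using uncountable_omega1 by simp
qed

lemma node_extend:
  assumes "Nd \<xi> x" "\<xi> \<le> \<gamma>"
  shows "\<exists>y. agree \<xi> x y \<and> Nd \<gamma> y"
proof -
  define y where "y = Pt (\<lambda>\<eta>. if \<eta> < \<xi> then dig x \<eta> else q (coh \<gamma> \<eta>))"
  have a: "agree \<xi> x y" by (simp add: y_def agree_def)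
  have "dig y \<eta> \<in> digits A S y \<eta>" if "\<eta> < \<gamma>" for \<eta>
  proof (cases "\<eta> < \<xi>")
    case True
    then show ?thesis using node_cong[OF a assms(1)] by (simp add: node_def)
  next
    case False
    then have "dig y \<eta> \<in> Q" using range_q by (auto simp: y_def)
    then show ?thesis using digits_subset by blast
  qed
  moreover have "finite {\<eta>. \<eta> < \<gamma> \<and> dig y \<eta> \<noteq> q (coh \<gamma> \<eta>)}"
  proof (cases "\<xi> = \<gamma>")
    case True
    then show ?thesis using node_cong[OF a assms(1)] by (simp add: node_def)
  next
    case False
    then have "\<xi> < \<gamma>" using assms(2) by simp
    have "{\<eta>. \<eta> < \<gamma> \<and> dig y \<eta> \<noteq> q (coh \<gamma> \<eta>)} \<subseteq>
        {\<eta>. \<eta> < \<xi> \<and> coh \<xi> \<eta> \<noteq> coh \<gamma> \<eta>} \<union> {\<eta>. \<eta> < \<xi> \<and> dig x \<eta> \<noteq> q (coh \<xi> \<eta>)}"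
      by (auto simp: y_def split: if_splits)
    then show ?thesis using assms(1) coh_coherent[OF \<open>\<xi> < \<gamma>\<close>] finite_subset
      unfolding node_def by blast
  qed
  ultimately show ?thesis using a by (auto simp: node_def)
qed

lemma node_trunc_suc:
  assumes "Nd \<xi> x" "d \<in> digits A S x \<xi>"
  shows "Nd (suc \<xi>) (trunc x \<xi> d)"
  unfolding node_suc_iff
  using assms node_cong[OF agree_trunc(1)] digits_cong[OF agree_trunc(1)[of \<xi> x d], of A S] by simp

sublocale node_tree Nd
proof
  show "Nd (fin 0) x" for x
    using fin_0_le by (auto simp: node_def not_less[symmetric])
  show "0 < dig x \<xi> \<and> dig x \<xi> < 1" if "Nd (suc \<xi>) x" for \<xi> x
    using that digits_subset(2)[of x \<xi>] A_sub by (auto simp: node_suc_iff)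
  show "\<exists>d. u < d \<and> d < v \<and> Nd (suc \<xi>) (trunc x \<xi> d)"
    if "Nd \<xi> x" "0 \<le> u" "u < v" "v \<le> 1" for \<xi> x u v
    using Q_between[OF that(2-4)] node_trunc_suc[OF that(1)] digits_subset(1) by (metis subsetD)
qed (fact node_le node_cong node_bounded node_extend)+

section \<open>Counting nodes\<close>

text \<open>A node is determined by its length and the finitely many places where it departs from the coherent
  sequence; this counts the nodes.\<close>

definition exceptions :: "omega1 \<Rightarrow> pt \<Rightarrow> (omega1 \<times> real) set" where
  "exceptions \<beta> x = (\<lambda>\<xi>. (\<xi>, dig x \<xi>)) ` {\<xi>. \<xi> < \<beta> \<and> dig x \<xi> \<noteq> q (coh \<beta> \<xi>)}"

lemma finite_exceptions: "Nd \<beta> x \<Longrightarrow> finite (exceptions \<beta> x)"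
  by (simp add: exceptions_def node_def)

lemma exceptions_eq_agree:
  assumes "exceptions \<beta> x = exceptions \<beta> y"
  shows "agree \<beta> x y"
  unfolding agree_def
proof (intro allI impI)
  fix \<xi> assume "\<xi> < \<beta>"
  have "(\<xi>, dig x \<xi>) \<in> exceptions \<beta> x \<longleftrightarrow> dig x \<xi> \<noteq> q (coh \<beta> \<xi>)"
    "(\<xi>, dig y \<xi>) \<in> exceptions \<beta> y \<longleftrightarrow> dig y \<xi> \<noteq> q (coh \<beta> \<xi>)"
    using \<open>\<xi> < \<beta>\<close> by (auto simp: exceptions_def)
  moreover have "(\<xi>, d) \<in> exceptions \<beta> x \<Longrightarrow> d = dig x \<xi>" "(\<xi>, d) \<in> exceptions \<beta> y \<Longrightarrow> d = dig y \<xi>" for d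
    by (auto simp: exceptions_def)
  ultimately show "dig x \<xi> = dig y \<xi>" using assms by metis
qed

text \<open>All levels from \<open>\<xi>\<close> on are countable in the subtree of this node.\<close>

definition flat :: "omega1 \<Rightarrow> pt \<Rightarrow> bool" where
  "flat \<xi> x \<longleftrightarrow> (\<forall>y \<eta>. agree \<xi> x y \<longrightarrow> \<xi> \<le> \<eta> \<longrightarrow> digits A S y \<eta> = Q)"

lemma countable_flat_nodes:
  assumes "flat \<xi> x"
  shows "countable {trunc y \<zeta> 0 | y. Nd \<zeta> y \<and> agree \<xi> x y}"
proof (rule countable_image_inj_on[where f = "exceptions \<zeta>"])
  have ex: "exceptions \<zeta> (trunc y \<zeta> 0) = exceptions \<zeta> y" for y
    by (auto simp: exceptions_def dig_trunc intro!: image_cong)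
  let ?C = "{..<\<zeta>} \<times> (Q \<union> dig x ` {..<\<xi>})"
  have "exceptions \<zeta> ` {trunc y \<zeta> 0 | y. Nd \<zeta> y \<and> agree \<xi> x y} \<subseteq> {M. finite M \<and> M \<subseteq> ?C}"
  proof (intro image_subsetI CollectI conjI subsetI)
    fix z assume "z \<in> {trunc y \<zeta> 0 | y. Nd \<zeta> y \<and> agree \<xi> x y}"
    then obtain y where z: "z = trunc y \<zeta> 0" and y: "Nd \<zeta> y" "agree \<xi> x y" by blast
    show "finite (exceptions \<zeta> z)" using ex z finite_exceptions[OF y(1)] by simp
    fix p assume p: "p \<in> exceptions \<zeta> z"
    then obtain a where a: "p = (a, dig y a)" "a < \<zeta>" unfolding z ex by (auto simp: exceptions_def)
    have "dig y a \<in> Q \<union> dig x ` {..<\<xi>}"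
    proof (cases "a < \<xi>")
      case True
      then show ?thesis using y(2) by (auto simp: agree_def)
    next
      case False
      have "dig y a \<in> digits A S y a" using y(1) a by (auto simp: node_def)
      then show ?thesis using assms y(2) False by (auto simp: flat_def)
    qed
    then show "p \<in> ?C" using a by simp
  qed
  moreover have "countable ?C"
    using countable_below countable_Q by (intro countable_SIGMA countable_Un countable_image)
  then have "countable {M. finite M \<and> M \<subseteq> ?C}" by (rule countable_Collect_finite_subset)
  ultimately show "countable (exceptions \<zeta> ` {trunc y \<zeta> 0 | y. Nd \<zeta> y \<and> agree \<xi> x y})"
    by (rule countable_subset)
  show "inj_on (exceptions \<zeta>) {trunc y \<zeta> 0 | y. Nd \<zeta> y \<and> agree \<xi> x y}"
  proof (rule inj_onI, safe)
    fix y y' assume "exceptions \<zeta> (trunc y \<zeta> 0) = exceptions \<zeta> (trunc y' \<zeta> 0)"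
    then have "agree \<zeta> y y'" using ex exceptions_eq_agree by metis
    then show "trunc y \<zeta> 0 = trunc y' \<zeta> 0" by (rule trunc_cong)
  qed
qed

end

section \<open>The rank of the intervals of a coded continuum\<close>

context coded_tree
begin

lemma rat_trunc_segm:
  assumes "a \<in> X" "b \<in> X" "agree \<xi> x a" "agree \<xi> x b" "dig a \<xi> < dig b \<xi>"
  obtains r where "trunc x \<xi> (of_rat r) \<in> segm X a b"
proof -
  obtain r where r: "dig a \<xi> < of_rat r" "of_rat r < dig b \<xi>" using of_rat_dense[OF assms(5)] by blast
  have ab: "agree \<xi> a b" using assms(3,4) agree_sym agree_trans by blast
  have "trunc a \<xi> (of_rat r) = trunc x \<xi> (of_rat r)"
    by (rule trunc_cong[OF agree_sym[OF assms(3)]])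
  moreover have "trunc a \<xi> (of_rat r) \<in> segm X a b"
    using trunc_between[OF assms(1,2) ab r] by (intro segmI less_imp_le)
  ultimately show thesis using that[of r] by simp
qed

lemma Nd_suc_if_agree:
  assumes "a \<in> X" "b \<in> X" "agree (suc \<xi>) a b" "a \<noteq> b"
  shows "Nd (suc \<xi>) a"
proof -
  obtain \<zeta> where \<zeta>: "agree \<zeta> a b" "dig a \<zeta> \<noteq> dig b \<zeta>" using first_difference[OF assms(4)] .
  then have "suc \<xi> \<le> \<zeta>" using assms(3) by (metis agree_def not_le)
  then show ?thesis using Nd_if_differ[OF assms(1,2) \<zeta>] Nd_le by blast
qed

lemma block_ends:
  assumes "Nd \<xi> x" "c \<in> X" "agree \<xi> x c"
  shows "trunc x \<xi> 0 \<le> c \<and> c \<le> trunc x \<xi> 1"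
proof
  show "trunc x \<xi> 0 \<le> c"
  proof (rule ccontr)
    assume "\<not> trunc x \<xi> 0 \<le> c"
    then obtain \<zeta> where \<zeta>: "agree \<zeta> c (trunc x \<xi> 0)" "dig c \<zeta> < dig (trunc x \<xi> 0) \<zeta>"
      by (auto simp: not_le less_pt_def)
    then show False using assms(3) dig_bounds(1)[OF assms(2), of \<zeta>]
      by (auto simp: dig_trunc agree_def split: if_splits)
  qed
  show "c \<le> trunc x \<xi> 1"
  proof (rule ccontr)
    assume "\<not> c \<le> trunc x \<xi> 1"
    moreover have "trunc x \<xi> 1 \<in> X" using assms(1) by (auto intro: trunc_in_X)
    ultimately obtain \<zeta> where \<zeta>: "agree \<zeta> (trunc x \<xi> 1) c" "dig (trunc x \<xi> 1) \<zeta> < dig c \<zeta>"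
      "Nd \<zeta> (trunc x \<xi> 1)"
      using less_in_X_E[OF _ assms(2)] by (metis not_le)
    have "\<xi> < \<zeta>"
    proof (rule ccontr)
      assume "\<not> \<xi> < \<zeta>"
      then show False using assms(3) \<zeta>(2) dig_bounds(2)[OF assms(2), of \<zeta>]
        by (auto simp: dig_trunc agree_def split: if_splits)
    qed
    then show False using Nd_dig[OF \<zeta>(3), of \<xi>] by simp
  qed
qed

text \<open>Two points with different digits at \<open>\<xi>\<close> have a point with a rational last digit at \<open>\<xi>\<close> between
  them, and a tame function that agrees on the two points has the same value there.\<close>

lemma values_of_differing_pairs:
  assumes "tame X f u v" "agree \<xi> x u" "agree \<xi> x v"
  shows "countable (wide_fibres X (\<lambda>a b. dig a \<xi> = dig b \<xi>) f u v)"
proof (rule countable_subset)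
  show "countable (f ` range (\<lambda>r. trunc x \<xi> (of_rat r)))" by auto
  show "wide_fibres X (\<lambda>a b. dig a \<xi> = dig b \<xi>) f u v
      \<subseteq> f ` range (\<lambda>r. trunc x \<xi> (of_rat r))"
  proof safe
    fix a b assume ab: "a \<in> segm X u v" "b \<in> segm X u v" "dig a \<xi> \<noteq> dig b \<xi>" "f b = f a"
    have *: "a \<in> X" "b \<in> X" "agree \<xi> x a" "agree \<xi> x b"
      using ab assms agree_segm in_segmD by blast+
    obtain r where "trunc x \<xi> (of_rat r) \<in> segm X a b"
      using rat_trunc_segm[of a b] rat_trunc_segm[of b a] * ab(3)
      by (metis linorder_neqE segm_commute)
    then have "f a = f (trunc x \<xi> (of_rat r))"
      using tame_const[OF assms(1) ab(1,2)] ab(4) by simp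
    then show "f a \<in> f ` range (\<lambda>r. trunc x \<xi> (of_rat r))" by simp
  qed
qed

text \<open>One level of blocks raises the rank by at most one: only countably many fibres are not
  contained in a single block.\<close>

lemma thin_if_children_thin:
  assumes "agree \<xi> x u" "agree \<xi> x v"
    and "\<And>a b. a \<in> segm X u v \<Longrightarrow> b \<in> segm X u v \<Longrightarrow> agree (suc \<xi>) a b \<Longrightarrow> thin X n a b"
  shows "thin X (Suc n) u v"
  unfolding thin.simps
proof (intro allI impI)
  fix f assume f: "tame X f u v"
  have "agree (suc \<xi>) a b" if "a \<in> segm X u v" "b \<in> segm X u v" "dig a \<xi> = dig b \<xi>" for a b
    using agree_common[OF agree_segm[OF assms(1,2) that(1)] agree_segm[OF assms(1,2) that(2)]] that(3)
    by (simp add: agree_suc_iff)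
  then have "wide_fibres X (thin X n) f u v
     \<subseteq> wide_fibres X (\<lambda>a b. dig a \<xi> = dig b \<xi>) f u v"
    using assms(3) by blast
  then show "countable (wide_fibres X (thin X n) f u v)"
    using values_of_differing_pairs[OF f assms(1,2)] countable_subset by blast
qed

text \<open>Countably many blocks do not raise the rank: each of them contributes only countably many
  wide fibres.\<close>

lemma thin_if_countably_many_children_thin:
  assumes uvx: "agree \<xi> x u" "agree \<xi> x v" "u \<in> X" "v \<in> X"
    and K: "countable K" "\<And>y. y \<in> X \<Longrightarrow> agree \<xi> x y \<Longrightarrow> Nd (suc \<xi>) y \<Longrightarrow> dig y \<xi> \<in> K"
    and thin: "\<And>a b. a \<in> segm X u v \<Longrightarrow> b \<in> segm X u v \<Longrightarrow> agree (suc \<xi>) a b \<Longrightarrow> a < b \<Longrightarrow> thin X (Suc n) a b"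
  shows "thin X (Suc n) u v"
proof -
  have *: "thin X (Suc n) u v" if uv: "u \<le> v" and uvx: "agree \<xi> x u" "agree \<xi> x v" "u \<in> X" "v \<in> X"
    and thin: "\<And>a b. a \<in> segm X u v \<Longrightarrow> b \<in> segm X u v \<Longrightarrow> agree (suc \<xi>) a b \<Longrightarrow> a < b \<Longrightarrow> thin X (Suc n) a b" for u v
    unfolding thin.simps(2)
  proof (intro allI impI)
    fix f assume f: "tame X f u v"
    define T where "T = (\<lambda>d. {t. \<exists>a\<in>segm X u v. \<exists>b\<in>segm X u v.
        f a = t \<and> f b = t \<and> dig a \<xi> = d \<and> dig b \<xi> = d \<and> \<not> thin X n a b})"
    have T: "countable (T d)" for d
    proof (cases "T d = {}")
      case False
      then obtain a b where ab: "a \<in> segm X u v" "b \<in> segm X u v" "dig a \<xi> = d" "dig b \<xi> = d"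
        "\<not> thin X n a b" by (auto simp: T_def)
      have abX: "a \<in> X" "b \<in> X" using ab in_segmD by blast+
      have "a \<noteq> b" using ab(5) abX(1) thin_le[of a X 0 n a] by auto
      have ax: "agree \<xi> x a" "agree \<xi> x b" using agree_segm uvx ab by blast+
      then have "agree (suc \<xi>) a b" using ab agree_common[OF ax] by (simp add: agree_suc_iff)
      then have N: "Nd (suc \<xi>) a"
        using Nd_suc_if_agree abX \<open>a \<noteq> b\<close> by blast
      define lo hi where "lo = trunc a (suc \<xi>) 0" and "hi = trunc a (suc \<xi>) 1"
      have lohi: "lo \<in> X" "hi \<in> X" using N by (auto simp: lo_def hi_def intro: trunc_in_X)
      have in_lohi: "lo \<le> c \<and> c \<le> hi" if "c \<in> X" "agree (suc \<xi>) a c" for c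
        unfolding lo_def hi_def using block_ends[OF N that] .
      \<comment> \<open>the part of the block with digit \<open>d\<close> that lies in the segment\<close>
      define a0 b0 where "a0 = max u lo" and "b0 = min v hi"
      have le: "u \<le> a" "a \<le> v" "u \<le> b" "b \<le> v" using ab uv by (auto simp: segm_eq)
      have lh: "lo \<le> a" "a \<le> hi" "lo \<le> b" "b \<le> hi" using in_lohi abX \<open>agree (suc \<xi>) a b\<close> by auto
      have a0: "a0 \<le> a" "a0 \<le> b" "a0 \<in> X" "u \<le> a0" "lo \<le> a0" using le lh uvx lohi
        by (auto simp: a0_def max_def)
      have b0: "a \<le> b0" "b \<le> b0" "b0 \<in> X" "b0 \<le> v" "b0 \<le> hi" using le lh uvx lohi
        by (auto simp: b0_def min_def)
      have a0b0: "a0 < b0" using a0 b0 \<open>a \<noteq> b\<close> by (metis order.strict_iff_order order.antisym order.trans)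
      have seg: "a0 \<in> segm X u v" "b0 \<in> segm X u v" using a0 b0 le uv by (auto simp: segm_eq)
      have "agree (suc \<xi>) lo hi" by (simp add: lo_def hi_def)
      then have "agree (suc \<xi>) lo a0" "agree (suc \<xi>) lo b0"
        using agree_between[of "suc \<xi>" lo hi] a0 b0 lh a0b0 by (meson order.trans less_imp_le)+
      then have "agree (suc \<xi>) a0 b0" using agree_sym agree_trans by blast
      then have th: "thin X (Suc n) a0 b0" using thin[OF seg] a0b0 by blast
      have "tame X f a0 b0"
        using f segm_subset[OF seg] unfolding tame_def by blast
      then have "countable (wide_fibres X (thin X n) f a0 b0)"
        using thin_SucD[OF th] by blast
      moreover have "T d \<subseteq> wide_fibres X (thin X n) f a0 b0"
      proof
        fix t assume "t \<in> T d"
        then obtain c e where ce: "c \<in> segm X u v" "e \<in> segm X u v" "f c = t" "f e = t"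
          "dig c \<xi> = d" "dig e \<xi> = d" "\<not> thin X n c e" by (auto simp: T_def)
        have "y \<in> segm X a0 b0" if y: "y \<in> segm X u v" "dig y \<xi> = d" for y
        proof -
          have "y \<in> X" "u \<le> y" "y \<le> v" using y uv by (auto simp: segm_eq)
          moreover have "agree (suc \<xi>) a y"
            using y(2) ab(3) agree_common[OF ax(1) agree_segm[OF uvx(1,2) y(1)]]
            by (simp add: agree_suc_iff)
          ultimately show ?thesis using in_lohi[of y] unfolding a0_def b0_def by (intro segmI) auto
        qed
        then show "t \<in> wide_fibres X (thin X n) f a0 b0"
          using ce by blast
      qed
      ultimately show ?thesis by (rule countable_subset[rotated])
    qed simp
    have "wide_fibres X (thin X n) f u v
      \<subseteq> wide_fibres X (\<lambda>a b. dig a \<xi> = dig b \<xi>) f u v \<union> (\<Union>d\<in>K. T d)"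
    proof
      fix t assume "t \<in> wide_fibres X (thin X n) f u v"
      then obtain a b where ab: "a \<in> segm X u v" "b \<in> segm X u v" "f a = t" "f b = t" "\<not> thin X n a b"
        by blast
      show "t \<in> wide_fibres X (\<lambda>a b. dig a \<xi> = dig b \<xi>) f u v \<union> (\<Union>d\<in>K. T d)"
      proof (cases "dig a \<xi> = dig b \<xi>")
        case True
        have abX: "a \<in> X" "b \<in> X" using ab in_segmD by blast+
        have "a \<noteq> b" using ab(5) abX(1) thin_le[of a X 0 n a] by auto
        have ax: "agree \<xi> x a" "agree \<xi> x b" using agree_segm uvx ab by blast+
        then have "agree (suc \<xi>) a b" using True agree_common[OF ax] by (simp add: agree_suc_iff)
        then have "Nd (suc \<xi>) a" using Nd_suc_if_agree abX \<open>a \<noteq> b\<close> by blast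
        then have "dig a \<xi> \<in> K" using K(2) abX(1) ax(1) by blast
        moreover have "t \<in> T (dig a \<xi>)" using ab True unfolding T_def by auto
        ultimately show ?thesis by blast
      qed (use ab in blast)
    qed
    moreover have "countable (wide_fibres X (\<lambda>a b. dig a \<xi> = dig b \<xi>) f u v \<union> (\<Union>d\<in>K. T d))"
      using values_of_differing_pairs[OF f uvx(1,2)] T K(1) by (intro countable_Un countable_UN)
    ultimately show "countable (wide_fibres X (thin X n) f u v)"
      by (rule countable_subset)
  qed
  show ?thesis
  proof (cases "u \<le> v")
    case True
    then show ?thesis using * assms by blast
  next
    case False
    then have "thin X (Suc n) v u" using *[of v u] assms by (simp add: segm_commute)
    then show ?thesis using thin_commute by blast
  qed
qed

text \<open>A tame function \<open>f\<close> has a countable set \<open>D\<close> of points that takes all rational values in its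
  range, and the points of \<open>D\<close> leave the tree before a countable level \<open>\<gamma>\<close>. If a fibre contains two points
  that differ before \<open>\<gamma>\<close>, then its value is taken at one of countably many truncations (\<open>T1\<close>).
  Otherwise it contains points below a common node of level \<open>\<gamma>\<close> (\<open>T2\<close>). There are only
  countably many nodes of this level, and two fibres cannot share one: between them there is a
  point of \<open>D\<close>, which would continue the same node of level \<open>\<gamma>\<close>.\<close>

lemma thin_flat:
  assumes flat: "flat \<xi> x" and uv: "u \<in> X" "v \<in> X" "agree \<xi> x u" "agree \<xi> x v"
  shows "thin X 1 u v"
  unfolding One_nat_def thin.simps
proof (intro allI impI)
  fix f assume f: "tame X f u v"
  define pre where "pre = (\<lambda>\<rho>. SOME d. d \<in> segm X u v \<and> f d = \<rho>)"
  define D where "D = pre ` (f ` segm X u v \<inter> \<rat>)"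
  have pre: "pre \<rho> \<in> segm X u v \<and> f (pre \<rho>) = \<rho>" if "\<rho> \<in> f ` segm X u v" for \<rho>
    unfolding pre_def by (rule someI_ex) (use that in blast)
  obtain b where b: "\<And>g. \<not> Nd (b g) g" using Nd_bounded by metis
  have "countable D" unfolding D_def using countable_rat by auto
  then have "countable (b ` D)" by auto
  then obtain \<gamma> where \<gamma>: "\<And>\<zeta>. \<zeta> \<in> b ` D \<Longrightarrow> \<zeta> < \<gamma>" using countable_bounded by blast
  have D_short: "\<not> Nd \<gamma> d" if "d \<in> D" for d
    using b[of d] \<gamma>[of "b d"] that Nd_le by (meson imageI less_imp_le)
  define C where "C = (\<lambda>\<zeta>. {trunc y \<zeta> 0 | y. Nd \<zeta> y \<and> agree \<xi> x y})"
  have C: "countable (C \<zeta>)" for \<zeta> unfolding C_def using countable_flat_nodes[OF flat] .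
  define P where "P = (\<lambda>t a b. a \<in> segm X u v \<and> b \<in> segm X u v \<and> f a = t \<and> f b = t \<and> a < b)"
  define T1 where "T1 = {t. \<exists>a b. P t a b \<and> \<not> agree \<gamma> a b}"
  define T2 where "T2 = {t. \<exists>a b. P t a b \<and> agree \<gamma> a b}"
  have "countable T1"
  proof (rule countable_subset)
    show "countable (\<Union>\<zeta>\<in>{..<\<gamma>}. \<Union>c\<in>C \<zeta>. f ` range (\<lambda>r. trunc c \<zeta> (of_rat r)))"
      using C countable_below by (intro countable_UN) auto
    show "T1 \<subseteq> (\<Union>\<zeta>\<in>{..<\<gamma>}. \<Union>c\<in>C \<zeta>. f ` range (\<lambda>r. trunc c \<zeta> (of_rat r)))"
    proof
      fix t assume "t \<in> T1"
      then obtain a b where ab: "P t a b" "\<not> agree \<gamma> a b" by (auto simp: T1_def)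
      then have abX: "a \<in> X" "b \<in> X" "a < b" "agree \<xi> x a"
        using uv agree_segm in_segmD unfolding P_def by blast+
      obtain \<zeta> where \<zeta>: "agree \<zeta> a b" "dig a \<zeta> < dig b \<zeta>" "Nd \<zeta> a" using less_in_X_E[OF abX(1-3)] .
      then have "\<zeta> < \<gamma>" using ab(2) agree_le by (meson not_le)
      moreover have "trunc a \<zeta> 0 \<in> C \<zeta>" using \<zeta>(3) abX(4) by (auto simp: C_def)
      moreover obtain r where r: "trunc (trunc a \<zeta> 0) \<zeta> (of_rat r) \<in> segm X a b"
        using rat_trunc_segm[OF abX(1,2), of \<zeta> "trunc a \<zeta> 0"] \<zeta> by (auto intro: agree_truncI)
      moreover have "t = f (trunc (trunc a \<zeta> 0) \<zeta> (of_rat r))"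
        using tame_const[OF f _ _ _ r] ab(1) by (simp add: P_def)
      ultimately show "t \<in> (\<Union>\<zeta>\<in>{..<\<gamma>}. \<Union>c\<in>C \<zeta>. f ` range (\<lambda>r. trunc c \<zeta> (of_rat r)))"
        by blast
    qed
  qed
  moreover have "countable T2"
  proof -
    have "\<forall>t\<in>T2. \<exists>p. P t (fst p) (snd p) \<and> agree \<gamma> (fst p) (snd p)"
      by (auto simp: T2_def)
    then obtain p where p: "\<forall>t\<in>T2. P t (fst (p t)) (snd (p t)) \<and> agree \<gamma> (fst (p t)) (snd (p t))"
      by (rule bchoice[THEN exE])
    define g h where "g = fst \<circ> p" and "h = snd \<circ> p"
    have gh: "P t (g t) (h t) \<and> agree \<gamma> (g t) (h t)" if "t \<in> T2" for t
      using p that by (simp add: g_def h_def)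
    have g: "g t \<in> X" "g t \<in> segm X u v" "f (g t) = t" "Nd \<gamma> (g t)" "agree \<xi> x (g t)" if "t \<in> T2" for t
    proof -
      have *: "P t (g t) (h t)" "agree \<gamma> (g t) (h t)" using gh[OF that] by auto
      then show X: "g t \<in> X" "g t \<in> segm X u v" "f (g t) = t" by (auto simp: P_def dest: in_segmD)
      show "agree \<xi> x (g t)" using agree_segm uv X(2) by blast
      have "h t \<in> X" "g t < h t" using * by (auto simp: P_def dest: in_segmD)
      then obtain \<zeta> where \<zeta>: "agree \<zeta> (g t) (h t)" "dig (g t) \<zeta> < dig (h t) \<zeta>" "Nd \<zeta> (g t)"
        using less_in_X_E X(1) by metis
      then have "\<gamma> \<le> \<zeta>" using *(2) by (metis agree_def less_irrefl not_le)
      then show "Nd \<gamma> (g t)" using \<zeta>(3) Nd_le by blast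
    qed
    have ne: False if t: "t \<in> T2" "t' \<in> T2" "t < t'" "trunc (g t) \<gamma> 0 = trunc (g t') \<gamma> 0" for t t'
    proof -
      obtain \<rho> where \<rho>: "\<rho> \<in> \<rat>" "t < \<rho>" "\<rho> < t'" using Rats_dense_in_real[OF t(3)] by blast
      have "\<rho> \<in> f ` segm X (g t) (g t')"
        using tameD[OF f g(2)[OF t(1)] g(2)[OF t(2)]] g(3) t \<rho> by auto
      then have "\<rho> \<in> f ` segm X u v" using segm_subset g(2) t by blast
      then have d: "pre \<rho> \<in> segm X u v" "f (pre \<rho>) = \<rho>" "pre \<rho> \<in> D"
        using pre \<rho>(1) by (auto simp: D_def)
      have "g t \<notin> segm X (pre \<rho>) (g t')"
      proof
        assume "g t \<in> segm X (pre \<rho>) (g t')"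
        then have "f (g t) \<in> {min (f (pre \<rho>)) (f (g t'))..max (f (pre \<rho>)) (f (g t'))}"
          using tameD[OF f d(1) g(2)[OF t(2)]] by blast
        then show False using \<rho> g(3) t d(2) by auto
      qed
      moreover have "g t' \<notin> segm X (g t) (pre \<rho>)"
      proof
        assume "g t' \<in> segm X (g t) (pre \<rho>)"
        then have "f (g t') \<in> {min (f (g t)) (f (pre \<rho>))..max (f (g t)) (f (pre \<rho>))}"
          using tameD[OF f g(2)[OF t(1)] d(1)] by blast
        then show False using \<rho> g(3) t d(2) by auto
      qed
      ultimately have dseg: "pre \<rho> \<in> segm X (g t) (g t')"
        using segm_trichotomy[of "g t" X "g t'" "pre \<rho>"] g(1) t in_segmD[OF d(1)] by blast
      have "agree \<gamma> (g t) (g t')"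
        using t(4) agree_trunc by (metis agree_trans)
      then have "agree \<gamma> (g t) (pre \<rho>)" using agree_segm[OF agree_refl _ dseg] by blast
      then have "Nd \<gamma> (pre \<rho>)" using g(4)[OF t(1)] Nd_cong by blast
      then show False using D_short d(3) by blast
    qed
    have "inj_on (\<lambda>t. trunc (g t) \<gamma> 0) T2"
      using ne by (auto intro!: linorder_inj_onI)
    moreover have "(\<lambda>t. trunc (g t) \<gamma> 0) ` T2 \<subseteq> C \<gamma>"
      using g by (auto simp: C_def)
    ultimately show ?thesis using C countable_image_inj_on countable_subset by metis
  qed
  moreover have "wide_fibres X (=) f u v \<subseteq> T1 \<union> T2"
  proof safe
    fix a b assume ab: "a \<in> segm X u v" "b \<in> segm X u v" "a \<noteq> b" "f b = f a" "f a \<notin> T2"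
    then have "P (f a) a b \<or> P (f a) b a" by (auto simp: P_def)
    then show "f a \<in> T1" using ab(5) unfolding T1_def T2_def by blast
  qed
  ultimately show "countable (wide_fibres X (=) f u v)"
    by (meson countable_Un countable_subset)
qed

text \<open>The node is preceded by the choice of the root digit, the choice of the number of uncountable
  levels, and \<open>j\<close> of these levels; there are \<open>r\<close> more to come.\<close>

definition ranked :: "nat \<Rightarrow> omega1 \<Rightarrow> pt \<Rightarrow> bool" where
  "ranked r \<xi> x \<longleftrightarrow> Nd \<xi> x \<and> (\<exists>j. \<xi> = fin (j + 2) \<and> depth_of x = j + r)"

lemma ranked_Nd: "ranked r \<xi> x \<Longrightarrow> Nd \<xi> x"
  by (simp add: ranked_def)

lemma ranked_depth_cong:
  assumes "ranked r \<xi> x" "agree \<xi> x y"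
  shows "depth_of y = depth_of x"
proof -
  obtain j where "\<xi> = fin (j + 2)" using assms(1) by (auto simp: ranked_def)
  then have "fin 2 \<le> \<xi>" using fin_less_iff[of "j + 2" 2] by (auto simp: not_less[symmetric])
  then show ?thesis using agree_le[OF assms(2)] depth_of_cong by metis
qed

lemma ranked_0_flat:
  assumes "ranked 0 \<xi> x"
  shows "flat \<xi> x"
  unfolding flat_def
proof (intro allI impI)
  fix y \<eta> assume y: "agree \<xi> x y" "\<xi> \<le> \<eta>"
  obtain j where j: "\<xi> = fin (j + 2)" "depth_of x = j" using assms by (auto simp: ranked_def)
  have "depth_of y = j" using ranked_depth_cong[OF assms y(1)] j by simp
  moreover have "\<eta> \<noteq> fin (i + 2)" if "i < j" for i
    using y(2) that unfolding j(1) by (metis add_less_cancel_right fin_less_iff not_le)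
  moreover have "\<eta> \<noteq> fin 0" using y(2) unfolding j(1) by (metis add_gr_0 fin_less_iff not_le zero_less_numeral)
  ultimately show "digits A S y \<eta> = Q" by (auto simp: digits_def)
qed

lemma ranked_Suc_digits:
  assumes "ranked (Suc r) \<xi> x"
  shows "digits A S x \<xi> = A"
proof -
  obtain j where "\<xi> = fin (j + 2)" "depth_of x = j + Suc r" using assms by (auto simp: ranked_def)
  then show ?thesis unfolding digits_def by auto
qed

lemma ranked_child:
  assumes "ranked (Suc r) \<xi> x" "agree \<xi> x y" "Nd (suc \<xi>) y"
  shows "ranked r (suc \<xi>) y"
proof -
  obtain j where "\<xi> = fin (j + 2)" "depth_of x = j + Suc r" using assms by (auto simp: ranked_def)
  then have "suc \<xi> = fin (Suc j + 2)" "depth_of y = Suc j + r"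
    using ranked_depth_cong[OF assms(1,2)] by (auto simp: fin_Suc)
  then show ?thesis using assms(3) unfolding ranked_def by blast
qed

lemma thin_ranked:
  assumes "ranked r \<xi> x" "u \<in> X" "v \<in> X" "agree \<xi> x u" "agree \<xi> x v"
  shows "thin X (Suc r) u v"
  using assms
proof (induction r arbitrary: \<xi> x u v)
  case 0
  then show ?case using thin_flat[OF ranked_0_flat] by (simp only: One_nat_def)
next
  case (Suc r)
  show ?case
  proof (rule thin_if_children_thin[OF Suc.prems(4,5)])
    fix a b assume ab: "a \<in> segm X u v" "b \<in> segm X u v" "agree (suc \<xi>) a b"
    have X: "a \<in> X" "b \<in> X" "agree \<xi> x a" using ab agree_segm in_segmD Suc.prems by blast+
    show "thin X (Suc r) a b"
    proof (cases "a = b")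
      case True
      then show ?thesis using thin_le[OF X(1), of 0 "Suc r" b] by simp
    next
      case False
      then have "ranked r (suc \<xi>) a"
        using ranked_child[OF Suc.prems(1) X(3)] Nd_suc_if_agree[OF X(1,2) ab(3)] by blast
      then show ?thesis using Suc.IH X ab(3) agree_refl by blast
    qed
  qed
qed

text \<open>The digit at \<open>\<xi>\<close> is a tame function, and uncountably many of its fibres are blocks with one
  uncountable level less.\<close>

lemma not_thin_ranked:
  assumes "ranked r \<xi> x" "0 \<le> d" "d < d'" "d' \<le> 1"
  shows "\<not> thin X r (trunc x \<xi> d) (trunc x \<xi> d')"
  using assms
proof (induction r arbitrary: \<xi> x d d')
  case 0
  then have "trunc x \<xi> d < trunc x \<xi> d'" by simp
  then show ?case by (metis less_irrefl thin.simps(1))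
next
  case (Suc r)
  let ?u = "trunc x \<xi> d" and ?v = "trunc x \<xi> d'"
  have Nx: "Nd \<xi> x" using Suc.prems(1) by (rule ranked_Nd)
  have uv: "?u \<in> X" "?v \<in> X" using Nx Suc.prems by (auto intro: trunc_in_X)
  have ag: "agree \<xi> x w" if "w \<in> segm X ?u ?v" for w
    using agree_segm[OF agree_trunc(1) agree_trunc(1) that] .
  have tame: "tame X (\<lambda>z. dig z \<xi>) ?u ?v"
    unfolding tame_def
  proof (intro ballI)
    have *: "(\<lambda>z. dig z \<xi>) ` segm X a b = {min (dig a \<xi>) (dig b \<xi>)..max (dig a \<xi>) (dig b \<xi>)}"
      if ab: "a \<in> X" "b \<in> X" "agree \<xi> x a" "agree \<xi> x b" "a \<le> b" for a b
    proof -
      have aab: "agree \<xi> a b" using ab agree_sym agree_trans by blast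
      then have le: "dig a \<xi> \<le> dig b \<xi>" using dig_mono ab(5) by blast
      have "(\<lambda>z. dig z \<xi>) ` segm X a b = {dig a \<xi>..dig b \<xi>}"
      proof (intro equalityI subsetI)
        fix c assume "c \<in> (\<lambda>z. dig z \<xi>) ` segm X a b"
        then obtain z where z: "z \<in> segm X a b" "c = dig z \<xi>" by blast
        then have "a \<le> z" "z \<le> b" "agree \<xi> a z" using ab agree_segm[OF agree_refl aab] by (auto simp: segm_eq)
        moreover from this have "agree \<xi> z b" using aab agree_sym agree_trans by blast
        ultimately show "c \<in> {dig a \<xi>..dig b \<xi>}" using dig_mono z(2) by auto
      next
        fix c assume c: "c \<in> {dig a \<xi>..dig b \<xi>}"
        then consider "c = dig a \<xi>" | "c = dig b \<xi>" | "dig a \<xi> < c" "c < dig b \<xi>" by fastforce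
        then show "c \<in> (\<lambda>z. dig z \<xi>) ` segm X a b"
        proof cases
          case 3
          have "trunc a \<xi> c \<in> segm X a b"
            using trunc_between[OF ab(1,2) aab 3] by (intro segmI less_imp_le)
          then show ?thesis by (rule rev_image_eqI) simp
        qed (use ab in auto)
      qed
      then show ?thesis using le by simp
    qed
    fix a b assume "a \<in> segm X ?u ?v" "b \<in> segm X ?u ?v"
    then have "a \<in> X" "b \<in> X" "agree \<xi> x a" "agree \<xi> x b" using ag in_segmD by blast+
    then show "(\<lambda>z. dig z \<xi>) ` segm X a b = {min (dig a \<xi>) (dig b \<xi>)..max (dig a \<xi>) (dig b \<xi>)}"
      using *[of a b] *[of b a] by (cases "a \<le> b") (auto simp: segm_commute min.commute max.commute)
  qed
  have "A \<inter> {d<..<d'} \<subseteq> wide_fibres X (thin X r) (\<lambda>z. dig z \<xi>) ?u ?v"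
  proof
    fix t assume t: "t \<in> A \<inter> {d<..<d'}"
    define y where "y = trunc x \<xi> t"
    have N: "Nd (suc \<xi>) y"
      unfolding y_def using node_trunc_suc[OF Nx] ranked_Suc_digits[OF Suc.prems(1)] t by blast
    have "ranked r (suc \<xi>) y" using ranked_child[OF Suc.prems(1) _ N] by (simp add: y_def)
    then have "\<not> thin X r (trunc y (suc \<xi>) 0) (trunc y (suc \<xi>) 1)" using Suc.IH by simp
    moreover have dt: "dig (trunc y (suc \<xi>) e) \<xi> = t" for e using less_suc by (simp add: dig_trunc y_def)
    moreover have "trunc y (suc \<xi>) e \<in> segm X ?u ?v" if "0 \<le> e" "e \<le> 1" for e
    proof -
      have "agree \<xi> x (trunc y (suc \<xi>) e)"
        using less_suc[of \<xi>] by (auto simp: agree_def dig_trunc y_def)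
      have "?u < trunc y (suc \<xi>) e" "trunc y (suc \<xi>) e < ?v"
        using dt t \<open>agree \<xi> x (trunc y (suc \<xi>) e)\<close> agree_sym[OF \<open>agree \<xi> x (trunc y (suc \<xi>) e)\<close>]
        by (auto intro!: lessI_digit[of \<xi>] intro: agree_truncI)
      then show ?thesis using trunc_in_X[OF N that] by (intro segmI less_imp_le)
    qed
    ultimately show "t \<in> wide_fibres X (thin X r) (\<lambda>z. dig z \<xi>) ?u ?v"
      by (intro CollectI bexI[of _ "trunc y (suc \<xi>) 0"] bexI[of _ "trunc y (suc \<xi>) 1"]) auto
  qed
  then have "uncountable (wide_fibres X (thin X r) (\<lambda>z. dig z \<xi>) ?u ?v)"
    using A_uncountable[OF Suc.prems(2-4)] countable_subset by blast
  then show ?case using thin_SucD tame by blast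
qed

text \<open>Any segment from \<open>z\<close> to another point on the side of \<open>p\<close> contains all truncations whose last
  digit, at \<open>\<xi>\<close>, is in some nondegenerate interval.\<close>

lemma not_near_ranked:
  assumes "ranked r \<xi> x" "z \<in> X" "p \<in> X" "agree \<xi> x z" "agree \<xi> x p"
    and "\<And>y. y \<in> segm X p z \<Longrightarrow> y \<noteq> z \<Longrightarrow> dig y \<xi> \<noteq> dig z \<xi>"
  shows "\<not> near X p r z"
proof
  assume "near X p r z"
  then obtain y where y: "y \<in> segm X p z" "y \<noteq> z" "thin X r y z" by (auto simp: near_def)
  have yX: "y \<in> X" "agree \<xi> x y" using y(1) agree_segm assms in_segmD by blast+
  have *: False if ab: "a \<in> X" "b \<in> X" "agree \<xi> x a" "agree \<xi> x b" "dig a \<xi> < dig b \<xi>" "thin X r a b" for a b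
  proof -
    obtain d where d: "dig a \<xi> < d" "d < dig b \<xi>" using dense[OF ab(5)] by blast
    obtain d' where d': "d < d'" "d' < dig b \<xi>" using dense[OF d(2)] by blast
    have aab: "agree \<xi> a b" "agree \<xi> a x" using ab agree_sym agree_trans by blast+
    have "trunc a \<xi> d \<in> segm X a b" "trunc a \<xi> d' \<in> segm X a b"
      using trunc_between[OF ab(1,2) aab(1)] d d' by (auto intro!: segmI less_imp_le)
    then have "thin X r (trunc x \<xi> d) (trunc x \<xi> d')"
      using thin_hereditary[OF ab(6)] trunc_cong[OF aab(2)] by metis
    moreover have "0 \<le> d" "d' \<le> 1"
      using d d' dig_bounds(1)[OF ab(1), of \<xi>] dig_bounds(2)[OF ab(2), of \<xi>] by linarith+
    ultimately show False using not_thin_ranked[OF assms(1)] d' by blast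
  qed
  have "dig y \<xi> \<noteq> dig z \<xi>" using assms(6) y by blast
  then show False
    using *[OF yX(1) assms(2) yX(2) assms(4)] *[OF assms(2) yX(1) assms(4) yX(2)] y(3) thin_commute
    by (metis linorder_neqE)
qed

end

section \<open>The types of a coded block\<close>

context coded_tree
begin

lemma eq_if_no_child:
  assumes "y \<in> X" "z \<in> X" "agree \<xi> z y" "dig y \<xi> = dig z \<xi>" "\<not> Nd (suc \<xi>) z"
  shows "y = z"
proof (rule ccontr)
  assume "y \<noteq> z"
  then have "Nd (suc \<xi>) z"
    using Nd_suc_if_agree[OF assms(2,1)] assms(3,4) by (auto simp: agree_suc_iff)
  then show False using assms(5) by simp
qed

lemma not_Nd_suc_end: "dig z \<xi> = 0 \<or> dig z \<xi> = 1 \<Longrightarrow> \<not> Nd (suc \<xi>) z"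
  using Nd_suc by fastforce

lemma near_if_thin: "p \<in> X \<Longrightarrow> p \<noteq> z \<Longrightarrow> thin X n p z \<Longrightarrow> near X p n z"
  unfolding near_def by (intro bexI[of _ p]) auto

text \<open>The point \<open>z\<close> is an end of a child block; \<open>out\<close> is the end of the parent block on the other
  side of \<open>z\<close>, \<open>inn\<close> the end on the side of the child block, and \<open>c\<close> the other end of the
  child block. The local ranks are \<open>r + 2\<close> outside and \<open>r + 1\<close> inside, which is too
  close together for a special point with \<open>m \<ge> 2\<close>.\<close>

lemma not_special_child_end:
  assumes r: "ranked (Suc r) \<xi> x" and z: "z \<in> X" "agree \<xi> x z" "Nd (suc \<xi>) z"
    and oi: "out \<in> X" "inn \<in> X" "agree \<xi> x out" "agree \<xi> x inn" "out \<noteq> z"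
    and out: "\<And>y. y \<in> segm X out z \<Longrightarrow> y \<noteq> z \<Longrightarrow> dig y \<xi> \<noteq> dig z \<xi>"
    and c: "c \<in> segm X inn z" "c \<noteq> z" "agree (suc \<xi>) z c"
    and inn: "\<And>y. y \<in> segm X c z \<Longrightarrow> y \<noteq> z \<Longrightarrow> dig y (suc \<xi>) \<noteq> dig z (suc \<xi>)"
    and m: "2 \<le> m"
  shows "\<not> special X out inn m z \<and> \<not> special X inn out m z"
proof -
  have n1: "\<not> near X out (Suc r) z"
    by (rule not_near_ranked[OF r z(1) oi(1) z(2) oi(3) out])
  have n2: "\<not> near X inn r z"
    unfolding near_iff[OF c(1,2) z(1)]
    by (rule not_near_ranked[OF ranked_child[OF r z(2,3)] z(1) in_segmD[OF c(1)] agree_refl c(3) inn])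
  have "\<not> near X out 1 z" using n1 near_le[of X out 1 z "Suc r"] by auto
  moreover have "\<not> special X inn out m z"
  proof
    assume sp: "special X inn out m z"
    then have "near X inn 1 z" "\<not> near X out m z" by (auto simp: special_def)
    then have "r = 0" using n2 near_le[of X inn 1 z r] by (cases r) auto
    then have "thin X 2 out z" using thin_ranked[OF r oi(1) z(1) oi(3) z(2)]
      by (simp only: numeral_2_eq_2)
    then have "near X out m z" using near_if_thin[OF oi(1,5)] near_le m by blast
    then show False using \<open>\<not> near X out m z\<close> by blast
  qed
  ultimately show ?thesis by (auto simp: special_def)
qed

text \<open>A point that is not in any child block has equal local ranks on both sides, an end of a child
  block is covered by the preceding lemma, and an inner point of a child block by induction.\<close>

lemma not_special_ranked:
  assumes "ranked r \<xi> x" "z \<in> X" "agree \<xi> x z" "z \<noteq> trunc x \<xi> 0" "z \<noteq> trunc x \<xi> 1" "2 \<le> m"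
  shows "\<not> special X (trunc x \<xi> 0) (trunc x \<xi> 1) m z \<and> \<not> special X (trunc x \<xi> 1) (trunc x \<xi> 0) m z"
  using assms
proof (induction r arbitrary: \<xi> x)
  case 0
  have ends: "trunc x \<xi> 0 \<in> X" "trunc x \<xi> 1 \<in> X"
    using ranked_Nd[OF 0(1)] by (auto intro: trunc_in_X)
  have "near X (trunc x \<xi> 0) 1 z" "near X (trunc x \<xi> 1) 1 z"
    using thin_ranked[OF 0(1) ends(1) 0(2) _ 0(3)] thin_ranked[OF 0(1) ends(2) 0(2) _ 0(3)] 0(4,5) ends
    by (auto intro!: near_if_thin)
  then show ?case using near_le[of X _ 1 z m] 0(6) by (auto simp: special_def)
next
  case (Suc r)
  let ?lo = "trunc x \<xi> 0" and ?hi = "trunc x \<xi> 1"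
  note r = Suc.prems(1) and z = Suc.prems(2,3) and m = Suc.prems(6)
  have Nx: "Nd \<xi> x" using ranked_Nd[OF r] .
  have ends: "?lo \<in> X" "?hi \<in> X" using Nx by (auto intro: trunc_in_X)
  have loz: "?lo < z" "z < ?hi" using block_ends[OF Nx z] Suc.prems(4,5) by auto
  have ag: "agree \<xi> z y" if "y \<in> segm X ?lo z \<or> y \<in> segm X ?hi z" for y
    using that agree_segm[OF _ z(2)] z(2) agree_common agree_trunc(1) by metis
  show ?case
  proof (cases "Nd (suc \<xi>) z")
    case False
    have "dig y \<xi> \<noteq> dig z \<xi>" if "y \<in> segm X ?lo z \<or> y \<in> segm X ?hi z" "y \<noteq> z" for y
      using eq_if_no_child[OF _ z(1) ag[OF that(1)] _ False] that in_segmD by blast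
    then have "\<not> near X ?lo (Suc r) z" "\<not> near X ?hi (Suc r) z"
      using not_near_ranked[OF r z(1) ends(1) z(2)] not_near_ranked[OF r z(1) ends(2) z(2)] by auto
    then show ?thesis using near_le[of X _ 1 z "Suc r"] by (auto simp: special_def)
  next
    case True
    let ?lo' = "trunc z (suc \<xi>) 0" and ?hi' = "trunc z (suc \<xi>) 1"
    have ends': "?lo' \<in> X" "?hi' \<in> X" using True by (auto intro: trunc_in_X)
    have lohi': "?lo' < ?hi'" by simp
    have z': "?lo' \<le> z" "z \<le> ?hi'" using block_ends[OF True z(1)] by auto
    have d: "0 < dig z \<xi>" "dig z \<xi> < 1" using Nd_suc[OF True] by auto
    have "?lo < ?lo'" "?hi' < ?hi"
      using d z(2) less_suc[of \<xi>] by (auto intro!: lessI_digit[of \<xi>] simp: agree_def dig_trunc)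
    then have seg: "?lo' \<in> segm X ?lo z" "?hi' \<in> segm X ?hi z"
      using ends' z' by (auto intro!: segmI simp: segm_commute[of X ?hi])
    have below: "dig y (suc \<xi>) \<noteq> dig z (suc \<xi>)"
      if "agree (suc \<xi>) z y" "y \<in> X" "y \<noteq> z" "z = ?lo' \<or> z = ?hi'" for y
    proof
      assume eq: "dig y (suc \<xi>) = dig z (suc \<xi>)"
      have "dig z (suc \<xi>) = 0 \<or> dig z (suc \<xi>) = 1" using that(4) by (metis dig_trunc_at)
      then show False using eq_if_no_child[OF that(2) z(1) that(1) eq] not_Nd_suc_end that(3) by blast
    qed
    consider "z = ?lo'" | "z = ?hi'" | "z \<noteq> ?lo'" "z \<noteq> ?hi'" by blast
    then show ?thesis
    proof cases
      case 1
      show ?thesis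
      proof (rule not_special_child_end[OF r z True ends _ _ _ _ seg(2)])
        show "dig y \<xi> \<noteq> dig z \<xi>" if y: "y \<in> segm X ?lo z" "y \<noteq> z" for y
        proof
          assume "dig y \<xi> = dig z \<xi>"
          then have "agree (suc \<xi>) z y" using ag y by (auto simp: agree_suc_iff)
          then have "?lo' \<le> y" using block_ends[OF True] y(1) in_segmD by blast
          moreover have "y \<le> z" using y(1) loz by (auto simp: segm_eq)
          ultimately show False using 1 y(2) by auto
        qed
        show "?hi' \<noteq> z" using 1 lohi' by auto
        show "dig y (suc \<xi>) \<noteq> dig z (suc \<xi>)" if y: "y \<in> segm X ?hi' z" "y \<noteq> z" for y
          using below[of y] 1 y agree_segm[OF agree_trunc(1) agree_refl y(1)] in_segmD by blast
      qed (use loz m in auto)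
    next
      case 2
      have "\<not> special X ?hi ?lo m z \<and> \<not> special X ?lo ?hi m z"
      proof (rule not_special_child_end[OF r z True ends(2,1) _ _ _ _ seg(1)])
        show "dig y \<xi> \<noteq> dig z \<xi>" if y: "y \<in> segm X ?hi z" "y \<noteq> z" for y
        proof
          assume "dig y \<xi> = dig z \<xi>"
          then have "agree (suc \<xi>) z y" using ag y by (auto simp: agree_suc_iff)
          then have "y \<le> ?hi'" using block_ends[OF True] y(1) in_segmD by blast
          moreover have "z \<le> y" using y(1) loz by (auto simp: segm_eq segm_commute[of X ?hi])
          ultimately show False using 2 y(2) by auto
        qed
        show "?lo' \<noteq> z" using 2 lohi' by auto
        show "dig y (suc \<xi>) \<noteq> dig z (suc \<xi>)" if y: "y \<in> segm X ?lo' z" "y \<noteq> z" for y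
          using below[of y] 2 y agree_segm[OF agree_trunc(1) agree_refl y(1)] in_segmD by blast
      qed (use loz m in auto)
      then show ?thesis by blast
    next
      case 3
      then have "\<not> special X ?lo' ?hi' m z \<and> \<not> special X ?hi' ?lo' m z"
        using Suc.IH[OF ranked_child[OF r z(2) True] z(1) agree_refl] m by blast
      moreover have "z \<in> segm X ?lo' ?hi'" "z \<in> segm X ?hi' ?lo'"
        using z(1) z' by (auto intro: segmI simp: segm_commute[of X ?hi'])
      ultimately show ?thesis
        using near_iff[OF seg(1) _ z(1)] near_iff[OF seg(2) _ z(1)] 3 by (auto simp: special_def)
    qed
  qed
qed

lemma special_unique:
  assumes "near X p 1 z" "near X p' (Suc n) z" "\<not> near X p' n z" "2 \<le> n" "2 \<le> m"
    and "special X p p' m z \<or> special X p' p m z"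
  shows "m = n"
proof -
  have "near X p m z" using near_le[OF assms(1), of m] assms(5) by simp
  then have "near X p' (Suc m) z" "\<not> near X p' m z" using assms(6) by (auto simp: special_def)
  then show ?thesis
    using near_le[of X p' "Suc m" z n] near_le[of X p' "Suc n" z m] assms(2,3)
    by (metis Suc_leI linorder_neqE_nat)
qed

lemma digits_fin_1: "digits A S x (fin 1) = Q"
  by (auto simp: digits_def)

lemma ranked_code_child:
  assumes "Nd (suc (fin 1)) y"
  shows "ranked (depth (dig y (fin 0)) (dig y (fin 1))) (suc (fin 1)) y"
  unfolding ranked_def depth_of_def using assms
  by (intro conjI exI[of _ 0]) (simp_all add: fin_Suc numeral_2_eq_2)

lemma thin_code_part:
  assumes uv: "u \<in> X" "v \<in> X" "agree (fin 1) x u" "agree (fin 1) x v"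
    and depth: "\<And>b c. b \<in> segm X u v \<Longrightarrow> c \<in> segm X u v \<Longrightarrow> b < c \<Longrightarrow> dig b (fin 1) = dig c (fin 1) \<Longrightarrow>
        depth (dig x (fin 0)) (dig b (fin 1)) = 0"
  shows "thin X 1 u v"
  unfolding One_nat_def
proof (rule thin_if_countably_many_children_thin[OF uv(3,4,1,2) countable_Q])
  show "dig y (fin 1) \<in> Q" if "Nd (suc (fin 1)) y" for y
    using that digits_fin_1 by (auto simp: node_suc_iff)
  fix b c assume bc: "b \<in> segm X u v" "c \<in> segm X u v" "agree (suc (fin 1)) b c" "b < c"
  have X: "b \<in> X" "c \<in> X" "agree (fin 1) x b" using bc uv agree_segm in_segmD by blast+
  have N: "Nd (suc (fin 1)) b" using Nd_suc_if_agree[OF X(1,2) bc(3)] bc(4) by auto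
  have "dig b (fin 0) = dig x (fin 0)" using X(3) by (simp add: agree_def)
  moreover have "dig b (fin 1) = dig c (fin 1)" using bc(3) by (simp add: agree_suc_iff)
  ultimately have "ranked 0 (suc (fin 1)) b"
    using ranked_code_child[OF N] depth[OF bc(1,2,4)] by simp
  then show "thin X (Suc 0) b c" using thin_ranked X bc(3) agree_refl by blast
qed

text \<open>If on one side of \<open>z\<close> no block of higher rank reaches \<open>z\<close>, then there is a segment next to \<open>z\<close> on that side which
  is free of such blocks, since their positions are isolated. The two statements are
  mirror images.\<close>

lemma near_code_end:
  assumes x: "Nd (fin 1) x" and z: "z \<in> X" "agree (fin 1) x z" "0 < dig z (fin 1)" "dig z (fin 1) < 1"
  shows "(\<And>b. b \<in> X \<Longrightarrow> agree (fin 1) x b \<Longrightarrow> dig b (fin 1) = dig z (fin 1) \<Longrightarrow> b < z \<Longrightarrow>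
           depth (dig x (fin 0)) (dig z (fin 1)) = 0) \<Longrightarrow> near X (trunc x (fin 1) 0) 1 z"
    and "(\<And>b. b \<in> X \<Longrightarrow> agree (fin 1) x b \<Longrightarrow> dig b (fin 1) = dig z (fin 1) \<Longrightarrow> z < b \<Longrightarrow>
           depth (dig x (fin 0)) (dig z (fin 1)) = 0) \<Longrightarrow> near X (trunc x (fin 1) 1) 1 z"
proof -
  let ?d = "dig z (fin 1)" and ?L = "trunc x (fin 1) 0" and ?H = "trunc x (fin 1) 1"
  obtain u v where uv: "0 < u" "u < ?d" "?d < v" "v < 1"
    "\<And>e. u \<le> e \<Longrightarrow> e \<le> v \<Longrightarrow> e \<noteq> ?d \<Longrightarrow> depth (dig x (fin 0)) e = 0"
    using depth_locally_0[OF z(3,4), where a = "dig x (fin 0)"] by metis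
  define U V where "U = trunc x (fin 1) u" and "V = trunc x (fin 1) v"
  have UV: "U \<in> X" "V \<in> X" "agree (fin 1) x U" "agree (fin 1) x V"
    using x uv by (auto simp: U_def V_def intro: trunc_in_X)
  have less: "?L < U" "U < z" "z < V" "V < ?H"
    using uv z(2) agree_sym[OF z(2)]
    by (auto simp: U_def V_def intro!: lessI_digit[of "fin 1"] intro: agree_truncI)
  show "near X ?L 1 z" if depth: "\<And>b. b \<in> X \<Longrightarrow> agree (fin 1) x b \<Longrightarrow> dig b (fin 1) = ?d \<Longrightarrow> b < z \<Longrightarrow>
           depth (dig x (fin 0)) ?d = 0"
  proof -
    have "thin X 1 U z"
    proof (rule thin_code_part[OF UV(1) z(1) UV(3) z(2)])
      fix b c assume bc: "b \<in> segm X U z" "c \<in> segm X U z" "b < c" "dig b (fin 1) = dig c (fin 1)"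
      have b: "b \<in> X" "U \<le> b" "b < z" "agree (fin 1) x b"
        using bc less agree_segm[OF UV(3) z(2) bc(1)] by (auto simp: segm_eq)
      have "u \<le> dig b (fin 1)" "dig b (fin 1) \<le> ?d"
        using dig_mono[OF agree_common[OF UV(3) b(4)] b(2)] dig_mono[OF agree_common[OF b(4) z(2)]] b(3)
        by (auto simp: U_def)
      then show "depth (dig x (fin 0)) (dig b (fin 1)) = 0"
        using uv depth[OF b(1,4) _ b(3)] by (cases "dig b (fin 1) = ?d") auto
    qed
    moreover have "U \<in> segm X ?L z" "U \<noteq> z" using less UV by (auto intro: segmI)
    ultimately show ?thesis unfolding near_def by blast
  qed
  show "near X ?H 1 z" if depth: "\<And>b. b \<in> X \<Longrightarrow> agree (fin 1) x b \<Longrightarrow> dig b (fin 1) = ?d \<Longrightarrow> z < b \<Longrightarrow>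
           depth (dig x (fin 0)) ?d = 0"
  proof -
    have "thin X 1 V z"
    proof (rule thin_code_part[OF UV(2) z(1) UV(4) z(2)])
      fix b c assume bc: "b \<in> segm X V z" "c \<in> segm X V z" "b < c" "dig b (fin 1) = dig c (fin 1)"
      have c: "c \<in> X" "c \<le> V" "z < c" "agree (fin 1) x c"
        using bc less agree_segm[OF UV(4) z(2) bc(2)] by (auto simp: segm_eq segm_commute[of X V])
      have "dig c (fin 1) \<le> v" "?d \<le> dig c (fin 1)"
        using dig_mono[OF agree_common[OF c(4) UV(4)] c(2)] dig_mono[OF agree_common[OF z(2) c(4)]] c(3)
        by (auto simp: V_def)
      then show "depth (dig x (fin 0)) (dig b (fin 1)) = 0"
        using uv depth[OF c(1,4) _ c(3)] bc(4) by (cases "dig c (fin 1) = ?d") auto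
    qed
    moreover have "V \<in> segm X ?H z" "V \<noteq> z" using less UV by (auto intro: segmI')
    ultimately show ?thesis unfolding near_def by blast
  qed
qed

text \<open>Both ends of the block at a digit are special points whose type is the depth of the block.\<close>

lemma near_code_child:
  assumes x: "Nd (fin 1) x" and y: "agree (fin 1) x y" "Nd (suc (fin 1)) y"
    and n: "depth (dig x (fin 0)) (dig y (fin 1)) = n"
  defines "L \<equiv> trunc x (fin 1) 0" and "H \<equiv> trunc x (fin 1) 1"
    and "lo \<equiv> trunc y (suc (fin 1)) 0" and "hi \<equiv> trunc y (suc (fin 1)) 1"
  shows "near X L 1 lo \<and> near X H (Suc n) lo \<and> \<not> near X H n lo"
    and "near X H 1 hi \<and> near X L (Suc n) hi \<and> \<not> near X L n hi"
proof -
  have d: "0 < dig y (fin 1)" "dig y (fin 1) < 1" using Nd_suc[OF y(2)] by auto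
  have dlo: "dig lo (fin 1) = dig y (fin 1)" "dig hi (fin 1) = dig y (fin 1)"
    using less_suc[of "fin 1"] by (auto simp: lo_def hi_def dig_trunc)
  have X: "lo \<in> X" "hi \<in> X" "L \<in> X" "H \<in> X"
    using x y(2) by (auto simp: lo_def hi_def L_def H_def intro: trunc_in_X)
  have ag: "agree (fin 1) x lo" "agree (fin 1) x hi"
    using y(1) agree_le[OF agree_trunc(1)[of "suc (fin 1)" y], of "fin 1"] less_suc[of "fin 1"] agree_trans
    unfolding lo_def hi_def by (metis less_imp_le)+
  have agy: "agree (suc (fin 1)) y lo" "agree (suc (fin 1)) y hi" by (auto simp: lo_def hi_def)
  have r: "ranked n (suc (fin 1)) y"
    using ranked_code_child[OF y(2)] n y(1) by (auto simp: agree_def)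
  have "L < lo" "hi < H"
    unfolding L_def H_def using d dlo
      lessI_digit[OF agree_truncI(2)[OF ag(1)]] lessI_digit[OF agree_truncI(1)[OF agree_sym[OF ag(2)]]]
    by auto
  moreover have "lo < hi" by (simp add: lo_def hi_def)
  ultimately have less: "L < lo" "lo < hi" "hi < H" by auto
  have in_block: "lo \<le> b \<and> b \<le> hi" if "b \<in> X" "agree (fin 1) x b" "dig b (fin 1) = dig y (fin 1)" for b
    unfolding lo_def hi_def
    using block_ends[OF y(2) that(1)] agree_common[OF y(1) that(2)] that(3) by (auto simp: agree_suc_iff)
  have ends: "b = z" if "z = lo \<or> z = hi" "b \<in> X" "agree (suc (fin 1)) y b" "dig b (suc (fin 1)) = dig z (suc (fin 1))" for b z
  proof (rule eq_if_no_child[OF that(2) _ _ that(4)])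
    show "z \<in> X" using that(1) X by blast
    show "agree (suc (fin 1)) z b" using agree_common that(1,3) agy by blast
    have "dig z (suc (fin 1)) = 0 \<or> dig z (suc (fin 1)) = 1" using that(1) by (auto simp: lo_def hi_def)
    then show "\<not> Nd (suc (suc (fin 1))) z" by (rule not_Nd_suc_end)
  qed
  have seg: "hi \<in> segm X H lo" "lo \<in> segm X L hi"
    using less X by (auto intro!: segmI simp: segm_commute[of X H])
  have "near X L 1 lo"
    unfolding L_def using X d dlo ag in_block by (intro near_code_end[OF x]) (auto simp: not_less[symmetric])
  moreover have "near X H (Suc n) lo" "\<not> near X H n lo"
  proof -
    have "near X hi (Suc n) lo"
      using thin_ranked[OF r X(2,1) agy(2,1)] X less by (intro near_if_thin) auto
    then show "near X H (Suc n) lo" using near_iff[OF seg(1) _ X(1)] less by auto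
    have "\<not> near X hi n lo"
      using ends[of lo] agree_segm[OF agy(2,1)] in_segmD
      by (intro not_near_ranked[OF r X(1,2) agy]) blast
    then show "\<not> near X H n lo" using near_iff[OF seg(1) _ X(1)] less by auto
  qed
  ultimately show "near X L 1 lo \<and> near X H (Suc n) lo \<and> \<not> near X H n lo" by blast
  have "near X H 1 hi"
    unfolding H_def using X d dlo ag in_block by (intro near_code_end[OF x]) (auto simp: not_less[symmetric])
  moreover have "near X L (Suc n) hi" "\<not> near X L n hi"
  proof -
    have "near X lo (Suc n) hi"
      using thin_ranked[OF r X(1,2) agy] X less by (intro near_if_thin) auto
    then show "near X L (Suc n) hi" using near_iff[OF seg(2) _ X(2)] less by auto
    have "\<not> near X lo n hi"
      using ends[of hi] agree_segm[OF agy] in_segmD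
      by (intro not_near_ranked[OF r X(2,1) agy(2,1)]) blast
    then show "\<not> near X L n hi" using near_iff[OF seg(2) _ X(2)] less by auto
  qed
  ultimately show "near X H 1 hi \<and> near X L (Suc n) hi \<and> \<not> near X L n hi" by blast
qed

text \<open>At each digit \<open>1 / (n + 2)\<close> with \<open>n \<in> code a\<close> an end of the inserted block is special of type
  \<open>n\<close>. Inside the inserted blocks no type from \<open>2\<close> on occurs, and at all other inner points both
  local ranks are \<open>1\<close>.\<close>

theorem types_code_block:
  assumes x: "Nd (fin 1) x"
  shows "types X (trunc x (fin 1) 0) (trunc x (fin 1) 1) = code (dig x (fin 0))"
proof -
  let ?L = "trunc x (fin 1) 0" and ?H = "trunc x (fin 1) 1" and ?a = "dig x (fin 0)"
  have LH: "?L \<in> X" "?H \<in> X" "?L < ?H" using x by (auto intro: trunc_in_X)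
  show ?thesis
  proof (intro equalityI subsetI)
    fix n assume n: "n \<in> code ?a"
    define y where "y = trunc x (fin 1) (1 / (real n + 2))"
    have N: "Nd (suc (fin 1)) y"
      unfolding y_def using code_digit_in_Q digits_fin_1 by (intro node_trunc_suc[OF x]) auto
    define lo where "lo = trunc y (suc (fin 1)) 0"
    have "depth ?a (dig y (fin 1)) = n" using depth_code[OF n] by (simp add: y_def)
    then have near: "near X ?L 1 lo \<and> near X ?H (Suc n) lo \<and> \<not> near X ?H n lo"
      unfolding lo_def using near_code_child(1)[OF x _ N] by (simp add: y_def)
    have "lo \<in> X" unfolding lo_def using N by (auto intro: trunc_in_X)
    moreover have "agree (fin 1) x lo"
      using less_suc[of "fin 1"] by (auto simp: agree_def lo_def y_def dig_trunc)
    ultimately have "lo \<in> segm X ?L ?H" using block_ends[OF x] by (auto intro: segmI)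
    then show "n \<in> types X ?L ?H"
      using near code_ge_2[OF n] by (auto simp: types_def special_def)
  next
    fix m assume "m \<in> types X ?L ?H"
    then obtain z where m: "2 \<le> m" and sp: "special X ?L ?H m z \<or> special X ?H ?L m z"
      by (auto simp: types_def)
    then have zs: "z \<in> segm X ?L ?H" by (auto simp: special_def segm_commute)
    have z: "z \<in> X" "agree (fin 1) x z"
      using in_segmD[OF zs] agree_segm[OF agree_trunc(1) agree_trunc(1) zs] by auto
    have zne: "z \<noteq> ?L" "z \<noteq> ?H" using sp near_ends[of X _ _ z] unfolding special_def by blast+
    let ?d = "dig z (fin 1)"
    have "?d \<noteq> 0" "?d \<noteq> 1"
      using eq_if_no_child[OF z(1) LH(1) agree_truncI(2)[OF z(2)]]
        eq_if_no_child[OF z(1) LH(2) agree_truncI(2)[OF z(2)]] zne not_Nd_suc_end by auto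
    then have d: "0 < ?d" "?d < 1"
      using dig_bounds(1)[OF z(1), of "fin 1"] dig_bounds(2)[OF z(1), of "fin 1"] by auto
    have pos: "depth ?a ?d \<noteq> 0"
    proof
      assume "depth ?a ?d = 0"
      then have "near X ?L 1 z" "near X ?H 1 z" using near_code_end[OF x z d] by auto
      then show False using sp m near_le[of X _ 1 z m] by (auto simp: special_def)
    qed
    define n where "n = depth ?a ?d"
    have n: "n \<in> code ?a" "?d = 1 / (real n + 2)" using depth_pos[OF pos] by (auto simp: n_def)
    have Nz: "Nd (suc (fin 1)) z"
      unfolding node_suc_iff digits_fin_1 using Nd_cong[OF z(2) x] n(2) code_digit_in_Q by auto
    let ?lo = "trunc z (suc (fin 1)) 0" and ?hi = "trunc z (suc (fin 1)) 1"
    have r: "ranked n (suc (fin 1)) z"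
      using ranked_code_child[OF Nz] z(2) by (auto simp: agree_def n_def)
    note near = near_code_child[OF x z(2) Nz n_def[symmetric]]
    consider "z = ?lo" | "z = ?hi" | "z \<noteq> ?lo" "z \<noteq> ?hi" by blast
    then have "m = n"
    proof cases
      case 1
      then have "near X ?L 1 z" "near X ?H (Suc n) z" "\<not> near X ?H n z" using near(1) by metis+
      then show ?thesis using special_unique code_ge_2[OF n(1)] m sp by blast
    next
      case 2
      then have "near X ?H 1 z" "near X ?L (Suc n) z" "\<not> near X ?L n z" using near(2) by metis+
      then show ?thesis using special_unique code_ge_2[OF n(1)] m sp by blast
    next
      case 3
      have lohi: "?lo \<in> X" "?hi \<in> X" using Nz by (auto intro: trunc_in_X)
      have le: "?lo \<le> z" "z \<le> ?hi" using block_ends[OF Nz z(1)] by auto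
      have "?L < ?lo" "?hi < ?H"
        using d z(2) less_suc[of "fin 1"] by (auto intro!: lessI_digit[of "fin 1"] simp: agree_def dig_trunc)
      then have seg: "?lo \<in> segm X ?L z" "?hi \<in> segm X ?H z"
        using le lohi by (auto intro: segmI segmI')
      have zz: "z \<in> segm X ?lo ?hi" "z \<in> segm X ?hi ?lo"
        using le z(1) by (auto intro: segmI segmI')
      have "special X ?lo ?hi m z \<or> special X ?hi ?lo m z"
        using sp zz near_iff[OF seg(1) _ z(1)] near_iff[OF seg(2) _ z(1)] 3
        by (auto simp: special_def)
      then show ?thesis using not_special_ranked[OF r z(1) agree_refl 3 m] by blast
    qed
    then show "m \<in> code ?a" using n(1) by simp
  qed
qed

end

text \<open>The image of the block coding \<open>a\<close> has types \<open>code a\<close>. If its ends have the same root digit \<open>b\<close>,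
  it is part of the block coding \<open>b\<close>, and so \<open>code a \<subseteq> code b\<close>. Otherwise two different elements of
  \<open>Q\<close> lie between the root digits, and the image contains both blocks coding them.\<close>

lemma coded_set_mono:
  assumes "coded_tree A S" "coded_tree A T"
    and inj: "inj_on \<phi> (node_tree.X (node A S))"
    and segm: "\<And>u v. u \<in> node_tree.X (node A S) \<Longrightarrow> v \<in> node_tree.X (node A S) \<Longrightarrow>
       \<phi> ` segm (node_tree.X (node A S)) u v = segm (node_tree.X (node A T)) (\<phi> u) (\<phi> v)"
    and img: "\<phi> ` node_tree.X (node A S) \<subseteq> node_tree.X (node A T)"
  shows "S \<subseteq> Q \<union> T"
proof
  interpret S: coded_tree A S by fact
  interpret T: coded_tree A T by fact
  have fin_1: "fin 1 = suc (fin 0)" by (simp add: fin_Suc)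
  have root: "digits A R x (fin 0) = Q \<union> R" for R x by (simp add: digits_def)
  fix a assume a: "a \<in> S"
  let ?x = "trunc S.Bot (fin 0) a"
  have Nx: "S.Nd (fin 1) ?x"
    unfolding fin_1 using a root by (intro S.node_trunc_suc S.Nd_0) auto
  let ?u = "trunc ?x (fin 1) 0" and ?v = "trunc ?x (fin 1) 1"
  have uv: "?u \<in> S.X" "?v \<in> S.X" "?u < ?v" using Nx by (auto intro: S.trunc_in_X)
  have "types T.X (\<phi> ?u) (\<phi> ?v) = types S.X ?u ?v"
    using types_iso[OF inj segm uv(1,2)] by simp
  also have "\<dots> = code a" using S.types_code_block[OF Nx] by simp
  finally have ty: "types T.X (\<phi> ?u) (\<phi> ?v) = code a" .
  define p q where "p = min (\<phi> ?u) (\<phi> ?v)" and "q = max (\<phi> ?u) (\<phi> ?v)"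
  have "\<phi> ?u \<noteq> \<phi> ?v" using inj uv by (metis inj_on_eq_iff less_irrefl)
  then have pq: "p < q" "p \<in> T.X" "q \<in> T.X" "types T.X p q = code a"
    using ty img uv by (auto simp: p_def q_def min_def max_def types_commute)
  show "a \<in> Q \<union> T"
  proof (cases "dig p (fin 0) = dig q (fin 0)")
    case True
    then have ag: "agree (suc (fin 0)) p q" by (simp add: agree_suc_iff)
    have N: "T.Nd (suc (fin 0)) p" using T.Nd_suc_if_agree[OF pq(2,3) ag] pq(1) by auto
    then have b: "dig p (fin 0) \<in> Q \<union> T" using root by (auto simp: T.node_suc_iff)
    let ?lo = "trunc p (fin 1) 0" and ?hi = "trunc p (fin 1) 1"
    have "p \<in> segm T.X ?lo ?hi" "q \<in> segm T.X ?lo ?hi"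
      using T.block_ends[of "fin 1" p] N ag pq unfolding fin_1 by (auto intro!: segmI)
    then have "code a \<subseteq> code (dig p (fin 0))"
      using types_mono T.types_code_block N pq(4) unfolding fin_1[symmetric] by metis
    then show ?thesis using code_antichain b by blast
  next
    case False
    then have less: "dig p (fin 0) < dig q (fin 0)"
      using dig_mono[of "fin 0" p q] pq(1) by (simp add: order.strict_iff_order)
    have *: "b = a" if b: "b \<in> Q" "dig p (fin 0) < b" "b < dig q (fin 0)" for b
    proof -
      let ?y = "trunc T.Bot (fin 0) b"
      have N: "T.Nd (fin 1) ?y"
        unfolding fin_1 using b root by (intro T.node_trunc_suc T.Nd_0) auto
      have "trunc ?y (fin 1) e \<in> segm T.X p q" if "0 \<le> e" "e \<le> 1" for e
      proof (intro segmI less_imp_le)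
        show "trunc ?y (fin 1) e \<in> T.X" using N that by (rule T.trunc_in_X)
        show "p < trunc ?y (fin 1) e" "trunc ?y (fin 1) e < q"
          using b by (auto intro!: lessI_digit[of "fin 0"] simp: dig_trunc)
      qed
      then have "code b \<subseteq> code a"
        using types_mono[of "trunc ?y (fin 1) 0" T.X p q "trunc ?y (fin 1) 1"]
          T.types_code_block[OF N] pq(4) by simp
      then show ?thesis by (rule code_antichain)
    qed
    have "0 \<le> dig p (fin 0)" "dig q (fin 0) \<le> 1" using T.dig_bounds pq by auto
    then obtain b where b: "b \<in> Q" "dig p (fin 0) < b" "b < dig q (fin 0)"
      using Q_between less by metis
    obtain c where c: "c \<in> Q" "b < c" "c < dig q (fin 0)"
      using Q_between[of b "dig q (fin 0)"] b \<open>0 \<le> dig p (fin 0)\<close> \<open>dig q (fin 0) \<le> 1\<close> by auto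
    have "b = a" "c = a" using *[OF b] *[of c] b c by auto
    with c(2) have False by simp
    then show ?thesis by simp
  qed
qed

section \<open>Cardinalities\<close>

lemma card_of_Pow_cexp: "|Pow A| =o ctwo ^c |A|"
  unfolding cexp_def ctwo_def Field_card_of by (rule card_of_Pow_Func)

lemma card_of_reals: "|UNIV :: real set| =o ctwo ^c natLeq"
proof -
  have "|UNIV :: real set| =o |UNIV :: nat set set|"
    using nat_sets_eqpoll_reals by (simp add: eqpoll_iff_card_of_ordIso ordIso_symmetric)
  also have "|UNIV :: nat set set| =o ctwo ^c |UNIV :: nat set|"
    using card_of_Pow_cexp[of "UNIV :: nat set"] by simp
  also have "ctwo ^c |UNIV :: nat set| =o ctwo ^c natLeq"
    by (rule cexp_cong2[OF card_of_nat Card_order_ctwo card_of_Card_order])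
  finally show ?thesis .
qed

lemma card_of_countable_subsets:
  assumes "|D| \<le>o ctwo ^c natLeq"
  shows "|{C. C \<subseteq> D \<and> countable C \<and> C \<noteq> {}}| \<le>o ctwo ^c natLeq"
proof -
  have "|{C. C \<subseteq> D \<and> countable C \<and> C \<noteq> {}}| \<le>o |D| ^c natLeq"
    by (rule card_of_countable_sets_Func)
  also have "|D| ^c natLeq \<le>o (ctwo ^c natLeq) ^c natLeq"
    using assms natLeq_Card_order by (rule cexp_mono1)
  also have "(ctwo ^c natLeq) ^c natLeq =o ctwo ^c natLeq"
    by (rule cexp_cprod_ordLeq[OF Card_order_ctwo natLeq_Cinfinite
          Cinfinite_Cnotzero[OF natLeq_Cinfinite] ordLeq_refl[OF natLeq_Card_order]])
  finally show ?thesis .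
qed

lemma card_of_finite_subsets:
  assumes "infinite Y"
  shows "|{M. finite M \<and> M \<subseteq> Y}| \<le>o |Y|"
proof -
  define G where "G = rec_nat {{}} (\<lambda>_ N. (\<lambda>(y, M). insert y M) ` (Y \<times> N))"
  have G: "G 0 = {{}}" "G (Suc n) = (\<lambda>(y, M). insert y M) ` (Y \<times> G n)" for n
    by (simp_all add: G_def)
  have "Y \<noteq> {}" using assms by auto
  have le: "|G n| \<le>o |Y|" for n
  proof (induction n)
    case 0
    show ?case unfolding G by (rule card_of_singl_ordLeq[OF \<open>Y \<noteq> {}\<close>])
  next
    case (Suc n)
    have "|Y \<times> G n| \<le>o |Y|"
      using card_of_Times_mono2[OF Suc] card_of_Times_same_infinite[OF assms] ordLeq_ordIso_trans by blast
    then show ?case unfolding G using card_of_image ordLeq_transitive by blast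
  qed
  have "M \<in> (\<Union>n. G n)" if "finite M" "M \<subseteq> Y" for M
    using that
  proof (induction M rule: finite_induct)
    case empty
    show ?case using G(1) by blast
  next
    case (insert y M)
    then obtain n where "M \<in> G n" by auto
    then have "insert y M \<in> G (Suc n)" unfolding G using insert.prems by auto
    then show ?case by blast
  qed
  then have "|{M. finite M \<and> M \<subseteq> Y}| \<le>o |\<Union>n. G n|"
    by (intro card_of_mono1) blast
  also have "|\<Union>n. G n| \<le>o |Y|"
    using le infinite_iff_card_of_nat[of Y] assms by (intro card_of_UNION_ordLeq_infinite) auto
  finally show ?thesis .
qed

lemma card_of_Times_le:
  assumes "infinite Y" "|A| \<le>o |Y|" "|B| \<le>o |Y|"
  shows "|A \<times> B| \<le>o |Y|"
  using card_of_Times_mono1[OF assms(2), of B] card_of_Times_mono2[OF assms(3), of Y]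
    card_of_Times_same_infinite[OF assms(1)] ordLeq_transitive ordLeq_ordIso_trans by blast

lemma card_of_Un_le: "infinite Y \<Longrightarrow> |A| \<le>o |Y| \<Longrightarrow> |B| \<le>o |Y| \<Longrightarrow> |A \<union> B| \<le>o |Y|"
  by (rule card_of_Un_ordLeq_infinite_Field) (simp_all add: Field_card_of card_of_card_order_on)

lemma card_of_countable_le: "countable C \<Longrightarrow> infinite Y \<Longrightarrow> |C| \<le>o |Y|"
  using countable_card_of_nat infinite_iff_card_of_nat ordLeq_transitive by blast

text \<open>A set of size \<open>\<kappa>\<close> is copied affinely into every rational subinterval.\<close>

lemma dense_uncountable_set:
  fixes \<kappa> :: "'k rel"
  assumes "Card_order \<kappa>" "natLeq <o \<kappa>" "\<kappa> \<le>o ctwo ^c natLeq"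
  obtains A where "|A| =o \<kappa>" "Q \<subseteq> A" "A \<subseteq> {0<..<1}"
    "\<And>u v. 0 \<le> u \<Longrightarrow> u < v \<Longrightarrow> v \<le> 1 \<Longrightarrow> uncountable (A \<inter> {u<..<v})"
proof -
  have F: "|Field \<kappa>| =o \<kappa>" using assms(1) by (rule card_of_Field_ordIso)
  have "|{0<..<1::real}| =o |UNIV :: real set|"
    using open_interval_eqpoll_reals[of 0 1] by (simp add: eqpoll_iff_card_of_ordIso)
  then have "|Field \<kappa>| \<le>o |{0<..<1::real}|"
    using F assms(3) card_of_reals
    by (meson ordIso_ordLeq_trans ordIso_symmetric ordLeq_ordIso_trans)
  then obtain f where f: "inj_on f (Field \<kappa>)" "f ` Field \<kappa> \<subseteq> {0<..<1::real}"
    unfolding card_of_ordLeq[symmetric] by blast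
  define B where "B = f ` Field \<kappa>"
  have "bij_betw f (Field \<kappa>) B" using f(1) by (simp add: bij_betw_def B_def)
  then have "|B| =o |Field \<kappa>|" by (rule ordIso_symmetric[OF card_of_ordIsoI])
  then have B: "|B| =o \<kappa>" "B \<subseteq> {0<..<1}"
    using ordIso_transitive[OF _ F] f(2) by (auto simp: B_def)
  have unc: "uncountable B"
  proof
    assume "countable B"
    then have "|B| \<le>o natLeq" by (simp add: countable_card_le_natLeq)
    then have "\<kappa> \<le>o natLeq" by (rule ordIso_ordLeq_trans[OF ordIso_symmetric[OF B(1)]])
    then show False using assms(2) not_ordLess_ordLeq by blast
  qed
  then have inf: "infinite B" using uncountable_infinite by blast
  define I where "I = {(u, v). u \<in> \<rat> \<and> v \<in> \<rat> \<and> 0 \<le> u \<and> u < v \<and> v \<le> (1 :: real)}"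
  define A where "A = Q \<union> (\<Union>(u, v)\<in>I. (\<lambda>b. u + (v - u) * b) ` B)"
  have "I \<subseteq> \<rat> \<times> \<rat>" by (auto simp: I_def)
  then have "countable I" by (rule countable_subset) (simp add: countable_rat)
  then have "|\<Union>(u, v)\<in>I. (\<lambda>b. u + (v - u) * b) ` B| \<le>o |B|"
    using inf by (intro card_of_UNION_ordLeq_infinite card_of_countable_le) (auto simp: card_of_image)
  moreover have "|Q| \<le>o |B|" using countable_Q inf by (rule card_of_countable_le)
  ultimately have "|A| \<le>o |B|"
    unfolding A_def using inf by (intro card_of_Un_le)
  moreover have "B \<subseteq> A"
  proof -
    have "(0, 1) \<in> I" by (auto simp: I_def)
    then have "(\<lambda>b. 0 + (1 - 0) * b) ` B \<subseteq> A" unfolding A_def by blast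
    then show ?thesis by simp
  qed
  ultimately have "|A| =o |B|" using card_of_mono1 ordIso_iff_ordLeq by blast
  show thesis
  proof
    show "|A| =o \<kappa>" using \<open>|A| =o |B|\<close> B(1) by (rule ordIso_transitive)
    show "Q \<subseteq> A" by (auto simp: A_def)
    have aff: "u + (v - u) * b \<in> {u<..<v}" if "u < v" "b \<in> B" for u v b :: real
    proof -
      have "0 < b" "b < 1" using that(2) B(2) by auto
      then have "0 < (v - u) * b" "(v - u) * b < (v - u) * 1" using that(1) by (auto intro!: mult_strict_left_mono)
      then show ?thesis by auto
    qed
    then show "A \<subseteq> {0<..<1}" by (fastforce simp: A_def I_def Q_def)
    fix u v :: real assume uv: "0 \<le> u" "u < v" "v \<le> 1"
    obtain u' where u': "u' \<in> \<rat>" "u < u'" "u' < v" using Rats_dense_in_real[OF uv(2)] by blast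
    obtain v' where v': "v' \<in> \<rat>" "u' < v'" "v' < v" using Rats_dense_in_real[OF u'(3)] by blast
    have "(u', v') \<in> I" using uv u' v' by (auto simp: I_def)
    then have "(\<lambda>b. u' + (v' - u') * b) ` B \<subseteq> A \<inter> {u<..<v}"
      unfolding A_def using aff[OF v'(2)] u' v' by fastforce
    moreover have "inj_on (\<lambda>b. u' + (v' - u') * b) B" using v'(2) by (auto simp: inj_on_def)
    ultimately have "uncountable ((\<lambda>b. u' + (v' - u') * b) ` B)"
      using unc countable_image_inj_on by blast
    then show "uncountable (A \<inter> {u<..<v})"
      using countable_subset[OF \<open>(\<lambda>b. u' + (v' - u') * b) ` B \<subseteq> A \<inter> {u<..<v}\<close>] by blast
  qed
qed

text \<open>An injection \<open>p\<close> assigns two elements to each \<open>a\<close>, and a set \<open>Z\<close> selects one of the two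
  according to whether \<open>a \<in> Z\<close>. Different selections are incomparable.\<close>

lemma antichain_of_subsets:
  fixes A :: "'a set"
  assumes "infinite A"
  obtains \<sigma> :: "'a set \<Rightarrow> 'a set" where "\<And>Z. \<sigma> Z \<subseteq> A"
    "\<And>Z Z'. Z \<subseteq> A \<Longrightarrow> Z' \<subseteq> A \<Longrightarrow> \<sigma> Z \<subseteq> \<sigma> Z' \<Longrightarrow> Z = Z'"
proof -
  have "|A \<times> (UNIV :: bool set)| \<le>o |A|"
    by (rule card_of_Times_le[OF assms ordLeq_refl[OF card_of_Card_order] card_of_countable_le[OF _ assms]]) simp
  then obtain p where p: "inj_on p (A \<times> (UNIV :: bool set))" "p ` (A \<times> UNIV) \<subseteq> A"
    unfolding card_of_ordLeq[symmetric] by blast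
  show thesis
  proof
    show "(\<lambda>a. p (a, a \<in> Z)) ` A \<subseteq> A" for Z using p(2) by auto
    fix Z Z' assume Z: "Z \<subseteq> A" "Z' \<subseteq> A" "(\<lambda>a. p (a, a \<in> Z)) ` A \<subseteq> (\<lambda>a. p (a, a \<in> Z')) ` A"
    have "a \<in> Z \<longleftrightarrow> a \<in> Z'" if a: "a \<in> A" for a
    proof -
      obtain b where b: "b \<in> A" "p (a, a \<in> Z) = p (b, b \<in> Z')" using Z(3) a by blast
      then have "(a, a \<in> Z) = (b, b \<in> Z')" using inj_onD[OF p(1) b(2)] a b(1) by blast
      then show ?thesis by (metis Pair_inject)
    qed
    then show "Z = Z'" using Z(1,2) by blast
  qed
qed

context coded_tree
begin

text \<open>An order-dense set with as many elements as there are nodes.\<close>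

definition truncs :: "pt set" where
  "truncs = (\<Union>x. rat_truncs x)"

lemma truncs_subset: "truncs \<subseteq> X"
  using rat_truncs_subset by (auto simp: truncs_def)

lemma truncs_dense: "x \<in> X \<Longrightarrow> y \<in> X \<Longrightarrow> x < y \<Longrightarrow> \<exists>d\<in>truncs. x < d \<and> d < y"
  using rat_truncs_dense(1)[of x y] unfolding truncs_def by fast

lemma card_of_truncs:
  assumes "infinite A" "|UNIV :: omega1 set| \<le>o |A|"
  shows "|truncs| \<le>o |A|"
proof -
  define F where "F = (\<lambda>(\<xi>, M, r :: rat). trunc (SOME x. exceptions \<xi> x = M) \<xi> (of_rat r))"
  let ?Y = "(UNIV :: omega1 set) \<times> A"
  let ?I = "(UNIV :: omega1 set) \<times> {M. finite M \<and> M \<subseteq> ?Y} \<times> (UNIV :: rat set)"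
  have "truncs \<subseteq> F ` ?I"
  proof
    fix d assume "d \<in> truncs"
    then obtain x \<xi> r where d: "d = trunc x \<xi> (of_rat r)" "Nd \<xi> x"
      unfolding truncs_def rat_truncs_def by blast
    have "exceptions \<xi> x \<subseteq> ?Y"
      using d(2) digits_subset(2) by (fastforce simp: exceptions_def node_def)
    moreover have "d = F (\<xi>, exceptions \<xi> x, r)"
    proof -
      have "exceptions \<xi> (SOME y. exceptions \<xi> y = exceptions \<xi> x) = exceptions \<xi> x"
        by (rule someI) (rule refl)
      then have "agree \<xi> (SOME y. exceptions \<xi> y = exceptions \<xi> x) x" by (rule exceptions_eq_agree)
      then show ?thesis unfolding F_def d(1) using trunc_cong by auto
    qed
    ultimately show "d \<in> F ` ?I" using finite_exceptions[OF d(2)] by blast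
  qed
  moreover have "|?I| \<le>o |A|"
  proof (intro card_of_Times_le assms)
    have "infinite ?Y" using assms(1) finite_cartesian_productD2[of "UNIV :: omega1 set" A] by blast
    then have "|{M. finite M \<and> M \<subseteq> ?Y}| \<le>o |?Y|" by (rule card_of_finite_subsets)
    also have "|?Y| \<le>o |A|" using assms by (intro card_of_Times_le ordLeq_refl card_of_Card_order)
    finally show "|{M. finite M \<and> M \<subseteq> ?Y}| \<le>o |A|" .
    show "|UNIV :: rat set| \<le>o |A|" using assms(1) by (intro card_of_countable_le) auto
  qed
  ultimately show ?thesis
    using card_of_mono1 card_of_image ordLeq_transitive by meson
qed

text \<open>A point is determined by its countable set of rational truncations below it. \<open>Bot\<close> is added only to
  make that set nonempty.\<close>

lemma card_of_X:
  assumes "|truncs| \<le>o ctwo ^c natLeq"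
  shows "|X| \<le>o ctwo ^c natLeq"
proof -
  define E where "E = (\<lambda>x. insert Bot {e \<in> rat_truncs x. e < x})"
  have Bot: "Bot \<in> truncs"
  proof -
    have "Bot = trunc Bot (fin 0) (of_rat 0)" by (cases Bot) (auto simp: trunc_def Bot_def)
    then show ?thesis unfolding truncs_def rat_truncs_def using Nd_0 by force
  qed
  have ne: "E x \<noteq> E y" if xy: "x \<in> X" "y \<in> X" "x < y" for x y
  proof -
    obtain e where e: "e \<in> rat_truncs y" "x < e" "e < y" using rat_truncs_dense(2)[OF xy(2,1,3)] by blast
    then have "e \<in> E y" by (simp add: E_def)
    moreover have "e \<notin> E x" using e(2) Bot_le[OF xy(1)] by (auto simp: E_def)
    ultimately show ?thesis by blast
  qed
  have "|X| \<le>o |{C. C \<subseteq> truncs \<and> countable C \<and> C \<noteq> {}}|"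
  proof (rule card_of_ordLeqI)
    show "inj_on E X" using ne by (rule linorder_inj_onI) auto
    show "E x \<in> {C. C \<subseteq> truncs \<and> countable C \<and> C \<noteq> {}}" for x
    proof -
      have "countable {e \<in> rat_truncs x. e < x}"
        using countable_rat_truncs by (rule countable_subset[rotated]) auto
      then show ?thesis using Bot by (auto simp: E_def truncs_def)
    qed
  qed
  then show ?thesis using card_of_countable_subsets[OF assms] ordLeq_transitive by blast
qed

text \<open>The interiors of the child blocks of a node with an uncountable level.\<close>

lemma disjoint_open_intervals:
  obtains U where "\<And>t. t \<in> A \<Longrightarrow> openin (otop X) (U t) \<and> U t \<noteq> {}"
    "\<And>s t z. s \<in> A \<Longrightarrow> t \<in> A \<Longrightarrow> z \<in> U s \<Longrightarrow> z \<in> U t \<Longrightarrow> s = t"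
proof -
  obtain a where a: "a \<in> Q" using Q_between[of 0 1] by auto
  obtain n where n: "n \<in> code a" using code_nonempty by blast
  define x where "x = trunc (trunc Bot (fin 0) a) (fin 1) (1 / (real n + 2))"
  have fin_1: "fin 1 = suc (fin 0)" by (simp add: fin_Suc)
  have "Nd (fin 1) (trunc Bot (fin 0) a)"
    unfolding fin_1 using a by (intro node_trunc_suc Nd_0) (auto simp: digits_def)
  then have N: "Nd (suc (fin 1)) x"
    unfolding x_def using code_digit_in_Q digits_fin_1 by (intro node_trunc_suc) auto
  have "dig x (fin 0) = a" "dig x (fin 1) = 1 / (real n + 2)" by (auto simp: x_def dig_trunc)
  then have r: "ranked n (suc (fin 1)) x" using ranked_code_child[OF N] depth_code[OF n] by simp
  obtain k where "n = Suc k" using code_ge_2[OF n] by (cases n) auto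
  then have dA: "digits A S x (suc (fin 1)) = A" using ranked_Suc_digits r by blast
  define y where "y = (\<lambda>t. trunc x (suc (fin 1)) t)"
  let ?\<xi> = "suc (suc (fin 1))"
  define U where "U = (\<lambda>t. {z \<in> X. trunc (y t) ?\<xi> 0 < z} \<inter> {z \<in> X. z < trunc (y t) ?\<xi> 1})"
  have Ny: "Nd ?\<xi> (y t)" if "t \<in> A" for t
    unfolding y_def using that dA by (intro node_trunc_suc[OF N]) auto
  show thesis
  proof
    fix t assume t: "t \<in> A"
    have X: "trunc (y t) ?\<xi> 0 \<in> X" "trunc (y t) ?\<xi> 1 \<in> X" using Ny[OF t] by (auto intro: trunc_in_X)
    have "openin (otop X) (U t)"
      unfolding U_def using X by (intro openin_Int openin_greater openin_lesser)
    moreover have "U t \<noteq> {}" using X_dense[OF X] by (auto simp: U_def)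
    ultimately show "openin (otop X) (U t) \<and> U t \<noteq> {}" ..
  next
    have dz: "dig z (suc (fin 1)) = t" if "z \<in> U t" for z t
    proof -
      have "agree ?\<xi> (trunc (y t) ?\<xi> 0) z"
        using that unfolding U_def by (intro agree_between[OF agree_trunc(3) less_imp_le less_imp_le]) auto
      then have "dig z (suc (fin 1)) = dig (y t) (suc (fin 1))"
        using less_suc[of "suc (fin 1)"] by (auto simp: agree_def dig_trunc)
      then show ?thesis by (simp add: y_def)
    qed
    show "s = t" if "z \<in> U s" "z \<in> U t" for s t z using dz that by metis
  qed
qed

lemma complete_dense_order_X: "complete_dense_order X"
proof
  show "\<exists>s\<in>X. (\<forall>b\<in>B. b \<le> s) \<and> (\<forall>u\<in>X. (\<forall>b\<in>B. b \<le> u) \<longrightarrow> s \<le> u)" if "B \<subseteq> X" for B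
    using X_complete[OF that] by metis
qed (rule X_dense)

end

section \<open>Transport to the reals\<close>

text \<open>The points are renamed by \<open>h\<close>, and the order is carried along. If the names are reals, this order is unrelated to the
  usual one.\<close>

definition transported :: "('a::linorder \<Rightarrow> 'b) \<Rightarrow> 'a set \<Rightarrow> 'b topology" where
  "transported h X = order_topology_on (h ` X) ((\<lambda>(x, y). (h x, h y)) ` order_on X)"

lemma transported_rays:
  assumes "inj_on h X" "a \<in> X"
  shows "{y \<in> h ` X. (h a, y) \<in> (\<lambda>(x, y). (h x, h y)) ` order_on X \<and> y \<noteq> h a} = h ` {x \<in> X. a < x}"
    and "{y \<in> h ` X. (y, h a) \<in> (\<lambda>(x, y). (h x, h y)) ` order_on X \<and> y \<noteq> h a} = h ` {x \<in> X. x < a}"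
  using assms by (auto simp: order_on_def image_iff inj_on_eq_iff order_less_le)

lemma transported_eq:
  assumes "inj_on h X"
  shows "transported h X = topology_generated_by ((`) h ` (ups X X \<union> downs X X))"
proof -
  have 1: "(\<lambda>b. {y \<in> h ` X. (b, y) \<in> (\<lambda>(x, y). (h x, h y)) ` order_on X \<and> y \<noteq> b}) ` (h ` X)
      = (`) h ` ((\<lambda>a. {x \<in> X. a < x}) ` X)"
    unfolding image_image using transported_rays(1)[OF assms] by (intro image_cong) auto
  have 2: "(\<lambda>b. {y \<in> h ` X. (y, b) \<in> (\<lambda>(x, y). (h x, h y)) ` order_on X \<and> y \<noteq> b}) ` (h ` X)
      = (`) h ` ((\<lambda>a. {x \<in> X. x < a}) ` X)"
    unfolding image_image using transported_rays(2)[OF assms] by (intro image_cong) auto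
  show ?thesis
    unfolding transported_def order_topology_on_def 1 2 ups_def downs_def
    by (simp only: image_Un image_insert Un_insert_left Un_insert_right insert_absorb2)
qed

lemma homeomorphic_map_transported:
  assumes inj: "inj_on h X"
  shows "homeomorphic_map (otop X) (transported h X) h"
proof -
  have sub: "U \<subseteq> X" if "U \<in> ups X X \<union> downs X X" for U
    using that by (auto simp: ups_def downs_def)
  have top: "topspace (transported h X) = h ` X"
    unfolding transported_eq[OF inj] topology_generated_by_topspace by (auto simp: ups_def downs_def)
  have "continuous_map (otop X) (transported h X) h"
    unfolding transported_eq[OF inj]
  proof (rule continuous_on_generated_topo)
    show "openin (otop X) (h -` U \<inter> topspace (otop X))" if U: "U \<in> (`) h ` (ups X X \<union> downs X X)" for U
    proof -
      obtain V where V: "V \<in> ups X X \<union> downs X X" "U = h ` V" using U by blast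
      then have "h -` U \<inter> X = V" using sub[OF V(1)] inj by (auto simp: inj_on_eq_iff dest: subsetD)
      then show ?thesis using V(1) openin_ups openin_downs by auto
    qed
    show "h ` topspace (otop X) \<subseteq> \<Union>((`) h ` (ups X X \<union> downs X X))"
      by (auto simp: ups_def downs_def)
  qed
  moreover have "continuous_map (transported h X) (otop X) (inv_into X h)"
    unfolding otop_eq
  proof (rule continuous_on_generated_topo)
    show "openin (transported h X) (inv_into X h -` U \<inter> topspace (transported h X))"
      if "U \<in> ups X X \<union> downs X X" for U
    proof -
      have "inv_into X h -` U \<inter> h ` X = h ` U" using sub[OF that] inj by auto
      moreover have "openin (transported h X) (h ` U)"
        unfolding transported_eq[OF inj] using that by (intro topology_generated_by_Basis imageI)
      ultimately show ?thesis by (simp only: top)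
    qed
    show "inv_into X h ` topspace (transported h X) \<subseteq> \<Union>(ups X X \<union> downs X X)"
      unfolding top using inj by (auto simp: ups_def)
  qed
  ultimately have "homeomorphic_maps (otop X) (transported h X) h (inv_into X h)"
    unfolding homeomorphic_maps_def using inj by (simp add: top)
  then show ?thesis using homeomorphic_maps_map by blast
qed

lemma linearly_ordered_transported:
  assumes inj: "inj_on h X"
  shows "linearly_ordered_space (transported h X)"
proof -
  have top: "topspace (transported h X) = h ` X"
    using homeomorphic_imp_surjective_map[OF homeomorphic_map_transported[OF inj]] by simp
  have "linear_order_on (h ` X) ((\<lambda>(x, y). (h x, h y)) ` order_on X)"
    unfolding linear_order_on_def partial_order_on_def preorder_on_def
  proof (intro conjI)
    show "(\<lambda>(x, y). (h x, h y)) ` order_on X \<subseteq> h ` X \<times> h ` X" by (auto simp: order_on_def)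
    show "refl_on (h ` X) ((\<lambda>(x, y). (h x, h y)) ` order_on X)"
      by (auto simp: refl_on_def order_on_def)
    show "trans ((\<lambda>(x, y). (h x, h y)) ` order_on X)"
    proof (rule transI)
      fix a b c assume ab: "(a, b) \<in> (\<lambda>(x, y). (h x, h y)) ` order_on X"
        and bc: "(b, c) \<in> (\<lambda>(x, y). (h x, h y)) ` order_on X"
      obtain x y where xy: "a = h x" "b = h y" "x \<in> X" "y \<in> X" "x \<le> y"
        using ab by (auto simp: order_on_def)
      obtain y' z where yz: "b = h y'" "c = h z" "y' \<in> X" "z \<in> X" "y' \<le> z"
        using bc by (auto simp: order_on_def)
      note * = xy yz
      then have "y = y'" using inj by (metis inj_on_eq_iff)
      then have "(x, z) \<in> order_on X" using * by (auto simp: order_on_def)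
      then show "(a, c) \<in> (\<lambda>(x, y). (h x, h y)) ` order_on X" using * by auto
    qed
    show "antisym ((\<lambda>(x, y). (h x, h y)) ` order_on X)"
      using inj by (auto simp: antisym_def order_on_def inj_on_eq_iff)
    show "total_on (h ` X) ((\<lambda>(x, y). (h x, h y)) ` order_on X)"
      unfolding total_on_def
    proof (intro ballI impI)
      fix a b assume "a \<in> h ` X" "b \<in> h ` X"
      then obtain x y where "a = h x" "b = h y" "x \<in> X" "y \<in> X" by blast
      then show "(a, b) \<in> (\<lambda>(x, y). (h x, h y)) ` order_on X \<or> (b, a) \<in> (\<lambda>(x, y). (h x, h y)) ` order_on X"
        using linear[of x y] by (auto simp: order_on_def)
    qed
  qed
  then show ?thesis unfolding linearly_ordered_space_def top by (auto simp: transported_def)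
qed

lemma weight_eqI:
  fixes \<kappa> :: "'k rel"
  assumes "base_of X B" "|B| \<le>o \<kappa>" "\<And>B'. base_of X B' \<Longrightarrow> \<kappa> \<le>o |B'|"
  shows "weight X =o \<kappa>"
proof -
  define M where "M = (SOME B. base_of X B \<and> (\<forall>B'. base_of X B' \<longrightarrow> |B| \<le>o |B'| ))"
  have "base_of X B \<and> (\<forall>B'. base_of X B' \<longrightarrow> |B| \<le>o |B'| )"
    using assms ordLeq_transitive by blast
  then have M: "base_of X M \<and> (\<forall>B'. base_of X B' \<longrightarrow> |M| \<le>o |B'| )"
    unfolding M_def by (rule someI)
  then have "|M| \<le>o \<kappa>" "\<kappa> \<le>o |M|" using assms ordLeq_transitive by blast+
  then show ?thesis unfolding weight_def M_def[symmetric] by (simp add: ordIso_iff_ordLeq)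
qed

lemma base_of_homeomorphic_image:
  assumes "homeomorphic_map X Y h" "base_of X B"
  shows "base_of Y ((`) h ` B)"
proof -
  have B: "\<And>V. V \<in> B \<Longrightarrow> openin X V" "\<And>U x. openin X U \<Longrightarrow> x \<in> U \<Longrightarrow> \<exists>V\<in>B. x \<in> V \<and> V \<subseteq> U"
    using assms(2) unfolding base_of_def openin_topology_base_unique by blast+
  obtain g where g: "homeomorphic_maps X Y h g" using assms(1) homeomorphic_map_maps by blast
  have inv: "\<And>x. x \<in> topspace X \<Longrightarrow> g (h x) = x" "\<And>y. y \<in> topspace Y \<Longrightarrow> h (g y) = y"
    using g by (auto simp: homeomorphic_maps_def)
  have gh: "homeomorphic_map Y X g" using g homeomorphic_maps_map by blast
  show ?thesis
    unfolding base_of_def openin_topology_base_unique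
  proof (intro conjI allI impI)
    fix V assume "V \<in> (`) h ` B"
    then show "openin Y V" using B(1) homeomorphic_map_openness_eq[OF assms(1)] by blast
  next
    fix U y assume U: "openin Y U \<and> y \<in> U"
    then have "openin X (g ` U)" "g y \<in> g ` U" "U \<subseteq> topspace Y"
      using homeomorphic_map_openness_eq[OF gh] openin_subset by blast+
    then obtain V where V: "V \<in> B" "g y \<in> V" "V \<subseteq> g ` U" using B(2) by meson
    have "h ` V \<subseteq> U" using V(3) \<open>U \<subseteq> topspace Y\<close> inv(2) by force
    moreover have "y \<in> h ` V" using V(2) inv(2) U \<open>U \<subseteq> topspace Y\<close> by force
    ultimately show "\<exists>V. V \<in> (`) h ` B \<and> y \<in> V \<and> V \<subseteq> U" using V(1) by blast
  qed
qed

lemma card_of_base_ge: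
  assumes "base_of X B" "\<And>t. t \<in> A \<Longrightarrow> openin X (U t) \<and> U t \<noteq> {}"
    "\<And>s t z. s \<in> A \<Longrightarrow> t \<in> A \<Longrightarrow> z \<in> U s \<Longrightarrow> z \<in> U t \<Longrightarrow> s = t"
  shows "|A| \<le>o |B|"
proof -
  have "\<exists>V\<in>B. V \<noteq> {} \<and> V \<subseteq> U t" if t: "t \<in> A" for t
  proof -
    obtain z where "z \<in> U t" using assms(2)[OF t] by blast
    then show ?thesis
      using assms(1) assms(2)[OF t] unfolding base_of_def openin_topology_base_unique by blast
  qed
  then obtain V where V: "\<And>t. t \<in> A \<Longrightarrow> V t \<in> B \<and> V t \<noteq> {} \<and> V t \<subseteq> U t" by metis
  show ?thesis
  proof (rule card_of_ordLeqI)
    show "inj_on V A"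
    proof (rule inj_onI)
      fix s t assume st: "s \<in> A" "t \<in> A" "V s = V t"
      then obtain z where "z \<in> V s" using V by blast
      then show "s = t" using V st assms(3) by blast
    qed
  qed (use V in blast)
qed

lemma card_of_interval_base:
  fixes E :: "'a::linorder set"
  assumes "infinite Y" "|E| \<le>o |Y|"
  shows "|interval_base X E| \<le>o |Y|"
proof -
  have img: "|insert X (f ` E)| \<le>o |Y|" for f :: "'a \<Rightarrow> 'a set"
  proof -
    have "|{X} \<union> f ` E| \<le>o |Y|"
      using assms ordLeq_transitive[OF card_of_image assms(2), of f] card_of_countable_le[of "{X}" Y]
      by (intro card_of_Un_le) auto
    then show ?thesis by simp
  qed
  have "|ups X E \<times> downs X E| \<le>o |Y|"
    unfolding ups_def downs_def by (intro card_of_Times_le assms(1) img)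
  then show ?thesis
    unfolding interval_base_def using card_of_image ordLeq_transitive by blast
qed

lemma totally_pathwise_disconnected_homeomorphic:
  assumes "homeomorphic_map X Y h" "totally_pathwise_disconnected X"
  shows "totally_pathwise_disconnected Y"
  unfolding totally_pathwise_disconnected_def homeomorphic_map_path_components_of[OF assms(1)]
proof
  fix C assume "C \<in> (`) h ` path_components_of X"
  then obtain D where D: "D \<in> path_components_of X" "C = h ` D" by auto
  obtain x where "D = {x}"
    using bspec[OF assms(2)[unfolded totally_pathwise_disconnected_def] D(1)] by auto
  with D(2) show "\<exists>y. C = {y}" by simp
qed

lemma embeds_in_homeomorphic:
  assumes "homeomorphic_map X X' h" "homeomorphic_map Y Y' k" "embeds_in X' Y'"
  obtains S \<phi> \<psi> where "homeomorphic_maps X (subtopology Y S) \<phi> \<psi>"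
proof -
  obtain S where S: "S \<subseteq> topspace Y'" "X' homeomorphic_space subtopology Y' S"
    using assms(3) by (auto simp: embeds_in_def)
  obtain k' where k': "homeomorphic_map Y' Y k'"
    using assms(2) homeomorphic_map_maps homeomorphic_maps_map by metis
  have "subtopology Y' S homeomorphic_space subtopology Y (k' ` S)"
  proof (rule homeomorphic_map_imp_homeomorphic_space)
    show "homeomorphic_map (subtopology Y' S) (subtopology Y (k' ` S)) k'"
      using S(1) homeomorphic_imp_surjective_map[OF k'] by (intro homeomorphic_map_subtopologies[OF k']) auto
  qed
  then have "X' homeomorphic_space subtopology Y (k' ` S)"
    by (rule homeomorphic_space_trans[OF S(2)])
  then have "X homeomorphic_space subtopology Y (k' ` S)"
    by (rule homeomorphic_space_trans[OF homeomorphic_map_imp_homeomorphic_space[OF assms(1)]])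
  then show thesis using that unfolding homeomorphic_space_def by metis
qed

section \<open>The incomparable continua\<close>

context coded_tree
begin

lemma transported_continuum:
  assumes inj: "inj_on h X"
  shows "linearly_ordered_continuum (transported h X)" "first_countable (transported h X)"
    "totally_pathwise_disconnected (transported h X)"
proof -
  interpret complete_dense_order X by (rule complete_dense_order_X)
  note hom = homeomorphic_map_transported[OF inj]
  note hs = homeomorphic_map_imp_homeomorphic_space[OF hom]
  have "topspace (transported h X) = h ` X"
    using homeomorphic_imp_surjective_map[OF hom] by simp
  moreover have "h Bot \<noteq> h Top"
    using inj_onD[OF inj _ Bot_in_X Top_in_X] Bot_less_Top by auto
  ultimately have "\<exists>x\<in>topspace (transported h X). \<exists>y\<in>topspace (transported h X). x \<noteq> y"
    using Bot_in_X Top_in_X by blast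
  then have "continuum (transported h X)"
    unfolding continuum_def
    using homeomorphic_compact_space[OF hs] homeomorphic_connected_space[OF hs]
      homeomorphic_Hausdorff_space[OF hs] compact_otop connected_otop Hausdorff_otop by simp
  then show "linearly_ordered_continuum (transported h X)"
    unfolding linearly_ordered_continuum_def using linearly_ordered_transported[OF inj] by simp
  have "first_countable (otop X)"
  proof (rule first_countable_otop)
    fix z assume "z \<in> X"
    then show "\<exists>E\<subseteq>X. countable E \<and> (\<forall>y\<in>X. y < z \<longrightarrow> (\<exists>e\<in>E. y < e \<and> e < z))
       \<and> (\<forall>y\<in>X. z < y \<longrightarrow> (\<exists>e\<in>E. z < e \<and> e < y))"
      using rat_truncs_subset countable_rat_truncs rat_truncs_dense
      by (intro exI[of _ "rat_truncs z"]) blast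
  qed
  then show "first_countable (transported h X)"
    using homeomorphic_space_first_countability[OF hs] by simp
  have "totally_pathwise_disconnected (otop X)"
  proof (rule totally_pathwise_disconnected_otop)
    fix x y G assume "x \<in> X" "y \<in> X" "x < y" "countable G" "G \<subseteq> X"
    then show "\<exists>u\<in>X. \<exists>v\<in>X. x < u \<and> u < v \<and> v < y \<and> (\<forall>g\<in>G. \<not> (u \<le> g \<and> g \<le> v))"
      using nowhere_separable by metis
  qed
  then show "totally_pathwise_disconnected (transported h X)"
    by (rule totally_pathwise_disconnected_homeomorphic[OF hom])
qed

lemma weight_transported:
  assumes inj: "inj_on h X" and A: "infinite A" "|UNIV :: omega1 set| \<le>o |A|"
  shows "weight (transported h X) =o |A|"
proof (rule weight_eqI)
  note hom = homeomorphic_map_transported[OF inj]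
  show "base_of (transported h X) ((`) h ` interval_base X truncs)"
    using base_of_homeomorphic_image[OF hom base_of_interval_base[OF truncs_subset truncs_dense]] .
  show "|(`) h ` interval_base X truncs| \<le>o |A|"
    using card_of_image card_of_interval_base[OF A(1) card_of_truncs[OF A]] ordLeq_transitive by blast
  fix B assume B: "base_of (transported h X) B"
  obtain U where U: "\<And>t. t \<in> A \<Longrightarrow> openin (otop X) (U t) \<and> U t \<noteq> {}"
    "\<And>s t z. s \<in> A \<Longrightarrow> t \<in> A \<Longrightarrow> z \<in> U s \<Longrightarrow> z \<in> U t \<Longrightarrow> s = t"
    using disjoint_open_intervals by metis
  show "|A| \<le>o |B|"
  proof (rule card_of_base_ge[OF B, of A "\<lambda>t. h ` U t"])
    show "openin (transported h X) (h ` U t) \<and> h ` U t \<noteq> {}" if "t \<in> A" for t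
      using U(1)[OF that] homeomorphic_map_openness_eq[OF hom] by blast
    fix s t z assume st: "s \<in> A" "t \<in> A" and z: "z \<in> h ` U s" "z \<in> h ` U t"
    then obtain x y where xy: "x \<in> U s" "y \<in> U t" "h x = h y" by auto
    have "U s \<subseteq> X" "U t \<subseteq> X" using U(1) st openin_subset topspace_otop by metis+
    then have "x = y" using inj_onD[OF inj xy(3)] xy(1,2) by blast
    then show "s = t" using U(2)[OF st] xy by blast
  qed
qed

lemma exists_injection_to_reals:
  assumes "infinite A" "|UNIV :: omega1 set| \<le>o |A|" "|A| \<le>o ctwo ^c natLeq"
  shows "\<exists>h :: pt \<Rightarrow> real. inj_on h X"
proof -
  have "|X| \<le>o ctwo ^c natLeq"
    by (rule card_of_X[OF ordLeq_transitive[OF card_of_truncs[OF assms(1,2)] assms(3)]])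
  then have "|X| \<le>o |UNIV :: real set|"
    by (rule ordLeq_ordIso_trans[OF _ ordIso_symmetric[OF card_of_reals]])
  then show ?thesis unfolding card_of_ordLeq[symmetric] by blast
qed

end

lemma embedding_determines_coded_set:
  assumes S: "coded_tree A S" and T: "coded_tree A T"
    and h: "inj_on h (node_tree.X (node A S))" and k: "inj_on k (node_tree.X (node A T))"
    and emb: "embeds_in (transported h (node_tree.X (node A S))) (transported k (node_tree.X (node A T)))"
  shows "S \<subseteq> Q \<union> T"
proof -
  let ?X = "node_tree.X (node A S)" and ?Y = "node_tree.X (node A T)"
  obtain R \<phi> \<psi> where hom: "homeomorphic_maps (otop ?X) (subtopology (otop ?Y) R) \<phi> \<psi>"
    using embeds_in_homeomorphic[OF homeomorphic_map_transported[OF h]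
        homeomorphic_map_transported[OF k] emb] .
  have cd: "complete_dense_order ?X" "complete_dense_order ?Y"
    using coded_tree.complete_dense_order_X S T by auto
  show ?thesis
  proof (rule coded_set_mono[OF S T])
    show "inj_on \<phi> ?X"
      using hom by (intro inj_on_inverseI[where g = \<psi>]) (auto simp: homeomorphic_maps_def)
    show "\<phi> ` segm ?X u v = segm ?Y (\<phi> u) (\<phi> v)" if "u \<in> ?X" "v \<in> ?X" for u v
      using embedding_preserves_segm[OF cd hom that] .
    show "\<phi> ` ?X \<subseteq> ?Y"
      using hom unfolding homeomorphic_maps_def continuous_map_in_subtopology
      by (auto simp: continuous_map_def)
  qed
qed

theorem theorem4:
  fixes \<kappa> :: "'k rel"
  assumes "Card_order \<kappa>" and "natLeq <o \<kappa>" and "\<kappa> \<le>o ctwo ^c natLeq"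
  shows "\<exists>F :: real topology set.
           |F| =o ctwo ^c \<kappa> \<and>
           incomparable_spaces F \<and>
           (\<forall>X\<in>F. linearly_ordered_continuum X \<and> first_countable X \<and>
                  totally_pathwise_disconnected X \<and> weight X =o \<kappa>)"
proof -
  obtain A where A: "|A| =o \<kappa>" "Q \<subseteq> A" "A \<subseteq> {0<..<1}"
    "\<And>u v. 0 \<le> u \<Longrightarrow> u < v \<Longrightarrow> v \<le> 1 \<Longrightarrow> uncountable (A \<inter> {u<..<v})"
    using dense_uncountable_set[OF assms] by metis
  have "uncountable A"
    using A(4)[of 0 1] countable_subset[of "A \<inter> {0<..<1}" A] by auto
  then have inf: "infinite A" "infinite (A - Q)"
    using uncountable_infinite uncountable_minus_countable countable_Q by blast+
  have "|UNIV :: omega1 set| \<le>o \<kappa>"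
    by (rule ordIso_ordLeq_trans[OF card_omega1 cardSuc_least[OF natLeq_Card_order assms(1,2)]])
  then have om: "|UNIV :: omega1 set| \<le>o |A|"
    by (rule ordLeq_ordIso_trans[OF _ ordIso_symmetric[OF A(1)]])
  have le_c: "|A| \<le>o ctwo ^c natLeq" by (rule ordIso_ordLeq_trans[OF A(1) assms(3)])
  have "|(A - Q) \<union> Q| \<le>o |A - Q|"
    using inf(2) countable_Q by (intro card_of_Un_le ordLeq_refl card_of_Card_order card_of_countable_le)
  moreover have "(A - Q) \<union> Q = A" using A(2) by blast
  ultimately have "|A - Q| =o |A|"
    using card_of_mono1[of "A - Q" A] by (simp add: ordIso_iff_ordLeq)
  then have AQ: "|A - Q| =o \<kappa>" using A(1) ordIso_transitive by blast
  obtain \<sigma> where \<sigma>: "\<And>Z. \<sigma> Z \<subseteq> A - Q"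
    "\<And>Z Z'. Z \<subseteq> A - Q \<Longrightarrow> Z' \<subseteq> A - Q \<Longrightarrow> \<sigma> Z \<subseteq> \<sigma> Z' \<Longrightarrow> Z = Z'"
    using antichain_of_subsets[OF inf(2)] by metis
  have ct: "coded_tree A (\<sigma> Z)" for Z
    using A \<sigma>(1)[of Z] by unfold_locales auto
  define X where "X = (\<lambda>Z. node_tree.X (node A (\<sigma> Z)))"
  have ex_h: "\<exists>h :: pt \<Rightarrow> real. inj_on h (X Z)" for Z
    unfolding X_def by (rule coded_tree.exists_injection_to_reals[OF ct inf(1) om le_c])
  obtain h :: "real set \<Rightarrow> pt \<Rightarrow> real" where h: "\<And>Z. inj_on (h Z) (X Z)"
    using ex_h by metis
  define \<tau> where "\<tau> = (\<lambda>Z. transported (h Z) (X Z))"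
  have emb: "Z = Z'" if "Z \<subseteq> A - Q" "Z' \<subseteq> A - Q" "embeds_in (\<tau> Z) (\<tau> Z')" for Z Z'
  proof -
    have "\<sigma> Z \<subseteq> Q \<union> \<sigma> Z'"
      using embedding_determines_coded_set[OF ct ct h[unfolded X_def] h[unfolded X_def]] that(3)
      unfolding \<tau>_def X_def by blast
    then have "\<sigma> Z \<subseteq> \<sigma> Z'" using \<sigma>(1) by blast
    then show ?thesis using \<sigma>(2) that(1,2) by blast
  qed
  have refl: "embeds_in T T" for T :: "real topology"
    unfolding embeds_in_def by (intro exI[of _ "topspace T"]) (simp add: homeomorphic_space_refl)
  show ?thesis
  proof (intro exI[of _ "\<tau> ` Pow (A - Q)"] conjI ballI)
    have "inj_on \<tau> (Pow (A - Q))" using emb refl by (metis PowD inj_onI)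
    then have "bij_betw \<tau> (Pow (A - Q)) (\<tau> ` Pow (A - Q))" by (simp add: bij_betw_def)
    then have "|\<tau> ` Pow (A - Q)| =o |Pow (A - Q)|" by (rule ordIso_symmetric[OF card_of_ordIsoI])
    also have "|Pow (A - Q)| =o ctwo ^c |A - Q|" by (rule card_of_Pow_cexp)
    also have "ctwo ^c |A - Q| =o ctwo ^c \<kappa>"
      by (rule cexp_cong2[OF AQ Card_order_ctwo card_of_Card_order])
    finally show "|\<tau> ` Pow (A - Q)| =o ctwo ^c \<kappa>" .
    show "incomparable_spaces (\<tau> ` Pow (A - Q))"
      unfolding incomparable_spaces_def pairwise_def using emb by blast
    fix T assume "T \<in> \<tau> ` Pow (A - Q)"
    then obtain Z where T: "T = transported (h Z) (node_tree.X (node A (\<sigma> Z)))"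
      by (auto simp: \<tau>_def X_def)
    note inj = h[of Z, unfolded X_def]
    show "linearly_ordered_continuum T" "first_countable T" "totally_pathwise_disconnected T"
      unfolding T using coded_tree.transported_continuum[OF ct inj] by blast+
    have "weight T =o |A|" unfolding T by (rule coded_tree.weight_transported[OF ct inj inf(1) om])
    then show "weight T =o \<kappa>" using A(1) ordIso_transitive by blast
  qed
qed

end
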